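(* Let $n\in\{2,3\}$, let $\Omega\subset\mathbb{R}^n$ and $\Gamma=\partial\Omega$ be as in the context, and let $\mathcal{T}_h$ be a quasi uniform, shape regular mesh on $\Gamma$ of mesh size $h$, with set of nodes $\mathcal{N}$ and node patches $\tau_{\mathbf{y}}$, $\mathbf{y}\in\mathcal{N}$. Let $\widetilde\Pi:H^{-1/2}(\Gamma)\to H^{-1/2}(\Gamma)$ be a bounded projector satisfying the following assumption: there exist functions $\varphi_{\mathbf{y}}\in W^{1,\infty}_0(\tau_{\mathbf{y}})$, $\mathbf{y}\in\mathcal{N}$, with $$\sum_{\mathbf{y}\in\mathcal{N}}\varphi_{\mathbf{y}}=1,\qquad \|\varphi_{\mathbf{y}}\|_{L^\infty(\tau_{\mathbf{y}})}\le C_0,\qquad |\varphi_{\mathbf{y}}|_{W^{1,\infty}(\tau_{\mathbf{y}})}\le C_0\,h^{-1},$$ with $C_0>0$ independent of $\mathbf{y}$ and $h$, such that for all $\zeta\in H^{-1/2}(\Gamma)$ $$\langle\zeta-\widetilde\Pi(\zeta),\varphi_{\mathbf{y}}\rangle_\Gamma=0\quad\text{for all }\mathbf{y}\in\mathcal{N}.$$ Then there exist positive constants $c,C$, independent of $h$ (depending only on $\Gamma$, on the shape regularity and quasi uniformity constants of the mesh, on $C_0$, and on an upper bound for the operator norm of $\widetilde\Pi$), such that for all $\zeta\in H^{-1/2}(\Gamma)$ $$c\,\|\zeta\|^2_{-1/2,\Gamma}\le\|\widetilde\Pi\zeta\|^2_{-1/2,\Gamma}+\sum_{\mathbf{y}\in\mathcal{N}}\|\zeta-\widetilde\Pi\zeta\|^2_{\widetilde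 H^{-1/2}(\tau_{\mathbf{y}})}\le C\,\|\zeta\|^2_{-1/2,\Gamma}.$$
   Context: Domain. $\Omega\subset\mathbb{R}^n$ ($n=2,3$) is a bounded, simply connected, possibly curvilinear polygon ($n=2$) or polyhedron ($n=3$) with Lipschitz boundary $\Gamma=\partial\Omega$, such that the geodesic distance on $\Gamma$ is bounded from above by a constant times the Euclidean distance in $\mathbb{R}^n$. Mesh. $\mathcal{T}_h$ is a decomposition, in the usual finite element sense, of $\Gamma$ into (possibly curvilinear) segments ($n=2$) or triangles ($n=3$), of mesh size $h$. It is quasi uniform (the diameters of all elements are comparable to $h$) and shape regular (the ratio of the diameter of an element to that of its largest inscribed ball is bounded), with constants fixed independently of $h$. $\mathcal{N}$ is the set of nodes (vertices) of $\mathcal{T}_h$, and for $\mathbf{y}\in\mathcal{N}$ the patch of elements sharing $\mathbf{y}$ as a vertex is $\tau_{\mathbf{y}}=\bigcup_{T\in\mathcal{T}_h:\ \mathbf{y}\in\partial T}T$. Norms. For $\tau\subseteq\Gamma$, $\|\cdot\|_{0,\tau}$ is the $L^2(\tau)$ norm (with respect to the surface/arclength measure on $\Gamma$), and $$|v|^2_{1/2,\tau}=\int_\tau dt\int_\tau ds\,\frac{|v(t)-v(s)|^2}{|t-s|^n},\qquad \|v\|^2_{1/2,\tau}=\|v\|^2_{0,\tau}+|v|^2_{1/2,\tau}.$$ $H^{1/2}(\tau)$ is the space of $v\in L^2(\tau)$ with $\|v\|_{1/2,\tau}<\infty$. $H^{1/2}_{00}(\tau)$ is the subspace of those $v\in H^{1/2}(\tau)$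 whose extension by zero $\mathscr{E}(v)$ to $\Gamma$ belongs to $H^{1/2}(\Gamma)$, with norm $\|v\|_{H^{1/2}_{00}(\tau)}=|\mathscr{E}(v)|_{1/2,\Gamma}$; $v$ and $\mathscr{E}(v)$ are identified. Dual norms. $H^{-1/2}(\Gamma)=(H^{1/2}(\Gamma))'$ and $\widetilde H^{-1/2}(\tau)=(H^{1/2}_{00}(\tau))'$, with duality pairings denoted $\langle\cdot,\cdot\rangle_\Gamma$, $\langle\cdot,\cdot\rangle_\tau$ (extending the $L^2$ scalar product) and norms $$\|\zeta\|_{-1/2,\Gamma}=\sup_{0\ne v\in H^{1/2}(\Gamma)}\frac{\langle\zeta,v\rangle_\Gamma}{\|v\|_{1/2,\Gamma}},\qquad \|\zeta\|_{\widetilde H^{-1/2}(\tau)}=\sup_{0\ne v\in H^{1/2}_{00}(\tau)}\frac{\langle\zeta,v\rangle_\tau}{\|v\|_{H^{1/2}_{00}(\tau)}}.$$ An element $\zeta\in H^{-1/2}(\Gamma)$ is regarded as an element of $\widetilde H^{-1/2}(\tau)$ by restriction: $\langle\zeta,v\rangle_\tau=\langle\zeta,\mathscr{E}(v)\rangle_\Gamma$. $W^{1,\infty}_0(\tau_{\mathbf{y}})$ denotes the functions in $W^{1,\infty}(\tau_{\mathbf{y}})$ (Lipschitz functions) vanishing on $\partial\tau_{\mathbf{y}}$, extended by zero to $\Gamma$; $|\cdot|_{W^{1,\infty}}$ is the seminorm given by the $L^\infty$ norm of the (tangential) gradient. A projector is a linear operator with $\widetilde\Pi\circ\widetilde\Pi=\widetilde\Pi$.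 *)

theory Defs
  imports "HOL-Probability.Essential_Supremum"
begin

section \<open>Surface measure and geodesic distance\<close>

text \<open>The \<open>s\<close>-dimensional Hausdorff measure on the Borel sets, for \<open>s \<ge> 1\<close>, normalised so
  that it agrees with arclength (\<open>s = 1\<close>) and surface area (\<open>s = 2\<close>). Covering sets have to
  be required to be bounded, because \<^const>\<open>diameter\<close> is \<open>0\<close> on unbounded sets.\<close>

definition hausdorff_outer :: "nat \<Rightarrow> 'a::metric_space set \<Rightarrow> ennreal" where
  "hausdorff_outer s A = ennreal (unit_ball_vol (real s) / 2 ^ s) *
     (SUP \<delta>\<in>{0<..}. INF E\<in>{E. A \<subseteq> (\<Union>i::nat. E i) \<and> (\<forall>i. bounded (E i) \<and> diameter (E i) \<le> \<delta>)}.
        \<Sum>i. ennreal (diameter (E i) ^ s))"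

definition hausdorff_measure :: "nat \<Rightarrow> 'a::metric_space measure" where
  "hausdorff_measure s = measure_of UNIV (sets borel) (hausdorff_outer s)"

definition surf :: "(real^'n) set \<Rightarrow> (real^'n) measure" where
  "surf \<tau> = restrict_space (hausdorff_measure (CARD('n) - 1)) \<tau>"

definition path_length :: "(real \<Rightarrow> 'a::metric_space) \<Rightarrow> ennreal" where
  "path_length g = (SUP (N, t)\<in>{(N::nat, t::nat \<Rightarrow> real). mono t \<and> range t \<subseteq> {0..1}}.
     \<Sum>i<N. ennreal (dist (g (t i)) (g (t (Suc i)))))"

text \<open>The value is \<open>\<infinity>\<close> if no rectifiable path in \<open>S\<close> joins the two points.\<close>

definition geodesic_dist :: "'a::metric_space set \<Rightarrow> 'a \<Rightarrow> 'a \<Rightarrow> ennreal" where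
  "geodesic_dist S x y =
     (INF g\<in>{g. path g \<and> path_image g \<subseteq> S \<and> pathstart g = x \<and> pathfinish g = y}. path_length g)"

section \<open>Curvilinear simplices, meshes and domains\<close>

text \<open>The reference element is the standard \<open>(n - 1)\<close>-simplex in \<open>\<real>\<^sup>n\<close>: a segment for
  \<open>n = 2\<close>, a triangle for \<open>n = 3\<close>.\<close>

definition ref_simplex :: "(real^'n) set" where
  "ref_simplex = convex hull Basis"

text \<open>A curvilinear simplex is a \<open>C\<^sup>1\<close> embedding of the reference element; it is given by its
  parametrisation because its vertices and edges cannot be recovered from the point set.
  The vectors with vanishing coordinate sum are the directions parallel to the reference
  element. Only the values of \<open>\<gamma>\<close> on the reference element matter.\<close>

definition curvilinear_simplex :: "(real^'n \<Rightarrow> real^'n) \<Rightarrow> bool" where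
  "curvilinear_simplex \<gamma> \<longleftrightarrow> inj_on \<gamma> ref_simplex \<and>
     (\<exists>\<gamma>' :: real^'n \<Rightarrow> ((real^'n) \<Rightarrow>\<^sub>L (real^'n)).
        continuous_on ref_simplex \<gamma>' \<and>
        (\<forall>x\<in>ref_simplex. (\<gamma> has_derivative blinfun_apply (\<gamma>' x)) (at x within ref_simplex) \<and>
           inj_on (blinfun_apply (\<gamma>' x)) {v. (\<Sum>i\<in>UNIV. v $ i) = 0}))"

definition elem :: "(real^'n \<Rightarrow> real^'n) \<Rightarrow> (real^'n) set" where
  "elem \<gamma> = \<gamma> ` ref_simplex"

text \<open>A decomposition in the usual finite element sense: two distinct elements meet in a
  common proper face, that is, in a common edge, in a common vertex, or not at all.\<close>

definition conforming_mesh :: "(real^'n) set \<Rightarrow> (real^'n \<Rightarrow> real^'n) set \<Rightarrow> bool" where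
  "conforming_mesh \<Gamma> \<T> \<longleftrightarrow> finite \<T> \<and> (\<forall>\<gamma>\<in>\<T>. curvilinear_simplex \<gamma>) \<and>
     (\<Union>\<gamma>\<in>\<T>. elem \<gamma>) = \<Gamma> \<and>
     (\<forall>\<gamma>\<in>\<T>. \<forall>\<delta>\<in>\<T>. \<gamma> \<noteq> \<delta> \<longrightarrow>
        (\<exists>F G. F face_of ref_simplex \<and> F \<noteq> ref_simplex \<and> G face_of ref_simplex \<and> G \<noteq> ref_simplex \<and>
               elem \<gamma> \<inter> elem \<delta> = \<gamma> ` F \<and> elem \<gamma> \<inter> elem \<delta> = \<delta> ` G))"

definition nodes :: "(real^'n \<Rightarrow> real^'n) set \<Rightarrow> (real^'n) set" where
  "nodes \<T> = (\<Union>\<gamma>\<in>\<T>. \<gamma> ` Basis)"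

definition patch :: "(real^'n \<Rightarrow> real^'n) set \<Rightarrow> real^'n \<Rightarrow> (real^'n) set" where
  "patch \<T> y = \<Union> {elem \<gamma> | \<gamma>. \<gamma> \<in> \<T> \<and> y \<in> \<gamma> ` Basis}"

definition quasi_uniform :: "real \<Rightarrow> real \<Rightarrow> (real^'n \<Rightarrow> real^'n) set \<Rightarrow> bool" where
  "quasi_uniform q h \<T> \<longleftrightarrow>
     (\<forall>\<gamma>\<in>\<T>. diameter (elem \<gamma>) \<le> q * h \<and> h \<le> q * diameter (elem \<gamma>))"

text \<open>Inscribed balls are geodesic balls of \<open>\<Gamma>\<close>, i.e. ordinary discs (intervals) for flat
  elements. The existence of one inscribed ball as below says that the ratio of the diameter
  of the element to that of its largest inscribed ball is at most \<open>\<kappa>\<close>.\<close>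

definition shape_regular :: "(real^'n) set \<Rightarrow> real \<Rightarrow> (real^'n \<Rightarrow> real^'n) set \<Rightarrow> bool" where
  "shape_regular \<Gamma> \<kappa> \<T> \<longleftrightarrow>
     (\<forall>\<gamma>\<in>\<T>. \<exists>x\<in>elem \<gamma>. \<exists>r>0. {y\<in>\<Gamma>. geodesic_dist \<Gamma> x y < ennreal r} \<subseteq> elem \<gamma> \<and>
        diameter (elem \<gamma>) \<le> \<kappa> * (2 * r))"

text \<open>Near each boundary point, \<open>\<Omega>\<close> is the set above the graph of a Lipschitz function over
  the hyperplane orthogonal to some direction \<open>e\<close>.\<close>

definition lipschitz_boundary :: "(real^'n) set \<Rightarrow> bool" where
  "lipschitz_boundary \<Omega> \<longleftrightarrow>
     (\<forall>x\<in>frontier \<Omega>. \<exists>r>0. \<exists>e. norm e = 1 \<and>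
        (\<exists>g L. L-lipschitz_on {w. w \<bullet> e = 0} g \<and>
           \<Omega> \<inter> ball x r = {y\<in>ball x r. g (y - (y \<bullet> e) *\<^sub>R e) < y \<bullet> e}))"

text \<open>A (possibly curvilinear) polygon or polyhedron is a domain whose boundary is composed of
  finitely many (possibly curvilinear) simplices.\<close>

definition admissible_domain :: "(real^'n) set \<Rightarrow> bool" where
  "admissible_domain \<Omega> \<longleftrightarrow>
     open \<Omega> \<and> \<Omega> \<noteq> {} \<and> bounded \<Omega> \<and> simply_connected \<Omega> \<and>
     (\<exists>\<T>. conforming_mesh (frontier \<Omega>) \<T>) \<and>
     lipschitz_boundary \<Omega> \<and>
     (\<exists>K. \<forall>x\<in>frontier \<Omega>. \<forall>y\<in>frontier \<Omega>.
        geodesic_dist (frontier \<Omega>) x y \<le> ennreal (K * dist x y))"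

section \<open>Fractional Sobolev spaces and their duals\<close>

text \<open>Elements of the spaces are represented by functions on the whole of \<open>\<real>\<^sup>n\<close>, of which only
  the values on \<open>\<tau>\<close> (up to null sets) matter.\<close>

definition L2_sq :: "(real^'n) set \<Rightarrow> (real^'n \<Rightarrow> real) \<Rightarrow> ennreal" where
  "L2_sq \<tau> v = (\<integral>\<^sup>+t. ennreal ((v t)\<^sup>2) \<partial>surf \<tau>)"

definition half_seminorm_sq :: "(real^'n) set \<Rightarrow> (real^'n \<Rightarrow> real) \<Rightarrow> ennreal" where
  "half_seminorm_sq \<tau> v =
     (\<integral>\<^sup>+t. (\<integral>\<^sup>+s. ennreal (\<bar>v t - v s\<bar>\<^sup>2 / norm (t - s) ^ CARD('n)) \<partial>surf \<tau>) \<partial>surf \<tau>)"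

definition Hhalf :: "(real^'n) set \<Rightarrow> (real^'n \<Rightarrow> real) set" where
  "Hhalf \<tau> = {v. v \<in> borel_measurable (surf \<tau>) \<and> L2_sq \<tau> v + half_seminorm_sq \<tau> v < \<infinity>}"

definition Hhalf_norm :: "(real^'n) set \<Rightarrow> (real^'n \<Rightarrow> real) \<Rightarrow> real" where
  "Hhalf_norm \<tau> v = sqrt (enn2real (L2_sq \<tau> v + half_seminorm_sq \<tau> v))"

definition zero_ext :: "(real^'n) set \<Rightarrow> (real^'n \<Rightarrow> real) \<Rightarrow> real^'n \<Rightarrow> real" where
  "zero_ext \<tau> v x = (if x \<in> \<tau> then v x else 0)"

definition H00 :: "(real^'n) set \<Rightarrow> (real^'n) set \<Rightarrow> (real^'n \<Rightarrow> real) set" where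
  "H00 \<Gamma> \<tau> = {v \<in> Hhalf \<tau>. zero_ext \<tau> v \<in> Hhalf \<Gamma>}"

definition H00_norm :: "(real^'n) set \<Rightarrow> (real^'n) set \<Rightarrow> (real^'n \<Rightarrow> real) \<Rightarrow> real" where
  "H00_norm \<Gamma> \<tau> v = sqrt (enn2real (half_seminorm_sq \<Gamma> (zero_ext \<tau> v)))"

text \<open>The duality pairing of \<open>\<zeta>\<close> and \<open>v\<close> is the application \<open>\<zeta> v\<close>. Functionals are normalised
  to vanish off \<open>Hhalf \<Gamma>\<close>, so that equality of functionals is equality of functions;
  boundedness forces them to respect equality almost everywhere.\<close>

definition Hmhalf :: "(real^'n) set \<Rightarrow> ((real^'n \<Rightarrow> real) \<Rightarrow> real) set" where
  "Hmhalf \<Gamma> = {\<zeta>. (\<forall>v. v \<notin> Hhalf \<Gamma> \<longrightarrow> \<zeta> v = 0) \<and>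
     (\<forall>v\<in>Hhalf \<Gamma>. \<forall>w\<in>Hhalf \<Gamma>. \<forall>a b. \<zeta> (\<lambda>x. a * v x + b * w x) = a * \<zeta> v + b * \<zeta> w) \<and>
     (\<exists>B. \<forall>v\<in>Hhalf \<Gamma>. \<bar>\<zeta> v\<bar> \<le> B * Hhalf_norm \<Gamma> v)}"

text \<open>The dual norms are suprema in \<open>[0,\<infinity>]\<close>; \<open>ennreal\<close> replaces negative values of \<open>\<zeta> v\<close> by
  \<open>0\<close>, which leaves the supremum unchanged since \<open>v\<close> can be replaced by \<open>-v\<close>. A quotient of
  a positive number by \<open>0\<close> is \<open>\<infinity>\<close>.\<close>

definition mhalf_norm :: "(real^'n) set \<Rightarrow> ((real^'n \<Rightarrow> real) \<Rightarrow> real) \<Rightarrow> ennreal" where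
  "mhalf_norm \<Gamma> \<zeta> =
     (SUP v\<in>{v\<in>Hhalf \<Gamma>. \<not> (AE x in surf \<Gamma>. v x = 0)}. ennreal (\<zeta> v) / ennreal (Hhalf_norm \<Gamma> v))"

definition mhalf_tilde_norm ::
    "(real^'n) set \<Rightarrow> (real^'n) set \<Rightarrow> ((real^'n \<Rightarrow> real) \<Rightarrow> real) \<Rightarrow> ennreal" where
  "mhalf_tilde_norm \<Gamma> \<tau> \<zeta> =
     (SUP v\<in>{v\<in>H00 \<Gamma> \<tau>. \<not> (AE x in surf \<tau>. v x = 0)}. ennreal (\<zeta> v) / ennreal (H00_norm \<Gamma> \<tau> v))"

definition restrict_functional ::
    "(real^'n) set \<Rightarrow> (real^'n) set \<Rightarrow> ((real^'n \<Rightarrow> real) \<Rightarrow> real) \<Rightarrow> (real^'n \<Rightarrow> real) \<Rightarrow> real" where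
  "restrict_functional \<Gamma> \<tau> \<zeta> v = (if v \<in> H00 \<Gamma> \<tau> then \<zeta> (zero_ext \<tau> v) else 0)"

definition Hmhalf_projector ::
    "(real^'n) set \<Rightarrow> (((real^'n \<Rightarrow> real) \<Rightarrow> real) \<Rightarrow> ((real^'n \<Rightarrow> real) \<Rightarrow> real)) \<Rightarrow> bool" where
  "Hmhalf_projector \<Gamma> P \<longleftrightarrow>
     (\<forall>\<zeta>\<in>Hmhalf \<Gamma>. P \<zeta> \<in> Hmhalf \<Gamma>) \<and>
     (\<forall>\<zeta>\<in>Hmhalf \<Gamma>. \<forall>\<xi>\<in>Hmhalf \<Gamma>. \<forall>a b.
        P (\<lambda>v. a * \<zeta> v + b * \<xi> v) = (\<lambda>v. a * P \<zeta> v + b * P \<xi> v)) \<and>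
     (\<forall>\<zeta>\<in>Hmhalf \<Gamma>. P (P \<zeta>) = P \<zeta>)"

section \<open>Lipschitz functions on patches\<close>

text \<open>The span of the tangent cone of \<open>S\<close> at \<open>x\<close>. Requiring the gradient to lie in it makes the
  gradient unique, although \<open>f\<close> is only differentiated along \<open>S\<close>.\<close>

definition tangent_space :: "'a::real_normed_vector set \<Rightarrow> 'a \<Rightarrow> 'a set" where
  "tangent_space S x = span {v. \<exists>X c. (\<forall>k::nat. X k \<in> S \<and> c k > (0::real)) \<and>
      X \<longlonglongrightarrow> x \<and> (\<lambda>k. c k *\<^sub>R (X k - x)) \<longlonglongrightarrow> v}"

definition has_tangential_gradient ::
    "('a::real_inner \<Rightarrow> real) \<Rightarrow> 'a \<Rightarrow> 'a set \<Rightarrow> 'a \<Rightarrow> bool" where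
  "has_tangential_gradient f g S x \<longleftrightarrow>
     g \<in> tangent_space S x \<and> (f has_derivative (\<lambda>v. g \<bullet> v)) (at x within S)"

definition Linf_norm :: "(real^'n) set \<Rightarrow> (real^'n \<Rightarrow> real) \<Rightarrow> ennreal" where
  "Linf_norm \<tau> f = esssup (surf \<tau>) (\<lambda>x. ennreal \<bar>f x\<bar>)"

text \<open>The essential supremum of the norm of the tangential gradient, written out, because the
  gradient is defined almost everywhere only.\<close>

definition W1inf_seminorm :: "(real^'n) set \<Rightarrow> (real^'n \<Rightarrow> real) \<Rightarrow> ennreal" where
  "W1inf_seminorm \<tau> f =
     Inf {L. AE x in surf \<tau>. \<exists>g. has_tangential_gradient f g \<tau> x \<and> ennreal (norm g) \<le> L}"

text \<open>The boundary of a patch is its boundary relative to \<open>\<Gamma>\<close>.\<close>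

definition W1inf_0 :: "(real^'n) set \<Rightarrow> (real^'n) set \<Rightarrow> (real^'n \<Rightarrow> real) set" where
  "W1inf_0 \<Gamma> \<tau> = {f. (\<exists>L. L-lipschitz_on \<tau> f) \<and>
     (\<forall>x\<in>(top_of_set \<Gamma>) frontier_of \<tau>. f x = 0) \<and> (\<forall>x\<in>\<Gamma> - \<tau>. f x = 0)}"

end

theory Submission
  imports Defs
begin

text \<open>Let \<open>\<xi> = \<zeta> - P \<zeta>\<close>. Since \<open>\<xi>\<close> annihilates the cut-off functions \<open>\<phi>\<^sub>y\<close>, which sum up to \<open>1\<close>,
  \<open>\<xi>(v) = \<Sum>\<^sub>y \<xi>(\<phi>\<^sub>y (v - v(t\<^sub>y)))\<close> for arbitrary points \<open>t\<^sub>y\<close>. The energy of \<open>\<phi>\<^sub>y (v - v(t\<^sub>y))\<close> is bounded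
  by the energy of \<open>v\<close> near the patch: the contribution of the differences of \<open>\<phi>\<^sub>y\<close> is at most
  \<open>C / h\<close> times the square of the \<open>L\<^sup>2\<close> norm of \<open>v - v(t\<^sub>y)\<close> on the patch, which for suitable \<open>t\<^sub>y\<close> is at
  most \<open>C h\<close> times the energy on the patch. Summing up with the finite overlap of the patches
  gives the lower bound. For the upper bound, \<open>\<xi>\<close> is tested with \<open>\<Sum>\<^sub>y \<alpha>\<^sub>y w\<^sub>y\<close>, where \<open>w\<^sub>y\<close> almost
  attains the dual norm \<open>\<alpha>\<^sub>y\<close> of \<open>\<xi>\<close> on the patch of \<open>y\<close>.

  The measure of \<open>\<Gamma>\<close> in a ball of radius \<open>r\<close> is comparable to \<open>r\<^sup>n\<^sup>-\<^sup>1\<close>, from above by counting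
  separated points of a Lipschitz graph, and from below by comparing a cylinder over the graph
  with its covers in Lebesgue measure. The patches overlap finitely because the inscribed balls of
  distinct elements are disjoint, proper faces of a simplex having no relative interior points. The
  almost everywhere gradient bound makes \<open>\<phi>\<^sub>y\<close> Lipschitz because almost every line in a chart
  meets the exceptional set in a null set.\<close>

section \<open>Separated sets and covers of graphs\<close>

text \<open>The estimates therefore use only metric data: diameters, inscribed balls, and the
  two-sided growth of the surface measure. The seminorm is nonlocal, so the energy of a cut-off
  product cannot be confined to pairs of points in one patch. It is estimated over patch times
  \<Gamma>, and the sum over the nodes counts overlaps in the first variable only. The two powers of
  \<open>h\<close> arise as follows. The factor \<open>1 / h\<close> is the integral of
  \<open>min(1, |s-t|/h)^2 / |s-t|^n\<close> in \<open>t\<close>; the Poincare constant of a patch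
  is of the order of diameter\<open>^n\<close> over mass, that is \<open>h^n / h^(n-1) = h\<close>.
  The Lipschitz constant contained in \<open>W1inf_0\<close> is only known to exist and may depend
  on the mesh. Uniform control comes from the gradient bound alone, which holds almost everywhere
  and in a patch only; it has to be turned into a bound for differences on all of \<Gamma>.\<close>

lemma card_separated_le:
  fixes Q :: "'a::euclidean_space set"
  assumes "finite Q" "Q \<subseteq> cball x R" "\<rho> > 0" "R \<ge> 0"
    and sep: "\<And>p q. p \<in> Q \<Longrightarrow> q \<in> Q \<Longrightarrow> p \<noteq> q \<Longrightarrow> \<rho> \<le> dist p q"
  shows "real (card Q) \<le> (2 * R / \<rho> + 1) ^ DIM('a)"
proof -
  let ?V = "unit_ball_vol (real DIM('a))"
  have V: "?V > 0" by simp
  \<comment> \<open>Packing by volume: these balls are disjoint and fit into a ball of radius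
    \<open>R + \<rho>/2\<close>; the ratio of the two radii is the base of the bound.\<close>
  have disj: "disjoint_family_on (\<lambda>p. ball p (\<rho>/2)) Q"
    unfolding disjoint_family_on_def
  proof (intro ballI impI)
    fix p q assume "p \<in> Q" "q \<in> Q" "p \<noteq> q"
    then have "\<rho> \<le> dist p q" by (rule sep)
    then show "ball p (\<rho>/2) \<inter> ball q (\<rho>/2) = {}"
      by (intro disjoint_ballI) simp
  qed
  have "(\<Union>p\<in>Q. ball p (\<rho>/2)) \<subseteq> cball x (R + \<rho>/2)"
  proof
    fix z assume "z \<in> (\<Union>p\<in>Q. ball p (\<rho>/2))"
    then obtain p where "p \<in> Q" "dist p z < \<rho>/2" by auto
    moreover have "dist x p \<le> R" using \<open>p \<in> Q\<close> assms(2) by auto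
    ultimately show "z \<in> cball x (R + \<rho>/2)" using dist_triangle[of x z p] by simp
  qed
  then have "emeasure lborel (\<Union>p\<in>Q. ball p (\<rho>/2)) \<le> emeasure lborel (cball x (R + \<rho>/2))"
    by (intro emeasure_mono) auto
  moreover have "emeasure lborel (\<Union>p\<in>Q. ball p (\<rho>/2)) = (\<Sum>p\<in>Q. emeasure lborel (ball p (\<rho>/2)))"
    using disj \<open>finite Q\<close> by (intro sum_emeasure[symmetric]) auto
  moreover have "(\<Sum>p\<in>Q. emeasure lborel (ball p (\<rho>/2))) = ennreal (real (card Q) * (?V * (\<rho>/2) ^ DIM('a)))"
    using assms by (simp add: emeasure_ball ennreal_of_nat_eq_real_of_nat ennreal_mult)
  moreover have "emeasure lborel (cball x (R + \<rho>/2)) = ennreal (?V * (R + \<rho>/2) ^ DIM('a))"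
    using assms by (subst emeasure_cball) auto
  ultimately have "ennreal (real (card Q) * (?V * (\<rho>/2) ^ DIM('a))) \<le> ennreal (?V * (R + \<rho>/2) ^ DIM('a))"
    by simp
  then have "real (card Q) * (?V * (\<rho>/2) ^ DIM('a)) \<le> ?V * (R + \<rho>/2) ^ DIM('a)"
    using assms V by (subst (asm) ennreal_le_iff) auto
  then have "?V * (real (card Q) * (\<rho>/2) ^ DIM('a)) \<le> ?V * (R + \<rho>/2) ^ DIM('a)"
    by (simp add: algebra_simps)
  then have "real (card Q) * (\<rho>/2) ^ DIM('a) \<le> (R + \<rho>/2) ^ DIM('a)"
    using V by (simp only: mult_le_cancel_left_pos)
  then have "real (card Q) \<le> (R + \<rho>/2) ^ DIM('a) / (\<rho>/2) ^ DIM('a)"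
    using assms by (simp add: pos_le_divide_eq)
  also have "\<dots> = ((R + \<rho>/2) / (\<rho>/2)) ^ DIM('a)" by (rule power_divide[symmetric])
  also have "(R + \<rho>/2) / (\<rho>/2) = 2 * R / \<rho> + 1" using assms by (simp add: field_simps)
  finally show ?thesis .
qed

text \<open>A separated subset of largest cardinality is a net, since an uncovered point could be
  added to it. A largest one exists because the packing bound limits all these
  cardinalities.\<close>

lemma separated_net_exists:
  fixes A :: "'a::euclidean_space set"
  assumes "bounded A" "\<delta> > 0"
  obtains P where "finite P" "P \<subseteq> A" "A \<subseteq> (\<Union>p\<in>P. cball p \<delta>)"
    "\<And>p q. p \<in> P \<Longrightarrow> q \<in> P \<Longrightarrow> p \<noteq> q \<Longrightarrow> \<delta> \<le> dist p q"
proof -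
  obtain R where "0 < R" "A \<subseteq> ball 0 R" using bounded_subset_ballD[OF assms(1), of 0] by blast
  then have R: "A \<subseteq> cball 0 R" "R \<ge> 0" by (auto intro: less_imp_le)
  define S where "S = {P. finite P \<and> P \<subseteq> A \<and> (\<forall>p\<in>P. \<forall>q\<in>P. p \<noteq> q \<longrightarrow> \<delta> \<le> dist p q)}"
  have "\<forall>P. P \<in> S \<longrightarrow> card P < Suc (nat \<lceil>(2 * R / \<delta> + 1) ^ DIM('a)\<rceil>)"
  proof (intro allI impI)
    fix P assume "P \<in> S"
    then have "real (card P) \<le> (2 * R / \<delta> + 1) ^ DIM('a)"
      using R assms unfolding S_def by (intro card_separated_le[where x=0]) auto
    then show "card P < Suc (nat \<lceil>(2 * R / \<delta> + 1) ^ DIM('a)\<rceil>)" by linarith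
  qed
  moreover have "{} \<in> S" by (simp add: S_def)
  ultimately obtain P where P: "P \<in> S" and max: "\<And>P'. P' \<in> S \<Longrightarrow> card P' \<le> card P"
    using ex_has_greatest_nat[of "\<lambda>P. P \<in> S" "{}" card] by metis
  have "A \<subseteq> (\<Union>p\<in>P. cball p \<delta>)"
  proof
    fix a assume "a \<in> A"
    show "a \<in> (\<Union>p\<in>P. cball p \<delta>)"
    proof (rule ccontr)
      assume *: "\<not> ?thesis"
      then have "a \<notin> P" using assms by force
      have "\<forall>p\<in>P. \<delta> \<le> dist p a" "\<forall>p\<in>P. \<delta> \<le> dist a p" 
        using * by (simp_all add: dist_commute not_le less_imp_le)
      then have "insert a P \<in> S" using P \<open>a \<in> A\<close> unfolding S_def mem_Collect_eq by blast
      from max[OF this] show False using \<open>a \<notin> P\<close> P unfolding S_def by simp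
    qed
  qed
  with P show ?thesis by (intro that[of P]) (auto simp: S_def)
qed

text \<open>Orthogonal projection onto the hyperplane orthogonal to \<open>e\<close> when
  \<open>norm e = 1\<close>. It makes a chart function, which is Lipschitz on that hyperplane,
  applicable to arbitrary points.\<close>

definition hproj :: "'a::real_inner \<Rightarrow> 'a \<Rightarrow> 'a" where
  "hproj e y = y - (y \<bullet> e) *\<^sub>R e"

lemma hproj_add: "hproj e (x + y) = hproj e x + hproj e y"
  and hproj_diff: "hproj e (x - y) = hproj e x - hproj e y"
  and hproj_scaleR: "hproj e (a *\<^sub>R x) = a *\<^sub>R hproj e x"
  by (simp_all add: hproj_def algebra_simps inner_add_left inner_diff_left)

lemma hproj_decomp: "hproj e y + (y \<bullet> e) *\<^sub>R e = y"
  by (simp add: hproj_def)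

lemma hproj_self: "norm e = 1 \<Longrightarrow> hproj e e = 0"
  by (simp add: hproj_def norm_eq_1)

lemma hproj_inner: "norm e = 1 \<Longrightarrow> hproj e y \<bullet> e = 0"
  by (simp add: hproj_def inner_diff_left norm_eq_1)

lemma hproj_hyperplane: "z \<bullet> e = 0 \<Longrightarrow> hproj e z = z"
  by (simp add: hproj_def)

lemma norm_hproj_le:
  assumes "norm e = 1" shows "norm (hproj e y) \<le> norm y"
proof -
  have "hproj e y \<bullet> hproj e y = y \<bullet> y - (y \<bullet> e)\<^sup>2"
    using assms
      by (simp add: hproj_def inner_diff_left inner_diff_right norm_eq_1 inner_commute power2_eq_square)
  then have "(norm (hproj e y))\<^sup>2 \<le> (norm y)\<^sup>2" by (simp add: power2_norm_eq_inner)
  then show ?thesis by (simp add: power2_le_iff_abs_le)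
qed

lemma continuous_on_hproj [continuous_intros]: "continuous_on S f \<Longrightarrow> continuous_on S (\<lambda>x. hproj e (f x))"
  unfolding hproj_def by (intro continuous_intros)

text \<open>The vertical translates of a separated subset of a Lipschitz graph by multiples of \<open>\<delta>\<close>
  are still separated; counting them in a ball of \<open>\<real>\<^sup>n\<close> gains the missing factor \<open>r / \<delta>\<close>.\<close>

lemma card_separated_graph_le:
  fixes P :: "'a::euclidean_space set"
  assumes e: "norm e = 1" and "L \<ge> 0" "0 < \<delta>" "\<delta> \<le> r" "finite P" "P \<subseteq> cball x r"
    and graph: "\<And>p q. p \<in> P \<Longrightarrow> q \<in> P \<Longrightarrow> \<bar>(p - q) \<bullet> e\<bar> \<le> L * norm (hproj e (p - q))"
    and sep: "\<And>p q. p \<in> P \<Longrightarrow> q \<in> P \<Longrightarrow> p \<noteq> q \<Longrightarrow> \<delta> \<le> dist p q"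
  shows "real (card P) * \<delta> ^ (DIM('a) - 1) \<le> (7 * (1 + L)) ^ DIM('a) * r ^ (DIM('a) - 1)"
proof -
  have ee: "e \<bullet> e = 1" using e by (simp add: norm_eq_1)
  \<comment> \<open>About \<open>r / \<delta>\<close> translates: the stack has height at most
    \<open>2 * r\<close> and stays within distance \<open>3 * r\<close> of \<open>x\<close>.\<close>
  define K where "K = nat \<lceil>r/\<delta>\<rceil>"
  have K1: "r / \<delta> \<le> real K" "real K \<le> r/\<delta> + 1" "r/\<delta> \<ge> 1"
  proof -
    show 1: "r/\<delta> \<ge> 1" using assms by (simp add: field_simps)
    then show "r / \<delta> \<le> real K" "real K \<le> r/\<delta> + 1" unfolding K_def by linarith+
  qed
  have K2: "real K * \<delta> \<le> 2 * r" 
  proof -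
    have "real K * \<delta> \<le> (r/\<delta> + 1) * \<delta>" using K1 assms by (intro mult_right_mono) auto
    also have "\<dots> = r + \<delta>" using assms by (simp add: field_simps)
    finally show ?thesis using assms by simp
  qed
  define \<tau> where "\<tau> = (\<lambda>(p, k::nat). p + (real k * \<delta>) *\<^sub>R e)"
  \<comment> \<open>Two points of the graph are at most \<open>1 + L\<close> times as far apart as
    their projections, and vertical shifts do not change the projections.\<close>
  define \<rho> where "\<rho> = \<delta> / (1 + L)"
  have \<rho>: "\<rho> > 0" "\<rho> \<le> \<delta>" using assms by (auto simp: \<rho>_def field_simps)
  have sepQ: "\<rho> \<le> dist (\<tau> a) (\<tau> b)" if ab: "a \<in> P \<times> {..<K}" "b \<in> P \<times> {..<K}" "a \<noteq> b" for a b
  proof -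
    obtain p k q l where [simp]: "a = (p,k)" "b = (q,l)" by (cases a; cases b)
    show ?thesis
    proof (cases "p = q")
      case True
      then have "k \<noteq> l" using ab by simp
      then have "1 \<le> \<bar>real k - real l\<bar>" by linarith
      then have "\<delta> \<le> \<bar>real k - real l\<bar> * \<delta>" using assms by simp
      also have "\<dots> = dist (\<tau> a) (\<tau> b)"
        using True assms e
          by (simp add: \<tau>_def dist_norm scaleR_left_diff_distrib[symmetric] left_diff_distrib[symmetric] abs_mult)
      finally show ?thesis using \<rho> by simp
    next
      case False
      have pq: "p \<in> P" "q \<in> P" using ab by auto
      have "\<delta> \<le> norm (p - q)" using sep[OF pq False] by (simp add: dist_norm)
      also have "\<dots> = norm (hproj e (p - q) + ((p - q) \<bullet> e) *\<^sub>R e)" by (simp add: hproj_decomp)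
      also have "\<dots> \<le> norm (hproj e (p - q)) + \<bar>(p - q) \<bullet> e\<bar>"
        by (rule norm_triangle_le) (simp add: e)
      also have "\<dots> \<le> (1 + L) * norm (hproj e (p - q))" using graph[OF pq] by (simp add: algebra_simps)
      finally have "\<rho> \<le> norm (hproj e (p - q))" using assms unfolding \<rho>_def by (simp add: field_simps)
      also have "hproj e (p - q) = hproj e (\<tau> a - \<tau> b)"
        by (simp add: \<tau>_def hproj_diff hproj_add hproj_scaleR hproj_self[OF e])
      also have "norm \<dots> \<le> dist (\<tau> a) (\<tau> b)" unfolding dist_norm by (rule norm_hproj_le[OF e])
      finally show ?thesis .
    qed
  qed
  have inj: "inj_on \<tau> (P \<times> {..<K})"
    using sepQ \<rho>(1) by (intro inj_onI) (metis dist_self not_le)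
  have "real (card (\<tau> ` (P \<times> {..<K}))) \<le> (2 * (3 * r) / \<rho> + 1) ^ DIM('a)"
  proof (rule card_separated_le[where x = x])
    show "\<tau> ` (P \<times> {..<K}) \<subseteq> cball x (3 * r)"
    proof clarsimp
      fix p k assume pk: "p \<in> P" "k < K"
      have "dist x (\<tau> (p,k)) \<le> dist x p + dist p (\<tau> (p,k))" by (rule dist_triangle)
      also have "dist p (\<tau> (p,k)) = real k * \<delta>" using assms by (simp add: \<tau>_def dist_norm abs_mult)
      also have "real k * \<delta> \<le> real K * \<delta>" using pk assms by simp
      finally show "dist x (\<tau> (p,k)) \<le> 3 * r" using K2 pk assms(6) by auto
    qed
  qed (use sepQ \<rho> assms in auto)
  also have "card (\<tau> ` (P \<times> {..<K})) = card P * K" by (simp add: card_image[OF inj] card_cartesian_product)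
  finally have "real (card P) * real K \<le> (2 * (3 * r) / \<rho> + 1) ^ DIM('a)" by simp
  \<comment> \<open>Here 7 is 6 + 1: the summand 1 is at most
    \<open>(1 + L) * (r / \<delta>)\<close>.\<close>
  also have "\<dots> \<le> (7 * (1 + L) * (r / \<delta>)) ^ DIM('a)"
  proof (rule power_mono)
    have "1 * 1 \<le> (1 + L) * (r/\<delta>)" using assms by (intro mult_mono) (auto simp: field_simps)
    moreover have "2 * (3 * r) / \<rho> = 6 * ((1 + L) * (r / \<delta>))" by (simp add: \<rho>_def)
    ultimately show "2 * (3 * r) / \<rho> + 1 \<le> 7 * (1 + L) * (r / \<delta>)" by linarith
  qed (use \<rho> assms in auto)
  finally have "real (card P) * real K \<le> (7 * (1 + L)) ^ DIM('a) * (r / \<delta>) ^ DIM('a)"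
    by (simp only: power_mult_distrib)
  moreover have "real (card P) * (r/\<delta>) \<le> real (card P) * real K" using K1 by (intro mult_left_mono) auto
  ultimately have *: "real (card P) * (r/\<delta>) \<le> (7 * (1 + L)) ^ DIM('a) * (r / \<delta>) ^ DIM('a)" by linarith
  have "real (card P) \<le> (7 * (1 + L)) ^ DIM('a) * (r / \<delta>) ^ (DIM('a) - 1)"
  proof -
    have "(r / \<delta>) ^ DIM('a) = (r/\<delta>) ^ (DIM('a) - 1) * (r/\<delta>)"
      using DIM_positive[where 'a='a] by (metis Suc_diff_1 power_Suc2)
    then have "real (card P) * (r/\<delta>) \<le> ((7 * (1 + L)) ^ DIM('a) * (r / \<delta>) ^ (DIM('a) - 1)) * (r/\<delta>)" using *
      by simp
    then show ?thesis using assms K1(3) by (subst (asm) mult_le_cancel_right_pos) auto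
  qed
  then have "real (card P) * \<delta> ^ (DIM('a) - 1) \<le> (7 * (1 + L)) ^ DIM('a) * (r / \<delta>) ^ (DIM('a) - 1) * \<delta> ^ (DIM('a) - 1)"
    using assms by (intro mult_right_mono) auto
  also have "\<dots> = (7 * (1 + L)) ^ DIM('a) * r ^ (DIM('a) - 1)"
    using assms by (simp add: power_divide)
  finally show ?thesis .
qed

section \<open>Bounds for the Hausdorff measure\<close>

text \<open>For an upper bound, covers by equal balls suffice. A ball of radius
  \<open>\<delta>\<close> has diameter at most \<open>2 * \<delta>\<close>, and the resulting factor
  \<open>2 ^ s\<close> cancels the one in the normalisation of
  \<open>hausdorff_outer\<close>.\<close>

lemma hausdorff_outer_le:
  fixes A :: "'a::metric_space set"
  assumes "s \<ge> 1" "\<delta>0 > 0" "B \<ge> 0"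
    and cover: "\<And>\<delta>. 0 < \<delta> \<Longrightarrow> \<delta> \<le> \<delta>0 \<Longrightarrow>
      \<exists>P. finite P \<and> A \<subseteq> (\<Union>p\<in>P. cball p \<delta>) \<and> real (card P) * \<delta> ^ s \<le> B"
  shows "hausdorff_outer s A \<le> ennreal (unit_ball_vol (real s) * B)"
proof -
  have *: "(INF E\<in>{E. A \<subseteq> (\<Union>i::nat. E i) \<and> (\<forall>i. bounded (E i) \<and> diameter (E i) \<le> \<delta>)}.
        \<Sum>i. ennreal (diameter (E i) ^ s)) \<le> ennreal (2 ^ s * B)" if "\<delta> > 0" for \<delta>
  proof -
    define \<eta> where "\<eta> = min (\<delta>/2) \<delta>0"
    have \<eta>: "\<eta> > 0" "\<eta> \<le> \<delta>0" "2 * \<eta> \<le> \<delta>" using that assms by (auto simp: \<eta>_def)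
    obtain P where P: "finite P" "A \<subseteq> (\<Union>p\<in>P. cball p \<eta>)" "real (card P) * \<eta> ^ s \<le> B"
      using cover[OF \<eta>(1,2)] by blast
    obtain f where f: "bij_betw f {0..<card P} P" using ex_bij_betw_nat_finite[OF P(1)] by blast
    define E where "E = (\<lambda>i. if i < card P then cball (f i) \<eta> else {})"
    have d: "diameter (cball x \<eta>) \<le> 2 * \<eta>" for x :: 'a
    proof (rule ccontr)
      assume "\<not> ?thesis"
      then obtain a b where "a \<in> cball x \<eta>" "b \<in> cball x \<eta>" "2 * \<eta> < dist a b"
        using diameter_lower_bounded[of "cball x \<eta>" "2 * \<eta>"] \<eta> by auto
      then show False using dist_triangle2[of a b x] by (simp add: dist_commute)
    qed
    have dE: "diameter (E i) \<le> 2 * \<eta>" "0 \<le> diameter (E i)" for i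
      using d \<eta> by (auto simp: E_def diameter_ge_0)
    have "E \<in> {E. A \<subseteq> (\<Union>i. E i) \<and> (\<forall>i. bounded (E i) \<and> diameter (E i) \<le> \<delta>)}"
    proof (clarsimp, intro conjI allI)
      show "A \<subseteq> (\<Union>i. E i)"
      proof
        fix a assume "a \<in> A"
        then obtain p where p: "p \<in> P" "a \<in> cball p \<eta>" using P(2) by blast
        then obtain i where "i < card P" "p = f i" using f unfolding bij_betw_def
          by (metis atLeastLessThan_iff imageE)
        then show "a \<in> (\<Union>i. E i)" using p by (auto simp: E_def)
      qed
      show "bounded (E i)" "diameter (E i) \<le> \<delta>" for i
        using \<eta>(3) dE(1)[of i] by (auto simp: E_def)
    qed
    then have "(INF E\<in>{E. A \<subseteq> (\<Union>i. E i) \<and> (\<forall>i. bounded (E i) \<and> diameter (E i) \<le> \<delta>)}.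
        \<Sum>i. ennreal (diameter (E i) ^ s)) \<le> (\<Sum>i. ennreal (diameter (E i) ^ s))"
      by (intro INF_lower)
    also have "\<dots> = (\<Sum>i<card P. ennreal (diameter (E i) ^ s))"
      using assms(1) by (intro suminf_finite) (auto simp: E_def)
    also have "\<dots> \<le> (\<Sum>i<card P. ennreal ((2 * \<eta>) ^ s))"
      using dE by (intro sum_mono ennreal_leI power_mono) auto
    also have "\<dots> = ennreal (real (card P) * (2 * \<eta>) ^ s)"
      using \<eta> by (simp add: ennreal_mult ennreal_of_nat_eq_real_of_nat)
    also have "\<dots> \<le> ennreal (2 ^ s * B)"
      using mult_left_mono[OF P(3), of "2 ^ s"]
        by (intro ennreal_leI) (simp add: power_mult_distrib mult_ac)
    finally show ?thesis .
  qed
  have "hausdorff_outer s A \<le> ennreal (unit_ball_vol (real s) / 2 ^ s) * ennreal (2 ^ s * B)"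
    unfolding hausdorff_outer_def by (intro mult_left_mono SUP_least *) auto
  also have "\<dots> = ennreal (unit_ball_vol (real s) * B)"
    using assms by (simp add: ennreal_mult[symmetric])
  finally show ?thesis .
qed

text \<open>About \<open>\<rho> / d\<close> balls of radius \<open>2 * d\<close> with centres on the
  axis cover the cylinder. Each has volume of order \<open>d ^ DIM('a)\<close>, and their number
  takes away one power of \<open>d\<close>. The value \<open>d = 0\<close> is included because
  covering sets may have diameter 0.\<close>

lemma emeasure_cylinder_le:
  fixes e :: "'a::euclidean_space"
  assumes e: "norm e = 1" and "0 \<le> d" "d \<le> \<rho>" "0 < \<rho>" and dim: "DIM('a) \<ge> 2"
  shows "emeasure lborel {y. norm (hproj e (y - p)) \<le> d \<and> \<bar>y \<bullet> e - c\<bar> \<le> \<rho>}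
    \<le> ennreal (5 * 2 ^ DIM('a) * unit_ball_vol (real DIM('a)) * \<rho>) * ennreal (d ^ (DIM('a) - 1))"
    (is "emeasure lborel (?Z d) \<le> ?C * _")
proof -
  let ?n = "DIM('a)" and ?V = "unit_ball_vol (real DIM('a))"
  have closed: "closed (?Z d)" for d
    by (intro closed_Collect_conj closed_Collect_le continuous_intros)
  have pos: "emeasure lborel (?Z d) \<le> ?C * ennreal (d ^ (?n - 1))" if d: "0 < d" "d \<le> \<rho>" for d
  proof -
    define K where "K = \<lceil>\<rho>/d\<rceil>"
    have K: "\<rho>/d \<le> of_int K" "of_int K \<le> \<rho>/d + 1" "\<rho>/d \<ge> 1" unfolding K_def using d by auto
    then have K0: "K \<ge> 1" by linarith
    define b where "b = (\<lambda>k::int. hproj e p + (c + of_int k * d) *\<^sub>R e)"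
    have sub: "?Z d \<subseteq> (\<Union>k\<in>{-K..K}. cball (b k) (2 * d))"
    proof
      fix y assume y: "y \<in> ?Z d"
      define k where "k = \<lfloor>(y \<bullet> e - c) / d\<rfloor>"
      have k: "of_int k \<le> (y \<bullet> e - c) / d" "(y \<bullet> e - c) / d \<le> of_int k + 1" by (auto simp: k_def)
      have "\<bar>(y \<bullet> e - c) / d\<bar> \<le> \<rho> / d" using y d by (simp add: divide_right_mono)
      then have ab: "(y \<bullet> e - c) / d \<le> of_int K" "- of_int K \<le> (y \<bullet> e - c) / d" using K by linarith+
      have "k \<in> {-K..K}" unfolding k_def using ab by (auto simp: le_floor_iff) linarith
      moreover have "y \<in> cball (b k) (2 * d)"
      proof -
        have "y - b k = hproj e (y - p) + (y \<bullet> e - c - of_int k * d) *\<^sub>R e"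
          unfolding b_def hproj_diff
            by (subst (1) hproj_decomp[of e y, symmetric]) (simp add: algebra_simps)
        then have "norm (y - b k) \<le> norm (hproj e (y - p)) + \<bar>y \<bullet> e - c - of_int k * d\<bar>"
          using norm_triangle_ineq[of "hproj e (y - p)" "(y \<bullet> e - c - of_int k * d) *\<^sub>R e"] e by simp
        moreover have "\<bar>y \<bullet> e - c - of_int k * d\<bar> \<le> d" using k d by (simp add: field_simps)
        ultimately show ?thesis using y by (simp add: dist_norm norm_minus_commute)
      qed
      ultimately show "y \<in> (\<Union>k\<in>{-K..K}. cball (b k) (2 * d))" by blast
    qed
    have "emeasure lborel (?Z d) \<le> emeasure lborel (\<Union>k\<in>{-K..K}. cball (b k) (2 * d))"
      by (intro emeasure_mono sub) auto
    also have "\<dots> \<le> (\<Sum>k\<in>{-K..K}. emeasure lborel (cball (b k) (2 * d)))"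
      by (intro emeasure_subadditive_finite) auto
    also have "\<dots> = ennreal (real (card {-K..K}) * (?V * (2 * d) ^ ?n))"
      using d
        by (simp add: emeasure_cball ennreal_mult ennreal_of_nat_eq_real_of_nat del: card_atLeastAtMost_int)
    also have "\<dots> \<le> ennreal ((5 * \<rho> / d) * (?V * (2 * d) ^ ?n))"
    proof (intro ennreal_leI mult_right_mono)
      \<comment> \<open>\<open>2 * K + 1\<close> is at most \<open>2 * \<rho> / d + 3\<close>, and
        \<open>\<rho> / d\<close> is at least 1.\<close>
      have "real (card {-K..K}) = 2 * of_int K + 1" using K0 by simp
      then show "real (card {-K..K}) \<le> 5 * \<rho> / d" using K by simp
    qed (use d in auto)
    also have "(5 * \<rho> / d) * (?V * (2 * d) ^ ?n) = (5 * 2 ^ ?n * ?V * \<rho>) * d ^ (?n - 1)"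
    proof -
      have "d ^ ?n = d ^ (?n - 1) * d" using DIM_positive[where 'a='a] by (metis Suc_diff_1 power_Suc2)
      then show ?thesis using d by (simp add: power_mult_distrib)
    qed
    finally show ?thesis using d by (simp add: ennreal_mult)
  qed
  show ?thesis
  proof (cases "d = 0")
    case True
    \<comment> \<open>The degenerate cylinder lies in those of radius
      \<open>\<rho> / (k + 1)\<close>, whose bounds tend to 0 because the exponent
      \<open>DIM('a) - 1\<close> is positive.\<close>
    have "emeasure lborel (?Z 0) \<le> 0"
    proof (rule LIMSEQ_le_const[of "\<lambda>k. ?C * ennreal ((\<rho> / real (Suc k)) ^ (?n - 1))"])
      have "(\<lambda>k. (\<rho> / real (Suc k)) ^ (?n - 1)) \<longlonglongrightarrow> 0 ^ (?n - 1)"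
        by (intro tendsto_power LIMSEQ_Suc tendsto_divide_0[OF tendsto_const] filterlim_compose[OF tendsto_inverse_0])
          (auto intro!: filterlim_real_sequentially filterlim_at_top_imp_at_infinity)
      then have "(\<lambda>k. ?C * ennreal ((\<rho> / real (Suc k)) ^ (?n - 1))) \<longlonglongrightarrow> ?C * ennreal (0 ^ (?n - 1))"
        by (intro ennreal_tendsto_cmult tendsto_ennrealI) auto
      then show "(\<lambda>k. ?C * ennreal ((\<rho> / real (Suc k)) ^ (?n - 1))) \<longlonglongrightarrow> 0"
        using dim by (simp add: power_0_left)
      have "emeasure lborel (?Z 0) \<le> ?C * ennreal ((\<rho> / real (Suc k)) ^ (?n - 1))" for k
      proof -
        have "emeasure lborel (?Z 0) \<le> emeasure lborel (?Z (\<rho> / real (Suc k)))"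
          using closed assms by (intro emeasure_mono) (auto simp del: of_nat_Suc)
        also have "\<dots> \<le> ?C * ennreal ((\<rho> / real (Suc k)) ^ (?n - 1))"
          using assms by (intro pos) (auto simp: field_simps)
        finally show ?thesis .
      qed
      then show "\<exists>N. \<forall>k\<ge>N. emeasure lborel (?Z 0) \<le> ?C * ennreal ((\<rho> / real (Suc k)) ^ (?n - 1))" by blast
    qed
    then show ?thesis using True by simp
  qed (use pos assms in auto)
qed

text \<open>The covering constant of \<open>emeasure_cylinder_le\<close> divided by the normalising
  factor of \<open>hausdorff_outer\<close>.\<close>

definition cyl_const :: "nat \<Rightarrow> real" where
  "cyl_const n = 5 * 2 ^ n * unit_ball_vol (real n) / (unit_ball_vol (real (n - 1)) / 2 ^ (n - 1))"

lemma cyl_const_pos: "cyl_const n > 0"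
  by (simp add: cyl_const_def)

text \<open>A cover of \<open>A\<close> by sets of small diameter induces a cover of the cylinder
  over \<open>A\<close> by cylinders that have these diameters as radii. The outer measure appears
  because the projection of \<open>A\<close> need not be measurable.\<close>

lemma outer_measure_cylinder_le_hausdorff:
  fixes e :: "'a::euclidean_space"
  assumes e: "norm e = 1" and "0 < \<rho>" and dim: "DIM('a) \<ge> 2"
  shows "outer_measure_of lborel {y. hproj e y \<in> hproj e ` A \<and> \<bar>y \<bullet> e - c\<bar> \<le> \<rho>}
    \<le> ennreal (cyl_const DIM('a) * \<rho>) * hausdorff_outer (DIM('a) - 1) A"
    (is "outer_measure_of lborel ?S \<le> _")
proof -
  let ?n = "DIM('a)"
  define s where "s = ?n - 1"
  have s1: "s \<ge> 1" using dim by (simp add: s_def)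
  define C where "C = 5 * 2 ^ ?n * unit_ball_vol (real ?n) * \<rho>"
  define w where "w = unit_ball_vol (real s) / 2 ^ s"
  \<comment> \<open>Fineness \<open>\<rho>\<close> is what \<open>emeasure_cylinder_le\<close>
    requires of the radii. One fineness is enough, since \<open>hausdorff_outer\<close> is a
    supremum over all of them.\<close>
  define X where "X = {E. A \<subseteq> (\<Union>i::nat. E i) \<and> (\<forall>i. bounded (E i) \<and> diameter (E i) \<le> \<rho>)}"
  have C0: "C > 0" using assms by (simp add: C_def)
  have w0: "w > 0" by (simp add: w_def)
  have one: "outer_measure_of lborel ?S \<le> ennreal C * (\<Sum>i. ennreal (diameter (E i) ^ s))" if "E \<in> X" for E
  proof -
    have E: "A \<subseteq> (\<Union>i. E i)" "\<And>i. bounded (E i)" "\<And>i. diameter (E i) \<le> \<rho>"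
      using that by (auto simp: X_def)
    define p where "p i = (SOME p. p \<in> E i)" for i
    define U where "U i = (if E i = {} then {} else
      {y. norm (hproj e (y - p i)) \<le> diameter (E i) \<and> \<bar>y \<bullet> e - c\<bar> \<le> \<rho>})" for i
    have Ub: "U i \<in> sets lborel" for i
      unfolding U_def by (auto intro!: borel_closed closed_Collect_conj closed_Collect_le continuous_intros)
    have "?S \<subseteq> (\<Union>i. U i)"
    proof clarsimp
      fix y a assume y: "\<bar>y \<bullet> e - c\<bar> \<le> \<rho>" "hproj e y = hproj e a" "a \<in> A"
      then obtain i where i: "a \<in> E i" using E by blast
      then have "p i \<in> E i" unfolding p_def by (metis someI)
      then have "norm (a - p i) \<le> diameter (E i)"
        using diameter_bounded_bound[OF E(2) i, of "p i"] by (simp add: dist_norm)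
      then have "norm (hproj e (y - p i)) \<le> diameter (E i)"
        using norm_hproj_le[OF e, of "a - p i"] y by (simp add: hproj_diff)
      then show "\<exists>i. y \<in> U i" using i y by (intro exI[of _ i]) (auto simp: U_def)
    qed
    then have "outer_measure_of lborel ?S \<le> emeasure lborel (\<Union>i. U i)"
      unfolding outer_measure_of_def using Ub by (intro INF_lower) auto
    also have "\<dots> \<le> (\<Sum>i. emeasure lborel (U i))"
      using Ub by (intro emeasure_subadditive_countably) auto
    also have "\<dots> \<le> (\<Sum>i. ennreal C * ennreal (diameter (E i) ^ s))"
    proof (intro suminf_le allI)
      fix i show "emeasure lborel (U i) \<le> ennreal C * ennreal (diameter (E i) ^ s)"
      proof (cases "E i = {}")
        case True then show ?thesis by (simp add: U_def)
      next
        case False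
        then show ?thesis
          unfolding U_def C_def s_def
            using emeasure_cylinder_le[OF e diameter_ge_0[OF E(2)] E(3) \<open>0 < \<rho>\<close> dim]
          by simp
      qed
    qed auto
    also have "\<dots> = ennreal C * (\<Sum>i. ennreal (diameter (E i) ^ s))" by simp
    finally show ?thesis .
  qed
  let ?I = "INF E\<in>X. \<Sum>i. ennreal (diameter (E i) ^ s)"
  \<comment> \<open>Division by \<open>C\<close> carries the bound over to the infimum over all
    covers; it is undone afterwards.\<close>
  have C_inv: "ennreal C * (x / ennreal C) = x" for x
    using C0 by (simp add: ennreal_times_divide mult.commute[of "ennreal C"] ennreal_mult_divide_eq)
  have "outer_measure_of lborel ?S / ennreal C \<le> ?I"
  proof (rule INF_greatest)
    fix E assume "E \<in> X"
    from divide_right_mono_ennreal[OF one[OF this], of "ennreal C"]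
    show "outer_measure_of lborel ?S / ennreal C \<le> (\<Sum>i. ennreal (diameter (E i) ^ s))"
      using C0 by (simp add: mult.commute[of "ennreal C"] ennreal_mult_divide_eq)
  qed
  then have "ennreal C * (outer_measure_of lborel ?S / ennreal C) \<le> ennreal C * ?I"
    by (rule mult_left_mono) simp
  then have 1: "outer_measure_of lborel ?S \<le> ennreal C * ?I" by (simp only: C_inv)
  have "?I \<le> (SUP \<delta>\<in>{0<..}. INF E\<in>{E. A \<subseteq> (\<Union>i::nat. E i) \<and> (\<forall>i. bounded (E i) \<and> diameter (E i) \<le> \<delta>)}.
        \<Sum>i. ennreal (diameter (E i) ^ s))"
    unfolding X_def using \<open>0 < \<rho>\<close> by (intro SUP_upper) auto
  then have 2: "ennreal w * ?I \<le> hausdorff_outer s A"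
    unfolding hausdorff_outer_def w_def by (intro mult_left_mono) auto
  have "cyl_const ?n = 5 * 2 ^ ?n * unit_ball_vol (real ?n) / w"
    unfolding cyl_const_def w_def s_def ..
  then have "C = cyl_const ?n * \<rho> * w" using w0 by (simp add: C_def)
  then have "ennreal C = ennreal (cyl_const ?n * \<rho>) * ennreal w"
    using w0 by (simp only: ennreal_mult'' less_imp_le)
  then have "ennreal C * ?I = ennreal (cyl_const ?n * \<rho>) * (ennreal w * ?I)"
    by (simp only: mult.assoc)
  also have "\<dots> \<le> ennreal (cyl_const ?n * \<rho>) * hausdorff_outer s A"
    by (intro mult_left_mono 2) auto
  finally show ?thesis using 1 by (simp add: s_def)
qed

section \<open>Lipschitz functions from bounds almost everywhere\<close>

text \<open>With the error term \<open>B * measure lborel (U \<inter> {u<..v})\<close> the estimate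
  is additive over adjacent intervals, so bisection reduces it to short intervals around a single
  point. Off \<open>N\<close> the bound \<open>K\<close> applies there; on \<open>N\<close> the
  crude bound \<open>B\<close> is paid for by the open set \<open>U\<close> around \<open>N\<close>,
  which has small measure.\<close>

lemma lipschitz_ae_1d:
  fixes h :: "real \<Rightarrow> real"
  assumes "a \<le> b" "B \<ge> 0" "K \<ge> 0" and N: "N \<in> null_sets lborel"
    and B: "\<And>x. a \<le> x \<Longrightarrow> x \<le> b \<Longrightarrow> \<exists>\<delta>>0. \<forall>y. a \<le> y \<and> y \<le> b \<and> \<bar>y - x\<bar> < \<delta> \<longrightarrow> \<bar>h y - h x\<bar> \<le> B * \<bar>y - x\<bar>"
    and K: "\<And>x. a \<le> x \<Longrightarrow> x \<le> b \<Longrightarrow> x \<notin> N \<Longrightarrow>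
      \<exists>\<delta>>0. \<forall>y. a \<le> y \<and> y \<le> b \<and> \<bar>y - x\<bar> < \<delta> \<longrightarrow> \<bar>h y - h x\<bar> \<le> K * \<bar>y - x\<bar>"
  shows "\<bar>h b - h a\<bar> \<le> K * (b - a)"
proof -
  have main: "\<bar>h b - h a\<bar> \<le> K * (b - a) + B * \<epsilon>" if "\<epsilon> > 0" for \<epsilon>
  proof -
    obtain U where U: "open U" "N \<subseteq> U" "emeasure lborel (U - N) < ennreal \<epsilon>"
      by (rule outer_regular_lborel[OF null_setsD2[OF N, unfolded sets_lborel] \<open>\<epsilon> > 0\<close>])
    have fin: "U \<inter> {u<..v} \<in> sets lborel" "emeasure lborel (U \<inter> {u<..v}) \<noteq> \<infinity>" for u v
    proof -
      have "emeasure lborel (U \<inter> {u<..v}) \<le> emeasure lborel {u<..v}" by (intro emeasure_mono) auto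
      also have "\<dots> < \<infinity>" by (cases "u \<le> v") (simp_all add: emeasure_lborel_Ioc)
      finally show "emeasure lborel (U \<inter> {u<..v}) \<noteq> \<infinity>" by simp
      show "U \<inter> {u<..v} \<in> sets lborel" using U(1) by (simp add: borel_open)
    qed
    have mU: "measure lborel (U \<inter> {a<..b}) \<le> \<epsilon>"
    proof -
      have "emeasure lborel (U \<inter> {a<..b}) \<le> emeasure lborel ((U - N) \<union> N)"
        using U N by (intro emeasure_mono) auto
      also have "\<dots> \<le> emeasure lborel (U - N) + emeasure lborel N"
        using U N by (intro emeasure_subadditive) auto
      also have "\<dots> \<le> ennreal \<epsilon>" using N U(3) by (simp add: null_setsD1 less_imp_le)
      finally show ?thesis using that unfolding measure_def by (intro enn2real_leI) simp_all
    qed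
    define P where "P u v \<longleftrightarrow> (a \<le> u \<and> v \<le> b \<longrightarrow>
      \<bar>h v - h u\<bar> \<le> K * (v - u) + B * measure lborel (U \<inter> {u<..v}))" for u v
    have "P a b"
      using \<open>a \<le> b\<close>
    proof (induction rule: Bolzano)
      case (trans u v w)
      show ?case
        unfolding P_def
      proof
        assume "a \<le> u \<and> w \<le> b"
        with trans have "\<bar>h v - h u\<bar> \<le> K * (v - u) + B * measure lborel (U \<inter> {u<..v})"
          "\<bar>h w - h v\<bar> \<le> K * (w - v) + B * measure lborel (U \<inter> {v<..w})"
          unfolding P_def by auto
        moreover have "U \<inter> {u<..w} = (U \<inter> {u<..v}) \<union> (U \<inter> {v<..w})" using trans by auto
        then have "measure lborel (U \<inter> {u<..w}) = measure lborel (U \<inter> {u<..v}) + measure lborel (U \<inter> {v<..w})"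
          using fin measure_Union[OF fin(2) fin(2) fin(1) fin(1), of u v v w] by (simp add: disjoint_iff)
        ultimately show "\<bar>h w - h u\<bar> \<le> K * (w - u) + B * measure lborel (U \<inter> {u<..w})"
          by (simp add: algebra_simps)
      qed
    next
      case (local x)
      show ?case
      proof (cases "x \<in> N")
        case False
        from K[OF local False] obtain \<delta> where \<delta>: "\<delta> > 0"
          "\<And>y. a \<le> y \<Longrightarrow> y \<le> b \<Longrightarrow> \<bar>y - x\<bar> < \<delta> \<Longrightarrow> \<bar>h y - h x\<bar> \<le> K * \<bar>y - x\<bar>" by blast
        show ?thesis
        proof (intro exI[of _ \<delta>] conjI allI impI \<delta>(1))
          fix u v assume uv: "u \<le> x \<and> x \<le> v \<and> v - u < \<delta>"
          show "P u v"
            unfolding P_def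
          proof
            assume ab: "a \<le> u \<and> v \<le> b"
            have "\<bar>h v - h x\<bar> \<le> K * (v - x)" "\<bar>h u - h x\<bar> \<le> K * (x - u)"
              using \<delta>(2)[of v] \<delta>(2)[of u] uv ab by auto
            moreover have "0 \<le> B * measure lborel (U \<inter> {u<..v})" using assms by simp
            ultimately show "\<bar>h v - h u\<bar> \<le> K * (v - u) + B * measure lborel (U \<inter> {u<..v})"
              by (simp add: algebra_simps)
          qed
        qed
      next
        case True
        from B[OF local] obtain \<delta> where \<delta>: "\<delta> > 0"
          "\<And>y. a \<le> y \<Longrightarrow> y \<le> b \<Longrightarrow> \<bar>y - x\<bar> < \<delta> \<Longrightarrow> \<bar>h y - h x\<bar> \<le> B * \<bar>y - x\<bar>" by blast
        have "x \<in> U" using U(2) True by blast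
        then obtain \<eta> where \<eta>: "\<eta> > 0" "ball x \<eta> \<subseteq> U" using openE[OF U(1)] by blast
        show ?thesis
        proof (intro exI[of _ "min \<delta> \<eta>"] conjI allI impI)
          show "min \<delta> \<eta> > 0" using \<delta> \<eta> by simp
          fix u v assume uv: "u \<le> x \<and> x \<le> v \<and> v - u < min \<delta> \<eta>"
          have "{u<..v} \<subseteq> ball x \<eta>" using uv by (auto simp: dist_real_def)
          then have "U \<inter> {u<..v} = {u<..v}" using \<eta> by auto
          then have m: "measure lborel (U \<inter> {u<..v}) = v - u" using uv by simp
          show "P u v"
            unfolding P_def
          proof
            assume ab: "a \<le> u \<and> v \<le> b"
            have "\<bar>h v - h x\<bar> \<le> B * (v - x)" "\<bar>h u - h x\<bar> \<le> B * (x - u)"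
              using \<delta>(2)[of v] \<delta>(2)[of u] uv ab by auto
            moreover have "0 \<le> K * (v - u)" using assms uv by simp
            ultimately show "\<bar>h v - h u\<bar> \<le> K * (v - u) + B * measure lborel (U \<inter> {u<..v})"
              unfolding m by (simp add: algebra_simps)
          qed
        qed
      qed
    qed
    then have "\<bar>h b - h a\<bar> \<le> K * (b - a) + B * measure lborel (U \<inter> {a<..b})" unfolding P_def by simp
    also have "\<dots> \<le> K * (b - a) + B * \<epsilon>" using mU assms by (intro add_left_mono mult_left_mono) auto
    finally show ?thesis .
  qed
  show ?thesis
  proof (rule field_le_epsilon)
    fix \<epsilon> :: real assume "\<epsilon> > 0"
    \<comment> \<open>The denominator \<open>B + 1\<close> covers the case
      \<open>B = 0\<close>.\<close>
    have "\<bar>h b - h a\<bar> \<le> K * (b - a) + B * (\<epsilon> / (B + 1))" using \<open>\<epsilon> > 0\<close> assms by (intro main) auto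
    also have "B * (\<epsilon> / (B + 1)) \<le> \<epsilon>" using assms \<open>\<epsilon> > 0\<close> by (simp add: field_simps)
    finally show "\<bar>h b - h a\<bar> \<le> K * (b - a) + \<epsilon>" by simp
  qed
qed

text \<open>The radius may vary with \<open>x\<close>, so that a bound for the derivative at one
  point yields this property at that point.\<close>

definition lip_at :: "'a::metric_space set \<Rightarrow> ('a \<Rightarrow> real) \<Rightarrow> 'a \<Rightarrow> real \<Rightarrow> bool" where
  "lip_at S f x K \<longleftrightarrow> (\<exists>\<delta>>0. \<forall>y\<in>S. dist y x < \<delta> \<longrightarrow> \<bar>f y - f x\<bar> \<le> K * dist y x)"

lemma lip_at_imp_continuous:
  assumes "\<And>x. x \<in> S \<Longrightarrow> lip_at S f x B"
  shows "continuous_on S f"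
  unfolding continuous_on_iff
proof (intro ballI allI impI)
  fix x \<epsilon> :: real and y assume "y \<in> S" "\<epsilon> > 0"
  then obtain \<delta> where \<delta>: "\<delta> > 0" "\<And>z. z \<in> S \<Longrightarrow> dist z y < \<delta> \<Longrightarrow> \<bar>f z - f y\<bar> \<le> B * dist z y"
    using assms unfolding lip_at_def by blast
  show "\<exists>d>0. \<forall>z\<in>S. dist z y < d \<longrightarrow> dist (f z) (f y) < \<epsilon>"
  proof (intro exI[of _ "min \<delta> (\<epsilon> / (\<bar>B\<bar> + 1))"] conjI ballI impI)
    show "min \<delta> (\<epsilon> / (\<bar>B\<bar> + 1)) > 0" using \<delta> \<open>\<epsilon> > 0\<close> by auto
    fix z assume z: "z \<in> S" "dist z y < min \<delta> (\<epsilon> / (\<bar>B\<bar> + 1))"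
    then have "\<bar>f z - f y\<bar> \<le> B * dist z y" using \<delta> by auto
    also have "\<dots> \<le> (\<bar>B\<bar> + 1) * dist z y" by (intro mult_right_mono) auto
    also have "\<dots> < \<epsilon>" using z by (simp add: field_simps)
    finally show "dist (f z) (f y) < \<epsilon>" by (simp add: dist_real_def)
  qed
qed

text \<open>By Fubini, almost every translate of the segment from \<open>a\<close> to
  \<open>b\<close> meets \<open>N\<close> in a null set of parameters. The one-dimensional lemma
  applies to these translates, and continuity of \<open>G\<close> passes the bound on to the segment
  itself.\<close>

lemma lipschitz_ae:
  fixes G :: "'a::euclidean_space \<Rightarrow> real"
  assumes W: "open W" "convex W" and "B \<ge> 0" "K \<ge> 0" and N: "N \<in> null_sets lborel"
    and B: "\<And>z. z \<in> W \<Longrightarrow> lip_at W G z B"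
    and K: "\<And>z. z \<in> W \<Longrightarrow> z \<notin> N \<Longrightarrow> lip_at W G z K"
    and ab: "a \<in> W" "b \<in> W"
  shows "\<bar>G b - G a\<bar> \<le> K * dist b a"
proof -
  define D where "D = b - a"
  have Nb: "N \<in> sets borel" using N by auto
  have *: "AE z in lborel. a + z + t *\<^sub>R D \<notin> N" for t
  proof -
    have "AE z in distr lborel borel ((+) (a + t *\<^sub>R D)). z \<notin> N"
      unfolding lborel_distr_plus by (rule AE_not_in[OF N])
    then have "AE z in lborel. (a + t *\<^sub>R D) + z \<notin> N"
      by (subst (asm) AE_distr_iff) (use Nb in auto)
    then show ?thesis by (simp add: algebra_simps)
  qed
  have "AE z in lborel. AE t in lborel. a + z + t *\<^sub>R D \<notin> N"
  proof (subst lborel_pair.AE_commute)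
    have "(\<lambda>x::'a \<times> real. a + fst x + snd x *\<^sub>R D) \<in> borel_measurable borel"
      by (intro borel_measurable_continuous_onI continuous_intros)
    then have "(\<lambda>x::'a \<times> real. a + fst x + snd x *\<^sub>R D) \<in> borel_measurable (lborel \<Otimes>\<^sub>M lborel)"
      by (simp add: borel_prod[symmetric] cong: measurable_cong_sets)
    then show "{x \<in> space (lborel \<Otimes>\<^sub>M lborel). a + fst x + snd x *\<^sub>R D \<notin> N} \<in> sets (lborel \<Otimes>\<^sub>M (lborel :: real measure))"
      using Nb by measurable
    show "AE t in lborel. AE z in lborel. a + z + t *\<^sub>R D \<notin> N" using * by simp
  qed
  then obtain Z where Z: "Z \<in> null_sets lborel" "\<And>z. z \<notin> Z \<Longrightarrow> AE t in lborel. a + z + t *\<^sub>R D \<notin> N"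
    by (auto elim!: AE_E3)
  have cont: "continuous_on W G" using B by (rule lip_at_imp_continuous)
  have shift: "\<bar>G (b + z) - G (a + z)\<bar> \<le> K * norm D" if z: "z \<notin> Z" "a + z \<in> W" "b + z \<in> W" for z
  proof -
    define s where "s t = a + z + t *\<^sub>R D" for t
    have sW: "s t \<in> W" if "0 \<le> t" "t \<le> 1" for t
    proof -
      have "s t = (1 - t) *\<^sub>R (a + z) + t *\<^sub>R (b + z)" by (simp add: s_def D_def algebra_simps)
      then show ?thesis using W(2) z that by (simp add: convex_alt)
    qed
    have ds: "dist (s t) (s u) = \<bar>t - u\<bar> * norm D" for t u
      by (simp add: s_def dist_norm scaleR_left_diff_distrib[symmetric])
    obtain M where M: "M \<in> null_sets lborel" "\<And>t. t \<notin> M \<Longrightarrow> s t \<notin> N"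
      using Z(2)[OF z(1)] unfolding s_def by (auto elim!: AE_E3)
    have lip: "\<exists>\<delta>>0. \<forall>y. 0 \<le> y \<and> y \<le> 1 \<and> \<bar>y - x\<bar> < \<delta> \<longrightarrow> \<bar>G (s y) - G (s x)\<bar> \<le> (C * norm D) * \<bar>y - x\<bar>"
      if "lip_at W G (s x) C" for x C
    proof -
      obtain \<delta> where \<delta>: "\<delta> > 0" "\<And>y. y \<in> W \<Longrightarrow> dist y (s x) < \<delta> \<Longrightarrow> \<bar>G y - G (s x)\<bar> \<le> C * dist y (s x)"
        using \<open>lip_at W G (s x) C\<close> unfolding lip_at_def by blast
      show ?thesis
      proof (intro exI[of _ "\<delta> / (norm D + 1)"] conjI allI impI)
        \<comment> \<open>\<open>norm D + 1\<close> is positive even if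
          \<open>a = b\<close>.\<close>
        show "\<delta> / (norm D + 1) > 0" using \<delta>(1) by (simp add: add_nonneg_pos)
        fix y assume y: "0 \<le> y \<and> y \<le> 1 \<and> \<bar>y - x\<bar> < \<delta> / (norm D + 1)"
        have "dist (s y) (s x) \<le> \<bar>y - x\<bar> * (norm D + 1)" unfolding ds by (intro mult_left_mono) auto
        also have "\<dots> < \<delta>" using y by (simp add: pos_less_divide_eq add_nonneg_pos)
        finally show "\<bar>G (s y) - G (s x)\<bar> \<le> (C * norm D) * \<bar>y - x\<bar>"
          using \<delta>(2)[of "s y"] sW[of y] y by (simp add: ds mult_ac)
      qed
    qed
    have "\<bar>G (s 1) - G (s 0)\<bar> \<le> K * norm D * (1 - 0)"
    proof (rule lipschitz_ae_1d[where B = "B * norm D" and N = M])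
      fix x :: real assume "0 \<le> x" "x \<le> 1"
      then show "\<exists>\<delta>>0. \<forall>y. 0 \<le> y \<and> y \<le> 1 \<and> \<bar>y - x\<bar> < \<delta> \<longrightarrow> \<bar>G (s y) - G (s x)\<bar> \<le> (B * norm D) * \<bar>y - x\<bar>"
        by (intro lip B sW)
      assume "x \<notin> M"
      then show "\<exists>\<delta>>0. \<forall>y. 0 \<le> y \<and> y \<le> 1 \<and> \<bar>y - x\<bar> < \<delta> \<longrightarrow> \<bar>G (s y) - G (s x)\<bar> \<le> (K * norm D) * \<bar>y - x\<bar>"
        using \<open>0 \<le> x\<close> \<open>x \<le> 1\<close> by (intro lip K sW M)
    qed (use assms M in auto)
    then show ?thesis by (simp add: s_def D_def algebra_simps)
  qed
  \<comment> \<open>A null set contains no ball, so there are good translates by arbitrarily small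
    vectors.\<close>
  have "\<exists>z. z \<notin> Z \<and> norm z < 1 / real (Suc k)" for k
  proof (rule ccontr)
    assume "\<not> ?thesis"
    then have "ball 0 (1 / real (Suc k)) \<subseteq> Z" by auto
    then have "ball (0::'a) (1 / real (Suc k)) \<in> null_sets lborel" using null_sets_subset[OF Z(1)] by simp
    then have "measure lborel (ball (0::'a) (1 / real (Suc k))) = 0"
      by (simp add: null_sets_def measure_def)
    then show False by (simp only: content_ball_eq_0_iff) (simp add: field_simps)
  qed
  then obtain \<zeta> where \<zeta>: "\<And>k. \<zeta> k \<notin> Z" "\<And>k. norm (\<zeta> k) < 1 / real (Suc k)" by metis
  have lim: "\<zeta> \<longlonglongrightarrow> 0"
    by (rule Lim_null_comparison[OF _ LIMSEQ_inverse_real_of_nat]) (use \<zeta>(2) in \<open>auto simp: inverse_eq_divide less_imp_le\<close>)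
  have la: "(\<lambda>k. a + \<zeta> k) \<longlonglongrightarrow> a" "(\<lambda>k. b + \<zeta> k) \<longlonglongrightarrow> b" using tendsto_add[OF tendsto_const lim] by auto
  have ev: "\<forall>\<^sub>F k in sequentially. a + \<zeta> k \<in> W" "\<forall>\<^sub>F k in sequentially. b + \<zeta> k \<in> W"
    using la W(1) ab by (auto intro: topological_tendstoD)
  have "(\<lambda>k. \<bar>G (b + \<zeta> k) - G (a + \<zeta> k)\<bar>) \<longlonglongrightarrow> \<bar>G b - G a\<bar>"
    using continuous_on_tendsto_compose[OF cont la(1) ab(1) ev(1)]
      continuous_on_tendsto_compose[OF cont la(2) ab(2) ev(2)] by (intro tendsto_intros)
  moreover have "\<forall>\<^sub>F k in sequentially. \<bar>G (b + \<zeta> k) - G (a + \<zeta> k)\<bar> \<le> K * norm D"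
    using ev by eventually_elim (rule shift[OF \<zeta>(1)])
  ultimately show ?thesis
    unfolding dist_norm D_def[symmetric] by (rule tendsto_upperbound) simp
qed

section \<open>Surfaces that are locally Lipschitz graphs\<close>

text \<open>One radius \<open>r0\<close> and one constant \<open>L\<close> serve all charts, which
  makes the constants independent of the point. The assumption \<open>hausdorff\<close> is settled
  by a case distinction in the final theorem, and \<open>K \<ge> 1\<close> by enlarging the constant
  of the geodesic distance.\<close>

locale lipschitz_surface =
  fixes \<Gamma> :: "(real^'n) set" and r0 L K :: real
  assumes compact: "compact \<Gamma>" and nonempty: "\<Gamma> \<noteq> {}" and dim: "2 \<le> CARD('n)"
    and hausdorff: "measure_space UNIV (sets borel) (hausdorff_outer (CARD('n) - 1) :: (real^'n) set \<Rightarrow> ennreal)"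
    and r0: "r0 > 0" and L: "L \<ge> 0" and K: "K \<ge> 1"
    and chart: "\<And>x. x \<in> \<Gamma> \<Longrightarrow> \<exists>e g. norm e = 1 \<and> L-lipschitz_on {w. w \<bullet> e = 0} g \<and>
      \<Gamma> \<inter> ball x r0 = {y\<in>ball x r0. g (hproj e y) = y \<bullet> e}"
    and geodesic: "\<And>x y. x \<in> \<Gamma> \<Longrightarrow> y \<in> \<Gamma> \<Longrightarrow> geodesic_dist \<Gamma> x y \<le> ennreal (K * dist x y)"

text \<open>The closure of \<open>\<Omega>\<close> stays in the closed region above the graph, and a
  frontier point is not in the open set \<open>\<Omega>\<close>; so it lies on the graph. Conversely
  a point of the graph is approached from within \<open>\<Omega>\<close> along
  \<open>e\<close>.\<close>

lemma lipschitz_graph_chart: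
  fixes \<Omega> :: "(real^'n) set"
  assumes "open \<Omega>" "norm e = 1" and g: "L-lipschitz_on {w. w \<bullet> e = 0} g"
    and \<Omega>: "\<Omega> \<inter> ball x r = {y\<in>ball x r. g (hproj e y) < y \<bullet> e}"
  shows "frontier \<Omega> \<inter> ball x r = {y\<in>ball x r. g (hproj e y) = y \<bullet> e}"
proof -
  have ee: "e \<bullet> e = 1" using assms by (simp add: norm_eq_1)
  have cg: "continuous_on {w. w \<bullet> e = 0} g" using g by (rule lipschitz_on_continuous_on)
  have cont: "continuous_on UNIV (\<lambda>y. g (hproj e y))"
    by (rule continuous_on_compose2[OF cg]) (auto intro!: continuous_intros simp: hproj_inner assms)
  have closedS: "closed {y. g (hproj e y) \<le> y \<bullet> e}"
    by (intro closed_Collect_le continuous_intros cont)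
  show ?thesis
  proof (intro equalityI subsetI)
    fix y assume y: "y \<in> frontier \<Omega> \<inter> ball x r"
    then have "y \<notin> \<Omega>" "y \<in> closure \<Omega>" using assms(1) by (auto simp: frontier_def interior_open)
    then have 1: "\<not> g (hproj e y) < y \<bullet> e" using \<Omega> y by auto
    have "y \<in> closure (\<Omega> \<inter> ball x r)"
      using \<open>y \<in> closure \<Omega>\<close> y open_Int_closure_subset[of "ball x r" \<Omega>] by (auto simp: Int_commute)
    also have "\<dots> \<subseteq> {y. g (hproj e y) \<le> y \<bullet> e}"
      by (rule closure_minimal[OF _ closedS]) (auto simp: \<Omega>)
    finally show "y \<in> {y\<in>ball x r. g (hproj e y) = y \<bullet> e}" using 1 y by auto
  next
    fix y assume y: "y \<in> {y\<in>ball x r. g (hproj e y) = y \<bullet> e}"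
    then have "y \<notin> \<Omega> \<inter> ball x r" unfolding \<Omega> by simp
    then have "y \<notin> \<Omega>" using y by blast
    moreover have "y \<in> closure \<Omega>"
      unfolding closure_approachable
    proof (intro allI impI)
      fix \<epsilon> :: real assume "\<epsilon> > 0"
      define t where "t = min (\<epsilon>/2) ((r - dist x y)/2)"
      have t: "t > 0" "t < \<epsilon>" "dist x y + t < r" using y \<open>\<epsilon> > 0\<close> by (auto simp: t_def min_def field_simps)
      have "dist (y + t *\<^sub>R e) y = t" using t assms by (simp add: dist_norm)
      moreover have "y + t *\<^sub>R e \<in> \<Omega>"
      proof -
        have "dist x (y + t *\<^sub>R e) < r"
          using dist_triangle[of x "y + t *\<^sub>R e" y] t calculation by (simp add: dist_commute)
        moreover have "hproj e (y + t *\<^sub>R e) = hproj e y"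
          by (simp add: hproj_add hproj_scaleR hproj_self assms)
        moreover have "(y + t *\<^sub>R e) \<bullet> e = y \<bullet> e + t" by (simp add: inner_add_left ee)
        ultimately have "y + t *\<^sub>R e \<in> {y\<in>ball x r. g (hproj e y) < y \<bullet> e}" using y t by simp
        then show ?thesis using \<Omega> by blast
      qed
      ultimately show "\<exists>z\<in>\<Omega>. dist z y < \<epsilon>" using t by metis
    qed
    ultimately show "y \<in> frontier \<Omega> \<inter> ball x r" using y assms(1) by (simp add: frontier_def interior_open)
  qed
qed

text \<open>Compactness: a Lebesgue number of a finite cover by chart balls is a common radius,
  since charts restrict to smaller balls, and the largest of finitely many Lipschitz constants is a
  common constant.\<close>

lemma uniform_charts:
  fixes \<Omega> :: "(real^'n) set"
  assumes "open \<Omega>" "bounded \<Omega>" "lipschitz_boundary \<Omega>"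
  obtains r L where "r > 0" "L \<ge> 0"
    "\<forall>x\<in>frontier \<Omega>. \<exists>e g. norm e = 1 \<and> L-lipschitz_on {w. w \<bullet> e = 0} g \<and>
      frontier \<Omega> \<inter> ball x r = {y\<in>ball x r. g (hproj e y) = y \<bullet> e}"
proof -
  let ?\<Gamma> = "frontier \<Omega>"
  have comp: "compact ?\<Gamma>" using assms(2) by (rule compact_frontier_bounded)
  define Q where "Q x r L \<longleftrightarrow> (\<exists>e g. norm e = 1 \<and> L-lipschitz_on {w. w \<bullet> e = 0} g \<and>
      ?\<Gamma> \<inter> ball x r = {y\<in>ball x r. g (hproj e y) = y \<bullet> e})" for x r and L :: real
  have "\<exists>r>0. \<exists>L. Q x r L" if "x \<in> ?\<Gamma>" for x
  proof -
    from assms(3) that obtain r where "r > 0" and r: "\<exists>e. norm e = 1 \<and> (\<exists>g L. L-lipschitz_on {w. w \<bullet> e = 0} g \<and>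
      \<Omega> \<inter> ball x r = {y\<in>ball x r. g (hproj e y) < y \<bullet> e})"
      unfolding lipschitz_boundary_def hproj_def by blast
    from r obtain e g L where e: "norm e = 1" and g: "L-lipschitz_on {w. w \<bullet> e = 0} g"
      and \<Omega>: "\<Omega> \<inter> ball x r = {y\<in>ball x r. g (hproj e y) < y \<bullet> e}"
      by blast
    have "Q x r L"
      unfolding Q_def using e g lipschitz_graph_chart[OF assms(1) e g \<Omega>] by blast
    with \<open>r > 0\<close> show ?thesis by blast
  qed
  then obtain r L where r: "\<And>x. x \<in> ?\<Gamma> \<Longrightarrow> r x > 0" and Q: "\<And>x. x \<in> ?\<Gamma> \<Longrightarrow> Q x (r x) (L x)"
    by metis
  obtain X where X: "X \<subseteq> ?\<Gamma>" "finite X" "?\<Gamma> \<subseteq> (\<Union>x\<in>X. ball x (r x))"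
  proof (rule compactE_image[OF comp, of ?\<Gamma> "\<lambda>x. ball x (r x)"])
    show "?\<Gamma> \<subseteq> (\<Union>x\<in>?\<Gamma>. ball x (r x))" using r by (meson UN_I centre_in_ball subsetI)
  qed auto
  obtain \<epsilon> where \<epsilon>: "\<epsilon> > 0" "\<And>x. x \<in> ?\<Gamma> \<Longrightarrow> \<exists>G\<in>(\<lambda>x. ball x (r x)) ` X. ball x \<epsilon> \<subseteq> G"
    by (rule Heine_Borel_lemma[OF comp X(3)]) auto
  define M where "M = Max (insert 0 (L ` X))"
  have M: "M \<ge> 0" "\<And>x. x \<in> X \<Longrightarrow> L x \<le> M" using X(2) by (auto simp: M_def)
  show ?thesis
  proof (rule that[OF \<epsilon>(1) M(1)], rule ballI)
    fix x assume "x \<in> ?\<Gamma>"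
    then obtain z where z: "z \<in> X" "ball x \<epsilon> \<subseteq> ball z (r z)" using \<epsilon>(2) by blast
    have "z \<in> ?\<Gamma>" using z X by blast
    from Q[OF this] obtain e g where e: "norm e = 1" and g: "(L z)-lipschitz_on {w. w \<bullet> e = 0} g"
      and G: "?\<Gamma> \<inter> ball z (r z) = {y\<in>ball z (r z). g (hproj e y) = y \<bullet> e}" unfolding Q_def by blast
    have "?\<Gamma> \<inter> ball x \<epsilon> = (?\<Gamma> \<inter> ball z (r z)) \<inter> ball x \<epsilon>" using z by blast
    also have "\<dots> = {y\<in>ball x \<epsilon>. g (hproj e y) = y \<bullet> e}" unfolding G using z by blast
    finally show "\<exists>e g. norm e = 1 \<and> M-lipschitz_on {w. w \<bullet> e = 0} g \<and>
      ?\<Gamma> \<inter> ball x \<epsilon> = {y\<in>ball x \<epsilon>. g (hproj e y) = y \<bullet> e}"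
      using e lipschitz_on_le[OF g M(2)[OF z(1)]] by blast
  qed
qed

section \<open>Surface measure of Borel subsets\<close>

lemma sets_hausdorff_measure [simp]: "sets (hausdorff_measure s) = sets borel"
  and space_hausdorff_measure [simp]: "space (hausdorff_measure s) = UNIV"
  using sets.sigma_sets_eq[of borel] by (auto simp: hausdorff_measure_def)

lemma sets_surf: "sets (surf \<tau>) = sets (restrict_space borel \<tau>)"
  unfolding surf_def by (intro sets_restrict_space_cong) simp

lemma space_surf [simp]: "space (surf \<tau>) = \<tau>"
  by (simp add: surf_def space_restrict_space)

lemma surf_subset_eq:
  assumes "\<tau> \<subseteq> \<Gamma>" "\<tau> \<in> sets borel" "\<Gamma> \<in> sets borel"
  shows "surf \<tau> = restrict_space (surf \<Gamma>) \<tau>"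
proof -
  have "\<Gamma> \<inter> \<tau> = \<tau>" using assms by blast
  then show ?thesis
    using assms unfolding surf_def by (subst restrict_restrict_space) auto
qed

context lipschitz_surface
begin

lemma closed: "closed \<Gamma>" and borel: "\<Gamma> \<in> sets borel" and bounded: "bounded \<Gamma>"
  using compact by (auto simp: compact_imp_closed compact_imp_bounded borel_closed)

lemma sets_surf_subset: "A \<in> sets borel \<Longrightarrow> A \<subseteq> \<Gamma> \<Longrightarrow> A \<in> sets (surf \<Gamma>)"
  unfolding sets_surf by (simp add: sets_restrict_space_iff borel)

text \<open>Here the assumption \<open>hausdorff\<close> enters: \<open>measure_of\<close>
  reproduces the values of a set function only if that is a measure.\<close>

lemma emeasure_surf:
  assumes "A \<in> sets borel" "A \<subseteq> \<Gamma>"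
  shows "emeasure (surf \<Gamma>) A = hausdorff_outer (CARD('n) - 1) A"
proof -
  have "emeasure (surf \<Gamma>) A = emeasure (hausdorff_measure (CARD('n) - 1)) A"
    unfolding surf_def using assms borel by (intro emeasure_restrict_space) auto
  also have "\<dots> = hausdorff_outer (CARD('n) - 1) A"
    unfolding hausdorff_measure_def emeasure_measure_of_conv
    using hausdorff assms sets.sigma_sets_eq[of "borel :: (real^'n) measure"] by simp
  finally show ?thesis .
qed

text \<open>The graph is parametrised by all points of the space, constantly along \<open>e\<close>,
  instead of by the hyperplane. Thus charts can be treated with Lebesgue measure of the ambient
  space.\<close>

lemma graph_map_lipschitz:
  assumes e: "norm e = 1" and g: "L-lipschitz_on {w. w \<bullet> e = 0} g"
  shows "dist (hproj e y + g (hproj e y) *\<^sub>R e) (hproj e z + g (hproj e z) *\<^sub>R e) \<le> (1 + L) * dist y z"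
proof -
  have n: "norm (hproj e y - hproj e z) \<le> dist y z"
    using norm_hproj_le[OF e, of "y - z"] by (simp add: hproj_diff dist_norm)
  have lip: "\<bar>g (hproj e y) - g (hproj e z)\<bar> \<le> L * norm (hproj e y - hproj e z)"
    using lipschitz_onD[OF g, of "hproj e y" "hproj e z"] hproj_inner[OF e] by (simp add: dist_norm)
  have "hproj e y + g (hproj e y) *\<^sub>R e - (hproj e z + g (hproj e z) *\<^sub>R e) =
      (hproj e y - hproj e z) + (g (hproj e y) - g (hproj e z)) *\<^sub>R e"
    by (simp add: algebra_simps)
  then have "dist (hproj e y + g (hproj e y) *\<^sub>R e) (hproj e z + g (hproj e z) *\<^sub>R e) \<le>
      norm (hproj e y - hproj e z) + \<bar>g (hproj e y) - g (hproj e z)\<bar>"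
    unfolding dist_norm by (simp only:) (rule norm_triangle_le, simp add: e)
  also have "\<dots> \<le> (1 + L) * norm (hproj e y - hproj e z)" using lip by (simp add: algebra_simps)
  also have "\<dots> \<le> (1 + L) * dist y z" using n L by (intro mult_left_mono) auto
  finally show ?thesis .
qed

text \<open>The graph map fixes \<open>x\<close> and expands distances at most by
  \<open>1 + L\<close>, so the radius \<open>r0 / (1 + L)\<close> keeps the image of
  \<open>y\<close> in the chart ball, where the graph is a part of \<Gamma>.\<close>

lemma graph_point:
  assumes e: "norm e = 1" and g: "L-lipschitz_on {w. w \<bullet> e = 0} g"
    and G: "\<Gamma> \<inter> ball x r0 = {y\<in>ball x r0. g (hproj e y) = y \<bullet> e}"
    and x: "x \<in> \<Gamma>" and r: "r \<le> r0 / (1 + L)" and y: "y \<in> ball x r"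
  defines "p \<equiv> hproj e y + g (hproj e y) *\<^sub>R e"
  shows "p \<in> \<Gamma>" "dist p x \<le> (1 + L) * dist y x" "p \<in> ball x r0" "hproj e p = hproj e y"
proof -
  have ee: "e \<bullet> e = 1" using e by (simp add: norm_eq_1)
  have "x \<in> {y\<in>ball x r0. g (hproj e y) = y \<bullet> e}" unfolding G[symmetric] using x r0 by simp
  then have gx: "g (hproj e x) = x \<bullet> e" by simp
  have "hproj e x + g (hproj e x) *\<^sub>R e = x" by (simp add: gx hproj_decomp)
  then show d: "dist p x \<le> (1 + L) * dist y x"
    using graph_map_lipschitz[OF e g, of y x] by (simp add: p_def)
  have "dist p x \<le> (1 + L) * dist y x" by (rule d)
  also have "\<dots> < (1 + L) * (r0 / (1 + L))"
    using y r L by (intro mult_strict_left_mono) (simp_all add: dist_commute)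
  also have "(1 + L) * (r0 / (1 + L)) = r0" using L by simp
  finally show pb: "p \<in> ball x r0" by (simp add: dist_commute)
  show hp: "hproj e p = hproj e y"
    using hproj_inner[OF e] by (simp add: p_def hproj_add hproj_scaleR hproj_self[OF e] hproj_hyperplane)
  have "p \<bullet> e = g (hproj e y)" using hproj_inner[OF e] by (simp add: p_def inner_add_left ee)
  then have "p \<in> {y\<in>ball x r0. g (hproj e y) = y \<bullet> e}" using pb hp by simp
  then show "p \<in> \<Gamma>" unfolding G[symmetric] by blast
qed

lemma graph_lipschitz:
  assumes e: "norm e = 1" and g: "L-lipschitz_on {w. w \<bullet> e = 0} g"
    and G: "\<Gamma> \<inter> ball x r0 = {y\<in>ball x r0. g (hproj e y) = y \<bullet> e}"
    and "p \<in> \<Gamma> \<inter> ball x r0" "q \<in> \<Gamma> \<inter> ball x r0"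
  shows "\<bar>(p - q) \<bullet> e\<bar> \<le> L * norm (hproj e (p - q))"
proof -
  have "g (hproj e p) = p \<bullet> e" "g (hproj e q) = q \<bullet> e" using assms by auto
  then show ?thesis
    using lipschitz_onD[OF g, of "hproj e p" "hproj e q"] hproj_inner[OF e]
    by (simp add: dist_norm hproj_diff inner_diff_left)
qed

section \<open>Growth of the surface measure on balls\<close>

definition d :: nat where "d = CARD('n) - 1"

lemma d1: "d \<ge> 1" and Suc_d: "Suc d = CARD('n)"
  using dim by (auto simp: d_def)

text \<open>Separated nets of every fineness serve as covers: \<open>card_separated_graph_le\<close>
  bounds their size times \<open>\<delta> ^ d\<close> independently of
  \<open>\<delta>\<close>.\<close>

lemma upper_regular_small:
  assumes "x \<in> \<Gamma>" "0 < r" "r \<le> r0"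
  shows "emeasure (surf \<Gamma>) (\<Gamma> \<inter> ball x r) \<le>
    ennreal (unit_ball_vol (real d) * ((7 * (1 + L)) ^ CARD('n) * r ^ d))"
proof -
  obtain e g where eg: "norm e = 1" "L-lipschitz_on {w. w \<bullet> e = 0} g"
    "\<Gamma> \<inter> ball x r0 = {y\<in>ball x r0. g (hproj e y) = y \<bullet> e}" using chart[OF assms(1)] by blast
  have "hausdorff_outer d (\<Gamma> \<inter> ball x r) \<le> ennreal (unit_ball_vol (real d) * ((7 * (1 + L)) ^ CARD('n) * r ^ d))"
  proof (rule hausdorff_outer_le[OF d1 \<open>0 < r\<close>])
    show "0 \<le> (7 * (1 + L)) ^ CARD('n) * r ^ d" using L assms by simp
    fix \<delta> assume \<delta>: "0 < \<delta>" "\<delta> \<le> r"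
    have "bounded (\<Gamma> \<inter> ball x r)" by (simp add: bounded_Int)
    then obtain P where P: "finite P" "P \<subseteq> \<Gamma> \<inter> ball x r" "\<Gamma> \<inter> ball x r \<subseteq> (\<Union>p\<in>P. cball p \<delta>)"
      "\<And>p q. p \<in> P \<Longrightarrow> q \<in> P \<Longrightarrow> p \<noteq> q \<Longrightarrow> \<delta> \<le> dist p q"
      using separated_net_exists[OF _ \<delta>(1)] by blast
    have P0: "p \<in> \<Gamma> \<inter> ball x r0" if "p \<in> P" for p using P(2) that assms(3) by auto
    have "real (card P) * \<delta> ^ (DIM(real^'n) - 1) \<le> (7 * (1 + L)) ^ DIM(real^'n) * r ^ (DIM(real^'n) - 1)"
    proof (rule card_separated_graph_le[OF eg(1) L \<delta> P(1)])
      show "P \<subseteq> cball x r" using P(2) by auto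
      show "\<bar>(p - q) \<bullet> e\<bar> \<le> L * norm (hproj e (p - q))" if "p \<in> P" "q \<in> P" for p q
        by (rule graph_lipschitz[OF eg P0 P0]) fact+
    qed (rule P(4))
    then show "\<exists>P. finite P \<and> \<Gamma> \<inter> ball x r \<subseteq> (\<Union>p\<in>P. cball p \<delta>) \<and> real (card P) * \<delta> ^ d \<le> (7 * (1 + L)) ^ CARD('n) * r ^ d"
      using P by (auto simp: d_def)
  qed
  then show ?thesis using emeasure_surf[of "\<Gamma> \<inter> ball x r"] borel by (simp add: d_def)
qed

lemma finite_surf: "emeasure (surf \<Gamma>) \<Gamma> < \<infinity>"
proof -
  obtain X where X: "finite X" "X \<subseteq> \<Gamma>" "\<Gamma> \<subseteq> (\<Union>x\<in>X. ball x r0)"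
  proof (rule compactE_image[OF compact, of \<Gamma> "\<lambda>x. ball x r0"])
    show "\<Gamma> \<subseteq> (\<Union>x\<in>\<Gamma>. ball x r0)" using r0 by (meson UN_I centre_in_ball subsetI)
  qed auto
  have "emeasure (surf \<Gamma>) \<Gamma> \<le> emeasure (surf \<Gamma>) (\<Union>x\<in>X. \<Gamma> \<inter> ball x r0)"
  proof (intro emeasure_mono sets_surf_subset)
    show "(\<Union>x\<in>X. \<Gamma> \<inter> ball x r0) \<in> sets borel"
      using borel by (intro sets.finite_UN X(1) sets.Int) auto
  qed (use X(3) in auto)
  also have "\<dots> \<le> (\<Sum>x\<in>X. emeasure (surf \<Gamma>) (\<Gamma> \<inter> ball x r0))"
    using X borel by (intro emeasure_subadditive_finite) (auto intro!: sets_surf_subset)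
  also have "\<dots> < \<infinity>"
  proof -
    have "emeasure (surf \<Gamma>) (\<Gamma> \<inter> ball x r0) \<noteq> \<infinity>" if "x \<in> X" for x
    proof -
      have "x \<in> \<Gamma>" using X(2) that by blast
      then show ?thesis using upper_regular_small[OF _ r0 order_refl, of x] by (auto simp: top_unique)
    qed
    then show ?thesis using X(1) by (simp add: less_top[symmetric])
  qed
  finally show ?thesis .
qed

lemma upper_regular: "\<exists>A>0. \<forall>x\<in>\<Gamma>. \<forall>r>0. emeasure (surf \<Gamma>) (\<Gamma> \<inter> ball x r) \<le> ennreal (A * r ^ d)"
proof -
  define A1 where "A1 = unit_ball_vol (real d) * (7 * (1 + L)) ^ CARD('n)"
  \<comment> \<open>Chosen so that \<open>A2 * r0 ^ d\<close> is the total mass, which settles all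
    radii above \<open>r0\<close>.\<close>
  define A2 where "A2 = measure (surf \<Gamma>) \<Gamma> / r0 ^ d"
  have A: "A1 > 0" "A2 \<ge> 0" using L r0 by (auto simp: A1_def A2_def)
  show ?thesis
  proof (intro exI[of _ "A1 + A2"] conjI ballI allI impI)
    show "A1 + A2 > 0" using A by simp
    fix x r assume x: "x \<in> \<Gamma>" "(r::real) > 0"
    show "emeasure (surf \<Gamma>) (\<Gamma> \<inter> ball x r) \<le> ennreal ((A1 + A2) * r ^ d)"
    proof (cases "r \<le> r0")
      case True
      have "emeasure (surf \<Gamma>) (\<Gamma> \<inter> ball x r) \<le> ennreal (A1 * r ^ d)"
        using upper_regular_small[OF x True] by (simp add: A1_def mult_ac)
      also have "\<dots> \<le> ennreal ((A1 + A2) * r ^ d)" using x A by (intro ennreal_leI mult_right_mono) auto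
      finally show ?thesis .
    next
      case False
      have "emeasure (surf \<Gamma>) (\<Gamma> \<inter> ball x r) \<le> emeasure (surf \<Gamma>) \<Gamma>"
        using borel by (intro emeasure_mono sets_surf_subset) auto
      also have "\<dots> = ennreal (measure (surf \<Gamma>) \<Gamma>)" using finite_surf
        by (simp add: emeasure_eq_ennreal_measure)
      also have "\<dots> = ennreal (A2 * r0 ^ d)" using r0 by (simp add: A2_def)
      also have "\<dots> \<le> ennreal ((A1 + A2) * r ^ d)"
        using A r0 False by (intro ennreal_leI mult_mono power_mono) auto
      finally show ?thesis .
    qed
  qed
qed

text \<open>By \<open>graph_point\<close>, the ball of radius \<open>r / (1 + L)\<close> lies in a
  cylinder over \<open>\<Gamma> \<inter> ball x r\<close>. Its volume has order
  \<open>r ^ CARD('n)\<close>, the cylinder is bounded by height times Hausdorff measure, and the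
  height takes away one power of \<open>r\<close>.\<close>

lemma lower_regular: "\<exists>a>0. \<forall>x\<in>\<Gamma>. \<forall>r. 0 < r \<and> r \<le> r0 \<longrightarrow> ennreal (a * r ^ d) \<le> emeasure (surf \<Gamma>) (\<Gamma> \<inter> ball x r)"
proof -
  define V where "V = unit_ball_vol (real CARD('n))"
  define c where "c = cyl_const CARD('n)"
  have V: "V > 0" "c > 0" by (auto simp: V_def c_def cyl_const_pos)
  show ?thesis
  proof (intro exI[of _ "V / (c * (1 + L) ^ d)"] conjI ballI allI impI)
    show "V / (c * (1 + L) ^ d) > 0" using V L by simp
    fix x r assume x: "x \<in> \<Gamma>" and r: "0 < r \<and> r \<le> r0"
    obtain e g where eg: "norm e = 1" "L-lipschitz_on {w. w \<bullet> e = 0} g"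
      "\<Gamma> \<inter> ball x r0 = {y\<in>ball x r0. g (hproj e y) = y \<bullet> e}" using chart[OF x] by blast
    define \<rho> where "\<rho> = r / (1 + L)"
    have \<rho>: "\<rho> > 0" "\<rho> \<le> r0 / (1 + L)" using r L by (auto simp: \<rho>_def divide_right_mono)
    let ?A = "\<Gamma> \<inter> ball x r"
    have sub: "ball x \<rho> \<subseteq> {y. hproj e y \<in> hproj e ` ?A \<and> \<bar>y \<bullet> e - x \<bullet> e\<bar> \<le> \<rho>}"
    proof
      fix y assume y: "y \<in> ball x \<rho>"
      note p = graph_point[OF eg x \<rho>(2) y]
      let ?p = "hproj e y + g (hproj e y) *\<^sub>R e"
      have "(1 + L) * dist y x < (1 + L) * \<rho>" using y L
        by (intro mult_strict_left_mono) (auto simp: dist_commute)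
      then have "dist ?p x < r" using p(2) L by (simp add: \<rho>_def)
      then have "?p \<in> ?A" using p(1) by (simp add: dist_commute)
      then have "hproj e y \<in> hproj e ` ?A" using p(4) by (metis image_eqI)
      moreover have "\<bar>(y - x) \<bullet> e\<bar> \<le> norm (y - x) * norm e" by (rule Cauchy_Schwarz_ineq2)
      ultimately show "y \<in> {y. hproj e y \<in> hproj e ` ?A \<and> \<bar>y \<bullet> e - x \<bullet> e\<bar> \<le> \<rho>}"
        using y eg(1) by (auto simp: inner_diff_left dist_norm norm_minus_commute)
    qed
    have "ennreal (V * \<rho> ^ CARD('n)) = outer_measure_of lborel (ball x \<rho>)"
      using \<rho> by (simp add: emeasure_ball V_def)
    also have "\<dots> \<le> ennreal (c * \<rho>) * hausdorff_outer (CARD('n) - 1) ?A"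
      using order_trans[OF outer_measure_of_mono[OF sub] outer_measure_cylinder_le_hausdorff[OF eg(1) \<rho>(1)]] dim
      by (simp add: c_def)
    also have "\<dots> = ennreal (c * \<rho>) * emeasure (surf \<Gamma>) ?A"
      using borel by (subst emeasure_surf) auto
    finally have *: "ennreal (V * \<rho> ^ CARD('n)) \<le> ennreal (c * \<rho>) * emeasure (surf \<Gamma>) ?A" .
    have fin: "emeasure (surf \<Gamma>) ?A < \<infinity>"
      using finite_surf borel
        by (elim order.strict_trans1[rotated], intro emeasure_mono sets_surf_subset) auto
    define m where "m = measure (surf \<Gamma>) ?A"
    have m: "emeasure (surf \<Gamma>) ?A = ennreal m" "m \<ge> 0" using fin
      by (auto simp: m_def emeasure_eq_ennreal_measure)
    have "V * \<rho> ^ CARD('n) \<le> c * \<rho> * m"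
      using * V \<rho> m(2) unfolding m(1)
        by (subst (asm) ennreal_mult[symmetric], simp, simp, subst (asm) ennreal_le_iff) auto
    then have "(V * \<rho> ^ d) * \<rho> \<le> (c * m) * \<rho>"
      unfolding Suc_d[symmetric] by (simp add: mult_ac)
    then have "V * \<rho> ^ d \<le> c * m" using \<rho> by (subst (asm) mult_le_cancel_right_pos) auto
    then have "V / (c * (1 + L) ^ d) * r ^ d \<le> m" 
      using V L unfolding \<rho>_def by (simp add: power_divide field_simps)
    then show "ennreal (V / (c * (1 + L) ^ d) * r ^ d) \<le> emeasure (surf \<Gamma>) ?A"
      unfolding m(1) by (rule ennreal_leI)
  qed
qed

text \<open>Turns null sets of the surface into Lebesgue null sets of a chart. The infinite cylinder
  is exhausted by cylinders of finite height, each of outer measure 0.\<close>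

lemma null_set_projection:
  assumes e: "norm e = 1" and N: "hausdorff_outer d N = 0"
  shows "\<exists>Z\<in>null_sets lborel. {y::real^'n. hproj e y \<in> hproj e ` N} \<subseteq> Z"
proof -
  let ?S = "\<lambda>k::nat. {y. hproj e y \<in> hproj e ` N \<and> \<bar>y \<bullet> e - 0\<bar> \<le> real (Suc k)}"
  have "\<forall>k. \<exists>Z. Z \<in> null_sets lborel \<and> ?S k \<subseteq> Z"
  proof
    fix k
    have "outer_measure_of lborel (?S k) \<le> ennreal (cyl_const CARD('n) * real (Suc k)) * hausdorff_outer (CARD('n) - 1) N"
      using outer_measure_cylinder_le_hausdorff[OF e, of "real (Suc k)" N 0] dim by (simp del: of_nat_Suc)
    then have 0: "outer_measure_of lborel (?S k) = 0" using N by (simp add: d_def)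
    have "\<exists>E\<in>sets lborel. ?S k \<subseteq> E \<and> outer_measure_of lborel (?S k) = emeasure lborel E"
      by (rule outer_measure_of_attain) simp
    then obtain E where "E \<in> sets lborel" "?S k \<subseteq> E" "outer_measure_of lborel (?S k) = emeasure lborel E"
      by (elim bexE conjE)
    with 0 show "\<exists>Z. Z \<in> null_sets lborel \<and> ?S k \<subseteq> Z"
      by (intro exI[of _ E]) (simp add: null_sets_def)
  qed
  from choice[OF this] obtain Z where Z0: "\<forall>k. Z k \<in> null_sets lborel \<and> ?S k \<subseteq> Z k" ..
  then have Z: "Z k \<in> null_sets lborel" "?S k \<subseteq> Z k" for k by simp_all
  show ?thesis
  proof (intro bexI[of _ "\<Union>k. Z k"])
    show "{y. hproj e y \<in> hproj e ` N} \<subseteq> (\<Union>k. Z k)"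
    proof
      fix y assume y: "y \<in> {y. hproj e y \<in> hproj e ` N}"
      obtain k where k: "\<bar>y \<bullet> e\<bar> \<le> real k" using real_arch_simple by blast
      have "y \<in> ?S k" using y k by simp
      then have "y \<in> Z k" by (rule subsetD[OF Z(2)])
      then show "y \<in> (\<Union>k. Z k)" by (rule UN_I[OF UNIV_I])
    qed
  qed (use Z(1) in \<open>rule null_sets_UN\<close>)
qed

text \<open>Composition with the graph map costs the factor \<open>1 + L\<close> and reduces the
  claim to \<open>lipschitz_ae\<close> on a ball. The bound \<open>B\<close> does not reach the
  conclusion; this is essential, because for cut-off functions \<open>B\<close> is not controlled
  uniformly in the mesh.\<close>

lemma lipschitz_from_lip_at:
  assumes B: "B \<ge> 0" "\<And>x. x \<in> \<Gamma> \<Longrightarrow> lip_at \<Gamma> f x B"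
    and K: "K' \<ge> 0" "AE x in surf \<Gamma>. lip_at \<Gamma> f x K'"
    and pq: "p \<in> \<Gamma>" "q \<in> \<Gamma>" "dist p q < r0 / (1 + L)"
  shows "\<bar>f p - f q\<bar> \<le> K' * (1 + L) * dist p q"
proof -
  obtain e g where eg: "norm e = 1" "L-lipschitz_on {w. w \<bullet> e = 0} g"
    "\<Gamma> \<inter> ball p r0 = {y\<in>ball p r0. g (hproj e y) = y \<bullet> e}" using chart[OF pq(1)] by blast
  define s where "s y = hproj e y + g (hproj e y) *\<^sub>R e" for y
  define W where "W = ball p (r0 / (1 + L))"
  have s: "s y \<in> \<Gamma>" "hproj e (s y) = hproj e y" if "y \<in> W" for y
    using graph_point[OF eg pq(1) order_refl, of y] that by (auto simp: s_def W_def)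
  have ds: "dist (s y) (s z) \<le> (1 + L) * dist y z" for y z
    unfolding s_def by (rule graph_map_lipschitz[OF eg(1,2)])
  obtain N where N: "N \<in> null_sets (surf \<Gamma>)" "\<And>x. x \<in> \<Gamma> - N \<Longrightarrow> lip_at \<Gamma> f x K'"
    using K(2) by (auto elim!: AE_E3)
  have Nb: "N \<in> sets borel" "N \<subseteq> \<Gamma>"
    using N(1) borel by (auto simp: null_sets_def sets_surf sets_restrict_space_iff)
  then have "hausdorff_outer d N = 0" using N(1) emeasure_surf[OF Nb] by (simp add: d_def null_sets_def)
  then obtain Z where Z: "Z \<in> null_sets lborel" "{y. hproj e y \<in> hproj e ` N} \<subseteq> Z"
    using null_set_projection[OF eg(1)] by blast
  have lip: "lip_at W (\<lambda>y. f (s y)) z (C * (1 + L))" if C: "lip_at \<Gamma> f (s z) C" "C \<ge> 0" and "z \<in> W" for z C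
  proof -
    obtain \<delta> where \<delta>: "\<delta> > 0" "\<And>y. y \<in> \<Gamma> \<Longrightarrow> dist y (s z) < \<delta> \<Longrightarrow> \<bar>f y - f (s z)\<bar> \<le> C * dist y (s z)"
      using C unfolding lip_at_def by blast
    show ?thesis
      unfolding lip_at_def
    proof (intro exI[of _ "\<delta> / (1 + L)"] conjI ballI impI)
      show "\<delta> / (1 + L) > 0" using \<delta> L by simp
      fix y assume y: "y \<in> W" "dist y z < \<delta> / (1 + L)"
      have "dist (s y) (s z) \<le> (1 + L) * dist y z" by (rule ds)
      also have "\<dots> < \<delta>" using y L by (simp add: pos_less_divide_eq mult.commute)
      finally have "\<bar>f (s y) - f (s z)\<bar> \<le> C * dist (s y) (s z)" using \<delta>(2) s(1)[OF y(1)] by simp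
      also have "\<dots> \<le> C * ((1 + L) * dist y z)" using C by (intro mult_left_mono ds) auto
      finally show "\<bar>f (s y) - f (s z)\<bar> \<le> C * (1 + L) * dist y z" by (simp add: mult_ac)
    qed
  qed
  have "\<bar>f (s p) - f (s q)\<bar> \<le> (K' * (1 + L)) * dist p q"
  proof (rule lipschitz_ae[where W = W and N = Z and B = "B * (1 + L)"])
    show "q \<in> W" "p \<in> W" using pq r0 L by (auto simp: W_def)
    show "lip_at W (\<lambda>y. f (s y)) z (B * (1 + L))" if "z \<in> W" for z
      by (rule lip[OF B(2) B(1) that]) (rule s(1)[OF that])
    show "lip_at W (\<lambda>y. f (s y)) z (K' * (1 + L))" if z: "z \<in> W" "z \<notin> Z" for z
    proof (rule lip[OF N(2) K(1) z(1)])
      have "s z \<notin> N" using z(2) Z(2) s(2)[OF z(1)]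
        by (metis (mono_tags, lifting) image_eqI mem_Collect_eq subsetD)
      then show "s z \<in> \<Gamma> - N" using s(1)[OF z(1)] by simp
    qed
  qed (use B K Z L in \<open>auto simp: W_def\<close>)
  moreover have "s x = x" if "x \<in> \<Gamma> \<inter> ball p r0" for x
  proof -
    have "g (hproj e x) = x \<bullet> e" using eg(3) that by blast
    then show ?thesis by (simp add: s_def hproj_decomp)
  qed
  moreover have "r0 / (1 + L) \<le> r0" using L r0 by (simp add: field_simps)
  ultimately show ?thesis using pq r0 by simp
qed

text \<open>By \<open>lower_regular\<close> no ball around a point of \<Gamma> is null. Continuous
  functions thereby inherit bounds from almost every point to every point.\<close>

lemma AE_surf_dense:
  assumes "AE x in surf \<Gamma>. P x" "x \<in> \<Gamma>" "\<epsilon> > 0"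
  obtains y where "y \<in> \<Gamma>" "dist y x < \<epsilon>" "P y"
proof -
  obtain a where a: "a > 0" "\<And>x r. x \<in> \<Gamma> \<Longrightarrow> 0 < r \<Longrightarrow> r \<le> r0 \<Longrightarrow> ennreal (a * r ^ d) \<le> emeasure (surf \<Gamma>) (\<Gamma> \<inter> ball x r)"
    using lower_regular by blast
  define r where "r = min \<epsilon> r0"
  have r: "0 < r" "r \<le> r0" "r \<le> \<epsilon>" using assms r0 by (auto simp: r_def)
  obtain N where N: "N \<in> null_sets (surf \<Gamma>)" "\<And>x. x \<in> \<Gamma> - N \<Longrightarrow> P x"
    using assms(1) by (auto elim!: AE_E3)
  have "\<not> \<Gamma> \<inter> ball x r \<subseteq> N"
  proof
    assume "\<Gamma> \<inter> ball x r \<subseteq> N"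
    then have "emeasure (surf \<Gamma>) (\<Gamma> \<inter> ball x r) \<le> emeasure (surf \<Gamma>) N"
      using N(1) by (intro emeasure_mono) auto
    then have "ennreal (a * r ^ d) \<le> 0" using a(2)[OF assms(2) r(1,2)] N(1) by (auto simp: null_sets_def)
    then show False using a(1) r by (simp add: ennreal_eq_0_iff mult_le_0_iff power_le_zero_eq not_le)
  qed
  then obtain y where "y \<in> \<Gamma>" "y \<in> ball x r" "y \<notin> N" by blast
  then show ?thesis using that[of y] N(2)[of y] r by (auto simp: dist_commute)
qed

end

section \<open>Elements and patches\<close>

lemma ref_simplex_compact_convex: "compact (ref_simplex :: (real^'n) set)" "convex (ref_simplex :: (real^'n) set)"
  by (auto simp: ref_simplex_def intro: finite_imp_compact_convex_hull convex_convex_hull)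

lemma curvilinear_simplex_continuous:
  assumes "curvilinear_simplex \<gamma>" shows "continuous_on ref_simplex \<gamma>"
  using assms unfolding curvilinear_simplex_def by (auto intro: has_derivative_continuous_on)

lemma compact_elem: "curvilinear_simplex \<gamma> \<Longrightarrow> compact (elem \<gamma>)"
  unfolding elem_def
    by (intro compact_continuous_image curvilinear_simplex_continuous ref_simplex_compact_convex)

lemma proper_face_no_interior:
  assumes \<gamma>: "curvilinear_simplex \<gamma>" and F: "F face_of ref_simplex" "F \<noteq> ref_simplex"
    and U: "open U" "U \<inter> elem \<gamma> \<subseteq> \<gamma> ` F"
  shows "U \<inter> elem \<gamma> = {}"
proof (rule ccontr)
  let ?S = "ref_simplex :: (real^'a) set"
  assume "U \<inter> elem \<gamma> \<noteq> {}"
  then obtain v where v: "v \<in> ?S" "\<gamma> v \<in> U" by (auto simp: elem_def)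
  obtain T where T: "open T" "T \<inter> ?S = \<gamma> -` U \<inter> ?S"
    using curvilinear_simplex_continuous[OF \<gamma>] U(1) unfolding continuous_on_open_invariant by blast
  have "v \<in> closure (rel_interior ?S)"
    using v(1) closure_subset by (subst convex_closure_rel_interior[OF ref_simplex_compact_convex(2)]) blast
  moreover have "v \<in> T" using T(2) v by blast
  ultimately have "T \<inter> rel_interior ?S \<noteq> {}" using T(1) by (meson disjoint_iff open_Int_closure_eq_empty)
  then obtain w where w: "w \<in> T" "w \<in> rel_interior ?S" by blast
  have wS: "w \<in> ?S" using w(2) rel_interior_subset by blast
  then have "\<gamma> w \<in> U \<inter> elem \<gamma>" using w(1) T(2) by (auto simp: elem_def)
  then obtain f where f: "f \<in> F" "\<gamma> w = \<gamma> f" using U(2) by blast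
  have "inj_on \<gamma> ?S" using \<gamma> by (simp add: curvilinear_simplex_def)
  then have "w = f" using f wS face_of_imp_subset[OF F(1)] by (meson inj_onD subsetD)
  then show False using face_of_disjoint_rel_interior[OF F] f w by blast
qed

lemma finite_nodes: "finite \<T> \<Longrightarrow> finite (nodes \<T>)"
  by (simp add: nodes_def)

context lipschitz_surface
begin

definition diam :: real where "diam = diameter \<Gamma>"

lemma dist_le_diam: "x \<in> \<Gamma> \<Longrightarrow> y \<in> \<Gamma> \<Longrightarrow> dist x y \<le> diam"
  unfolding diam_def by (rule diameter_bounded_bound[OF bounded])

lemma diam_nonneg: "diam \<ge> 0"
  unfolding diam_def by (rule diameter_ge_0[OF bounded])

definition mesh :: "real \<Rightarrow> real \<Rightarrow> real \<Rightarrow> (real^'n \<Rightarrow> real^'n) set \<Rightarrow> bool" where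
  "mesh \<kappa> q h \<T> \<longleftrightarrow> h > 0 \<and> conforming_mesh \<Gamma> \<T> \<and> quasi_uniform q h \<T> \<and> shape_regular \<Gamma> \<kappa> \<T>"

text \<open>A fraction of \<open>h\<close> that is a valid Euclidean inradius of every element. A
  geodesic ball of radius \<open>r\<close> contains the Euclidean one of radius
  \<open>r / K\<close>, and \<open>h\<close> is at most \<open>2 * \<kappa> * q * r\<close>; this
  gives the first entry. The second keeps the radius below \<open>r0\<close>, as
  \<open>lower_regular\<close> demands. Absolute values and the summand 1 make it positive for all
  real parameters.\<close>

definition inradius :: "real \<Rightarrow> real \<Rightarrow> real" where
  "inradius \<kappa> q = min (1 / (2 * \<bar>\<kappa>\<bar> * \<bar>q\<bar> * K + 1)) (r0 / (\<bar>q\<bar> * diam + 1))"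

lemma inradius_pos: "inradius \<kappa> q > 0"
  unfolding inradius_def using r0 K diam_nonneg
    by (auto intro!: divide_pos_pos add_nonneg_pos mult_nonneg_nonneg)

lemma mesh_elem:
  assumes "mesh \<kappa> q h \<T>" "\<gamma> \<in> \<T>"
  shows "elem \<gamma> \<subseteq> \<Gamma>" "compact (elem \<gamma>)" "curvilinear_simplex \<gamma>"
    "\<And>x y. x \<in> elem \<gamma> \<Longrightarrow> y \<in> elem \<gamma> \<Longrightarrow> dist x y \<le> \<bar>q\<bar> * h"
    "h \<le> \<bar>q\<bar> * diam" "inradius \<kappa> q * h \<le> r0"
    "\<exists>x\<in>elem \<gamma>. \<Gamma> \<inter> ball x (inradius \<kappa> q * h) \<subseteq> elem \<gamma>"
proof -
  have h: "h > 0" and cm: "conforming_mesh \<Gamma> \<T>" and qu: "quasi_uniform q h \<T>" and sr: "shape_regular \<Gamma> \<kappa> \<T>"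
    using assms by (auto simp: mesh_def)
  show sub: "elem \<gamma> \<subseteq> \<Gamma>" using cm assms(2) unfolding conforming_mesh_def by blast
  show cs: "curvilinear_simplex \<gamma>" using cm assms(2) unfolding conforming_mesh_def by blast
  show comp: "compact (elem \<gamma>)" by (rule compact_elem[OF cs])
  define D where "D = diameter (elem \<gamma>)"
  have D: "D \<le> q * h" "h \<le> q * D" using qu assms(2) by (auto simp: quasi_uniform_def D_def)
  have D0: "D \<ge> 0" unfolding D_def by (rule diameter_ge_0[OF compact_imp_bounded[OF comp]])
  \<comment> \<open>The sign is forced by \<open>h \<le> q * D\<close> with \<open>h > 0\<close> and
    \<open>D \<ge> 0\<close>; the same happens for \<open>\<kappa>\<close> below.\<close>
  have q: "q > 0" using D D0 h by (smt (verit, best) mult_nonpos_nonneg)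
  have Dp: "D > 0" using D D0 h by (cases "D = 0") auto
  have Dd: "D \<le> diam" unfolding D_def diam_def by (rule diameter_subset[OF sub bounded])
  show "dist x y \<le> \<bar>q\<bar> * h" if "x \<in> elem \<gamma>" "y \<in> elem \<gamma>" for x y
    using diameter_bounded_bound[OF compact_imp_bounded[OF comp] that] D(1) q by (simp add: D_def)
  show hq: "h \<le> \<bar>q\<bar> * diam" using D(2) Dd q by (smt (verit, best) mult_left_mono)
  have "inradius \<kappa> q * h \<le> r0 / (\<bar>q\<bar> * diam + 1) * h"
    unfolding inradius_def using h by (intro mult_right_mono) auto
  also have "\<dots> \<le> r0 / (\<bar>q\<bar> * diam + 1) * (\<bar>q\<bar> * diam + 1)"
    using hq r0 diam_nonneg by (intro mult_left_mono) auto
  also have "\<dots> = r0" using h hq by simp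
  finally show "inradius \<kappa> q * h \<le> r0" .
  obtain x r where x: "x \<in> elem \<gamma>" and r: "r > 0" "{y\<in>\<Gamma>. geodesic_dist \<Gamma> x y < ennreal r} \<subseteq> elem \<gamma>"
    "diameter (elem \<gamma>) \<le> \<kappa> * (2 * r)"
    using sr assms(2) unfolding shape_regular_def by blast
  have r3: "D \<le> \<kappa> * (2 * r)" using r(3) by (simp add: D_def)
  have \<kappa>: "\<kappa> > 0" using r3 Dp r(1) by (smt (verit, best) mult_nonpos_nonneg)
  have "h \<le> q * (\<kappa> * (2 * r))" using D(2) r3 q by (smt (verit, best) mult_left_mono)
  then have hr: "h \<le> 2 * \<kappa> * q * r" by (simp add: mult_ac)
  \<comment> \<open>Geodesic distance is at most \<open>K\<close> times Euclidean distance, so this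
    puts the Euclidean ball into the inscribed geodesic ball.\<close>
  have ir: "K * (inradius \<kappa> q * h) < r"
  proof -
    define A where "A = 2 * \<kappa> * q * K"
    have A: "A > 0" using \<kappa> q K by (simp add: A_def)
    have "K * (inradius \<kappa> q * h) \<le> K * (1 / (A + 1) * h)"
      unfolding inradius_def A_def using \<kappa> q K h by (intro mult_left_mono mult_right_mono) auto
    also have "\<dots> \<le> K * (1 / (A + 1) * (2 * \<kappa> * q * r))"
      using hr A K by (intro mult_left_mono) auto
    also have "\<dots> = A / (A + 1) * r" by (simp add: A_def)
    also have "\<dots> < 1 * r" using A r(1) by (intro mult_strict_right_mono) (auto simp: field_simps)
    finally show ?thesis by simp
  qed
  have "\<Gamma> \<inter> ball x (inradius \<kappa> q * h) \<subseteq> elem \<gamma>"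
  proof
    fix y assume y: "y \<in> \<Gamma> \<inter> ball x (inradius \<kappa> q * h)"
    have "geodesic_dist \<Gamma> x y \<le> ennreal (K * dist x y)" using geodesic x sub y by blast
    also have "K * dist x y \<le> K * (inradius \<kappa> q * h)" using y K by (intro mult_left_mono) auto
    then have "ennreal (K * dist x y) < ennreal r" using ir r(1) by (intro ennreal_lessI) auto
    finally show "y \<in> elem \<gamma>" using r(2) y by blast
  qed
  then show "\<exists>x\<in>elem \<gamma>. \<Gamma> \<inter> ball x (inradius \<kappa> q * h) \<subseteq> elem \<gamma>" using x by blast
qed

text \<open>If the centres were closer than \<open>r\<close>, the intersection of the two balls
  would meet \<open>elem \<gamma>\<close> only inside the common face, hence not at all by
  \<open>proper_face_no_interior\<close>; but it contains \<open>y\<close>, which the first ball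
  puts into \<open>elem \<gamma>\<close>.\<close>

lemma mesh_centres_separated:
  assumes m: "mesh \<kappa> q h \<T>" and \<gamma>: "\<gamma> \<in> \<T>" "\<delta> \<in> \<T>" "\<gamma> \<noteq> \<delta>"
    and x: "x \<in> elem \<gamma>" "\<Gamma> \<inter> ball x r \<subseteq> elem \<gamma>" and y: "y \<in> elem \<delta>" "\<Gamma> \<inter> ball y r \<subseteq> elem \<delta>"
  shows "r \<le> dist x y"
proof (rule ccontr)
  assume *: "\<not> r \<le> dist x y"
  obtain F where F: "F face_of ref_simplex" "F \<noteq> ref_simplex" "elem \<gamma> \<inter> elem \<delta> = \<gamma> ` F"
    using m \<gamma> unfolding mesh_def conforming_mesh_def by blast
  note e = mesh_elem[OF m \<gamma>(1)] mesh_elem[OF m \<gamma>(2)]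
  let ?U = "ball x r \<inter> ball y r"
  have "?U \<inter> elem \<gamma> \<subseteq> elem \<delta>" using e(1) y(2) by blast
  then have "?U \<inter> elem \<gamma> \<subseteq> \<gamma> ` F" using F(3) by blast
  then have "?U \<inter> elem \<gamma> = {}" by (intro proper_face_no_interior[OF e(3) F(1,2)]) auto
  moreover have "0 < r" using * by (smt (verit) zero_le_dist)
  then have "y \<in> ?U" using * by simp
  moreover have "y \<in> \<Gamma>" using y(1) e(8) by blast
  ultimately show False using x(2) by blast
qed

lemma patch_subset: "mesh \<kappa> q h \<T> \<Longrightarrow> patch \<T> y \<subseteq> \<Gamma>"
  using mesh_elem(1) by (fastforce simp: patch_def)

lemma compact_patch:
  assumes m: "mesh \<kappa> q h \<T>" shows "compact (patch \<T> y)"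
proof -
  have "finite \<T>" using m by (simp add: mesh_def conforming_mesh_def)
  then show ?thesis
    unfolding patch_def using mesh_elem(2)[OF m] by (intro compact_Union) auto
qed

lemma patch_dist_le:
  assumes m: "mesh \<kappa> q h \<T>" and "s \<in> patch \<T> y" "t \<in> patch \<T> y"
  shows "dist s t \<le> 2 * \<bar>q\<bar> * h"
proof -
  have *: "dist s y \<le> \<bar>q\<bar> * h" if "s \<in> patch \<T> y" for s
  proof -
    obtain \<gamma> where \<gamma>: "\<gamma> \<in> \<T>" "s \<in> elem \<gamma>" "y \<in> \<gamma> ` Basis"
      using \<open>s \<in> patch \<T> y\<close> unfolding patch_def by blast
    have "y \<in> elem \<gamma>" using \<gamma>(3) hull_subset[of Basis convex] by (auto simp: elem_def ref_simplex_def)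
    then show ?thesis using mesh_elem(4)[OF m \<gamma>(1,2)] by blast
  qed
  show ?thesis using *[OF assms(2)] *[OF assms(3)] dist_triangle2[of s t y] by simp
qed

lemma patch_contains_ball:
  assumes m: "mesh \<kappa> q h \<T>" and "y \<in> nodes \<T>"
  shows "\<exists>x\<in>patch \<T> y. \<Gamma> \<inter> ball x (inradius \<kappa> q * h) \<subseteq> patch \<T> y"
proof -
  obtain \<gamma> where \<gamma>: "\<gamma> \<in> \<T>" "y \<in> \<gamma> ` Basis" using assms(2) by (auto simp: nodes_def)
  then have "elem \<gamma> \<subseteq> patch \<T> y" by (auto simp: patch_def)
  then show ?thesis using mesh_elem(7)[OF m \<gamma>(1)] by blast
qed

lemma mesh_nonempty: assumes "mesh \<kappa> q h \<T>" shows "\<T> \<noteq> {}"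
  using assms nonempty by (auto simp: mesh_def conforming_mesh_def)

lemma mesh_size:
  assumes m: "mesh \<kappa> q h \<T>" shows "h > 0" "h \<le> \<bar>q\<bar> * diam" "inradius \<kappa> q * h \<le> r0" "finite (nodes \<T>)"
  using mesh_nonempty[OF m] mesh_elem(5,6)[OF m] m finite_nodes[of \<T>]
    by (auto simp: mesh_def conforming_mesh_def)

text \<open>Vertices per element times the packing bound for points within
  \<open>\<bar>q\<bar> * h\<close> of a given one that are \<open>inradius \<kappa> q * h\<close>
  apart; \<open>h\<close> cancels.\<close>

definition overlap :: "real \<Rightarrow> real \<Rightarrow> real" where
  "overlap \<kappa> q = real CARD('n) * (2 * \<bar>q\<bar> / inradius \<kappa> q + 1) ^ CARD('n)"

lemma overlap_nonneg: "overlap \<kappa> q \<ge> 0"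
  using inradius_pos[of \<kappa> q] by (simp add: overlap_def)

lemma patch_overlap:
  assumes m: "mesh \<kappa> q h \<T>"
  shows "real (card {y\<in>nodes \<T>. t \<in> patch \<T> y}) \<le> overlap \<kappa> q"
proof -
  define \<rho> where "\<rho> = inradius \<kappa> q * h"
  have h: "h > 0" and fin: "finite \<T>" using m by (auto simp: mesh_def conforming_mesh_def)
  have \<rho>: "\<rho> > 0" using inradius_pos h by (simp add: \<rho>_def)
  define I where "I = {\<gamma>\<in>\<T>. t \<in> elem \<gamma>}"
  have finI: "finite I" using fin by (simp add: I_def)
  have "\<forall>\<gamma>\<in>I. \<exists>x. x \<in> elem \<gamma> \<and> \<Gamma> \<inter> ball x \<rho> \<subseteq> elem \<gamma>"
    using mesh_elem(7)[OF m] unfolding I_def \<rho>_def by blast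
  then obtain x where x: "\<forall>\<gamma>\<in>I. x \<gamma> \<in> elem \<gamma> \<and> \<Gamma> \<inter> ball (x \<gamma>) \<rho> \<subseteq> elem \<gamma>"
    by (rule bchoice[THEN exE])
  have sep: "\<rho> \<le> dist (x \<gamma>) (x \<delta>)" if "\<gamma> \<in> I" "\<delta> \<in> I" "\<gamma> \<noteq> \<delta>" for \<gamma> \<delta>
    using that x by (intro mesh_centres_separated[OF m]) (auto simp: I_def)
  have inj: "inj_on x I" using sep \<rho> by (intro inj_onI) (metis dist_self not_le)
  have "real (card (x ` I)) \<le> (2 * (\<bar>q\<bar> * h) / \<rho> + 1) ^ DIM(real^'n)"
  proof (rule card_separated_le[where x = t])
    show "x ` I \<subseteq> cball t (\<bar>q\<bar> * h)"
    proof clarsimp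
      fix \<gamma> assume "\<gamma> \<in> I"
      then show "dist t (x \<gamma>) \<le> \<bar>q\<bar> * h" using mesh_elem(4)[OF m, of \<gamma> t "x \<gamma>"] x by (auto simp: I_def)
    qed
  qed (use finI \<rho> sep h in auto)
  then have cI: "real (card I) \<le> (2 * \<bar>q\<bar> / inradius \<kappa> q + 1) ^ CARD('n)"
    using h by (simp add: card_image[OF inj] \<rho>_def)
  \<comment> \<open>A node whose patch contains \<open>t\<close> is a vertex of an element through
    \<open>t\<close>.\<close>
  have "{y\<in>nodes \<T>. t \<in> patch \<T> y} \<subseteq> (\<Union>\<gamma>\<in>I. \<gamma> ` Basis)"
    by (auto simp: patch_def I_def)
  then have "card {y\<in>nodes \<T>. t \<in> patch \<T> y} \<le> card (\<Union>\<gamma>\<in>I. \<gamma> ` Basis)"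
    using finI by (intro card_mono) auto
  also have "\<dots> \<le> (\<Sum>\<gamma>\<in>I. card (\<gamma> ` Basis))" by (rule card_UN_le[OF finI])
  also have "\<dots> \<le> (\<Sum>\<gamma>\<in>I. CARD('n))"
  proof (rule sum_mono)
    fix \<gamma> :: "real^'n \<Rightarrow> real^'n" show "card (\<gamma> ` Basis) \<le> CARD('n)"
      using card_image_le[of "Basis :: (real^'n) set" \<gamma>] by simp
  qed
  finally have "card {y\<in>nodes \<T>. t \<in> patch \<T> y} \<le> card I * CARD('n)" by simp
  then have "real (card {y\<in>nodes \<T>. t \<in> patch \<T> y}) \<le> real (card I) * real CARD('n)"
    by (metis of_nat_le_iff of_nat_mult)
  also have "\<dots> \<le> overlap \<kappa> q" unfolding overlap_def using cI by (simp add: mult.commute mult_right_mono)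
  finally show ?thesis .
qed

section \<open>Cut-off functions\<close>

text \<open>At a relative boundary point \<open>f\<close> vanishes, so differences to points outside
  the patch are 0. At any other point of the patch a whole neighbourhood in \<Gamma> belongs to the
  patch.\<close>

lemma lip_at_extend_zero:
  assumes "\<tau> \<subseteq> \<Gamma>" "closed \<tau>" and zero: "\<And>x. x \<in> \<Gamma> - \<tau> \<Longrightarrow> f x = 0"
    and bd: "\<And>x. x \<in> (top_of_set \<Gamma>) frontier_of \<tau> \<Longrightarrow> f x = 0"
    and x: "x \<in> \<tau>" "lip_at \<tau> f x B" and "B \<ge> 0"
  shows "lip_at \<Gamma> f x B"
proof -
  obtain \<delta> where \<delta>: "\<delta> > 0" "\<And>y. y \<in> \<tau> \<Longrightarrow> dist y x < \<delta> \<Longrightarrow> \<bar>f y - f x\<bar> \<le> B * dist y x"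
    using x(2) unfolding lip_at_def by blast
  show ?thesis
  proof (cases "x \<in> (top_of_set \<Gamma>) frontier_of \<tau>")
    case True
    then have "f x = 0" by (rule bd)
    then have "\<bar>f y - f x\<bar> \<le> B * dist y x" if "y \<in> \<Gamma>" "dist y x < \<delta>" for y
      using \<delta>(2)[of y] zero[of y] that \<open>B \<ge> 0\<close> by (cases "y \<in> \<tau>") auto
    then show ?thesis unfolding lip_at_def using \<delta>(1) by blast
  next
    case False
    have "x \<in> (top_of_set \<Gamma>) closure_of \<tau>"
      using x(1) assms(1) closure_of_subset[of \<tau> "top_of_set \<Gamma>"] by auto
    then have "x \<in> (top_of_set \<Gamma>) interior_of \<tau>" using False by (simp add: frontier_of_def)
    then obtain T where T: "openin (top_of_set \<Gamma>) T" "x \<in> T" "T \<subseteq> \<tau>" unfolding interior_of_def by blast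
    then obtain \<epsilon> where \<epsilon>: "\<epsilon> > 0" "ball x \<epsilon> \<inter> \<Gamma> \<subseteq> T" unfolding openin_contains_ball by blast
    have "\<bar>f y - f x\<bar> \<le> B * dist y x" if "y \<in> \<Gamma>" "dist y x < min \<delta> \<epsilon>" for y
    proof -
      have "y \<in> \<tau>" using that \<epsilon>(2) T(3) by (auto simp: dist_commute)
      then show ?thesis using \<delta>(2) that by simp
    qed
    then show ?thesis unfolding lip_at_def using \<delta>(1) \<epsilon>(1) by (metis min_less_iff_conj)
  qed
qed

lemma lip_at_zero:
  assumes "closed \<tau>" "x \<in> \<Gamma> - \<tau>" and zero: "\<And>x. x \<in> \<Gamma> - \<tau> \<Longrightarrow> f x = 0" and "B \<ge> 0"
  shows "lip_at \<Gamma> f x B"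
proof -
  have "open (- \<tau>)" using assms(1) by auto
  then obtain \<epsilon> where \<epsilon>: "\<epsilon> > 0" "ball x \<epsilon> \<subseteq> - \<tau>" using assms(2) openE by blast
  have "\<bar>f y - f x\<bar> \<le> B * dist y x" if "y \<in> \<Gamma>" "dist y x < \<epsilon>" for y
  proof -
    have "y \<in> \<Gamma> - \<tau>" using that \<epsilon>(2) by (auto simp: dist_commute)
    then show ?thesis using zero assms by simp
  qed
  then show ?thesis unfolding lip_at_def using \<epsilon>(1) by blast
qed

text \<open>The strict inequality leaves the margin \<open>B - norm g\<close>, which absorbs the
  remainder of the linear approximation.\<close>

lemma lip_at_from_gradient:
  assumes "has_tangential_gradient f g \<tau> x" "norm g < B"
  shows "lip_at \<tau> f x B"
proof -
  have "B - norm g > 0" using assms(2) by simp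
  then obtain \<delta> where \<delta>: "\<delta> > 0" "\<And>y. y \<in> \<tau> \<Longrightarrow> norm (y - x) < \<delta> \<Longrightarrow>
      norm (f y - f x - g \<bullet> (y - x)) \<le> (B - norm g) * norm (y - x)"
    using assms(1) unfolding has_tangential_gradient_def has_derivative_within_alt by blast
  have "\<bar>f y - f x\<bar> \<le> B * dist y x" if "y \<in> \<tau>" "dist y x < \<delta>" for y
  proof -
    have "\<bar>f y - f x - g \<bullet> (y - x)\<bar> \<le> (B - norm g) * norm (y - x)" using \<delta>(2)[of y] that
      by (simp add: dist_norm)
    moreover have "\<bar>g \<bullet> (y - x)\<bar> \<le> norm g * norm (y - x)" by (rule Cauchy_Schwarz_ineq2)
    ultimately show ?thesis by (simp add: dist_norm algebra_simps)
  qed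
  then show ?thesis unfolding lip_at_def using \<delta>(1) by blast
qed

text \<open>The three summands come from three estimates of a difference of values: nearby points by
  the gradient bound, distant points by the sup bound at distance at least
  \<open>r0 / (1 + L)\<close>, and the plain bound \<open>2 * C0\<close> for the entry 1 of the
  minimum.\<close>

definition cutoff_lip :: "real \<Rightarrow> real \<Rightarrow> real" where
  "cutoff_lip C0 H = 2 * C0 * ((1 + L) + H * (1 + L) / r0 + 1)"

text \<open>The constant \<open>B\<close> of the definition of \<open>W1inf_0\<close> gives
  continuity and the crude pointwise bound at every point; the quantitative bounds come from the
  norms, which see only almost every point of the patch.\<close>

lemma cutoff_lipschitz:
  assumes \<tau>: "\<tau> \<subseteq> \<Gamma>" "closed \<tau>" and f: "f \<in> W1inf_0 \<Gamma> \<tau>"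
    and C0: "C0 > 0" "Linf_norm \<tau> f \<le> ennreal C0" and h: "0 < h" "h \<le> H" "W1inf_seminorm \<tau> f \<le> ennreal (C0 / h)"
  shows "\<And>x. x \<in> \<Gamma> - \<tau> \<Longrightarrow> f x = 0" "\<And>x. x \<in> \<Gamma> \<Longrightarrow> \<bar>f x\<bar> \<le> C0"
    "\<And>p q. p \<in> \<Gamma> \<Longrightarrow> q \<in> \<Gamma> \<Longrightarrow> \<bar>f p - f q\<bar> \<le> cutoff_lip C0 H * min 1 (dist p q / h)"
    "continuous_on \<Gamma> f"
proof -
  obtain B where B: "B-lipschitz_on \<tau> f" and bd: "\<And>x. x \<in> (top_of_set \<Gamma>) frontier_of \<tau> \<Longrightarrow> f x = 0"
    and zero: "\<And>x. x \<in> \<Gamma> - \<tau> \<Longrightarrow> f x = 0"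
    using f unfolding W1inf_0_def by blast
  show "\<And>x. x \<in> \<Gamma> - \<tau> \<Longrightarrow> f x = 0" by (rule zero)
  have B0: "B \<ge> 0" using B by (rule lipschitz_on_nonneg)
  have lipB: "lip_at \<Gamma> f x B" if "x \<in> \<Gamma>" for x
  proof (cases "x \<in> \<tau>")
    case True
    have "lip_at \<tau> f x B"
      unfolding lip_at_def using lipschitz_onD[OF B _ True]
        by (intro exI[of _ 1]) (auto simp: dist_real_def)
    then show ?thesis by (intro lip_at_extend_zero[OF \<tau> zero bd True _ B0])
  next
    case False
    then show ?thesis using that by (intro lip_at_zero[OF \<tau>(2) _ zero B0]) auto
  qed
  show cont: "continuous_on \<Gamma> f" using lipB by (rule lip_at_imp_continuous)
  \<comment> \<open>Twice the given bound: the infimum in \<open>W1inf_seminorm\<close> need not be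
    attained, and \<open>lip_at_from_gradient\<close> asks for strict inequality.\<close>
  define G where "G = 2 * C0 / h"
  have G0: "G > 0" using C0 h by (simp add: G_def)
  have tb: "\<tau> \<in> sets borel" using \<tau>(2) by (rule borel_closed)
  have AE_\<tau>: "(AE x in surf \<tau>. P x) \<longleftrightarrow> (AE x in surf \<Gamma>. x \<in> \<tau> \<longrightarrow> P x)" for P
    unfolding surf_subset_eq[OF \<tau>(1) tb borel]
    using sets_surf_subset[OF tb \<tau>(1)] \<tau>(1) by (intro AE_restrict_space_iff) (simp add: Int_absorb2)
  have AE_lip: "AE x in surf \<Gamma>. lip_at \<Gamma> f x G"
  proof -
    have "ennreal (C0 / h) < ennreal G" using C0 h
      by (intro ennreal_lessI) (auto simp: G_def divide_strict_right_mono)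
    then have "W1inf_seminorm \<tau> f < ennreal G" using h(3) by (rule le_less_trans[rotated])
    then obtain l where l: "AE x in surf \<tau>. \<exists>g. has_tangential_gradient f g \<tau> x \<and> ennreal (norm g) \<le> l" "l < ennreal G"
      unfolding W1inf_seminorm_def Inf_less_iff by blast
    have *: "lip_at \<tau> f x G" if g: "\<exists>g. has_tangential_gradient f g \<tau> x \<and> ennreal (norm g) \<le> l" for x
    proof -
      obtain g where g: "has_tangential_gradient f g \<tau> x" "ennreal (norm g) \<le> l" using g by blast
      have "ennreal (norm g) < ennreal G" using g(2) l(2) by (rule le_less_trans)
      then have "norm g < G" using G0 by (simp add: ennreal_less_iff)
      then show ?thesis by (rule lip_at_from_gradient[OF g(1)])
    qed
    have "AE x in surf \<Gamma>. x \<in> \<tau> \<longrightarrow> (\<exists>g. has_tangential_gradient f g \<tau> x \<and> ennreal (norm g) \<le> l)"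
      using l(1) unfolding AE_\<tau> .
    moreover have "AE x in surf \<Gamma>. x \<in> \<Gamma>" by (rule AE_I2) simp
    ultimately show ?thesis
    proof eventually_elim
      fix x assume x: "x \<in> \<tau> \<longrightarrow> (\<exists>g. has_tangential_gradient f g \<tau> x \<and> ennreal (norm g) \<le> l)" "x \<in> \<Gamma>"
      show "lip_at \<Gamma> f x G"
      proof (cases "x \<in> \<tau>")
        case True
        then show ?thesis using x * G0 by (intro lip_at_extend_zero[OF \<tau> zero bd]) auto
      next
        case False
        then show ?thesis using x G0 by (intro lip_at_zero[OF \<tau>(2) _ zero]) auto
      qed
    qed
  qed
  have lip: "\<bar>f p - f q\<bar> \<le> G * (1 + L) * dist p q"
    if "p \<in> \<Gamma>" "q \<in> \<Gamma>" "dist p q < r0 / (1 + L)" for p q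
    using B0 lipB less_imp_le[OF G0] AE_lip that by (rule lipschitz_from_lip_at)
  have AEb: "AE x in surf \<Gamma>. \<bar>f x\<bar> \<le> C0"
  proof -
    have "AE x in surf \<tau>. ennreal \<bar>f x\<bar> \<le> Linf_norm \<tau> f" unfolding Linf_norm_def by (rule esssup_AE)
    then have "AE x in surf \<Gamma>. x \<in> \<tau> \<longrightarrow> ennreal \<bar>f x\<bar> \<le> Linf_norm \<tau> f" unfolding AE_\<tau> .
    moreover have "AE x in surf \<Gamma>. x \<in> \<Gamma>" by (rule AE_I2) simp
    ultimately show ?thesis
    proof eventually_elim
      fix x assume x: "x \<in> \<tau> \<longrightarrow> ennreal \<bar>f x\<bar> \<le> Linf_norm \<tau> f" "x \<in> \<Gamma>"
      show "\<bar>f x\<bar> \<le> C0"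
      proof (cases "x \<in> \<tau>")
        case True
        then have "ennreal \<bar>f x\<bar> \<le> ennreal C0" using x(1) C0(2) by (meson order_trans)
        then show ?thesis using C0(1) by (simp add: ennreal_le_iff)
      next
        case False then show ?thesis using zero[of x] x C0 by simp
      qed
    qed
  qed
  show bound: "\<bar>f x\<bar> \<le> C0" if x: "x \<in> \<Gamma>" for x
  proof (rule field_le_epsilon)
    fix \<epsilon> :: real assume "\<epsilon> > 0"
    then obtain \<delta> where \<delta>: "\<delta> > 0" "\<And>y. y \<in> \<Gamma> \<Longrightarrow> dist y x < \<delta> \<Longrightarrow> dist (f y) (f x) < \<epsilon>"
      using cont x unfolding continuous_on_iff by blast
    obtain y where "y \<in> \<Gamma>" "dist y x < \<delta>" "\<bar>f y\<bar> \<le> C0" using AE_surf_dense[OF AEb x \<delta>(1)] .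
    then show "\<bar>f x\<bar> \<le> C0 + \<epsilon>" using \<delta>(2)[of y] by (simp add: dist_real_def)
  qed
  show "\<bar>f p - f q\<bar> \<le> cutoff_lip C0 H * min 1 (dist p q / h)" if pq: "p \<in> \<Gamma>" "q \<in> \<Gamma>" for p q
  proof -
    define \<Lambda> where "\<Lambda> = cutoff_lip C0 H"
    have H: "H > 0" using h by simp
    have t1: "2 * C0 * (H * (1 + L) / r0) \<ge> 0" using C0 L H r0 by simp
    have t2: "2 * C0 * (1 + L) \<ge> 0" using C0 L by simp
    have \<Lambda>: "\<Lambda> = 2 * C0 * (1 + L) + 2 * C0 * (H * (1 + L) / r0) + 2 * C0"
      by (simp add: \<Lambda>_def cutoff_lip_def algebra_simps)
    have b2: "\<bar>f p - f q\<bar> \<le> 2 * C0" using bound[OF pq(1)] bound[OF pq(2)] by linarith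
    then have "\<bar>f p - f q\<bar> \<le> \<Lambda>" using \<Lambda> t1 t2 by linarith
    moreover have "\<bar>f p - f q\<bar> \<le> \<Lambda> * (dist p q / h)"
    proof (cases "dist p q < r0 / (1 + L)")
      case True
      have "\<bar>f p - f q\<bar> \<le> G * (1 + L) * dist p q" by (rule lip[OF pq True])
      also have "\<dots> = 2 * C0 * (1 + L) * (dist p q / h)" by (simp add: G_def)
      also have "\<dots> \<le> \<Lambda> * (dist p q / h)" using \<Lambda> t1 C0 h by (intro mult_right_mono) auto
      finally show ?thesis .
    next
      case False
      \<comment> \<open>Distant points: the bound \<open>2 * C0\<close> is multiplied by a factor of
        at least 1 that is proportional to the distance, and \<open>h \<le> H\<close> introduces the
        scale \<open>h\<close>.\<close>
      then have "1 \<le> (1 + L) / r0 * dist p q" using L r0 by (simp add: field_simps)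
      then have "2 * C0 * 1 \<le> 2 * C0 * ((1 + L) / r0 * dist p q)" using C0 by (intro mult_left_mono) auto
      also have "\<dots> = 2 * C0 * (h * (1 + L) / r0) * (dist p q / h)" using h by simp
      also have "\<dots> \<le> 2 * C0 * (H * (1 + L) / r0) * (dist p q / h)"
        using h C0 L r0 by (intro mult_right_mono mult_left_mono divide_right_mono) auto
      also have "\<dots> \<le> \<Lambda> * (dist p q / h)" using \<Lambda> t2 C0 h by (intro mult_right_mono) auto
      finally show ?thesis using b2 by simp
    qed
    ultimately show ?thesis unfolding \<Lambda>_def[symmetric] by (simp add: min_def)
  qed
qed

end

section \<open>The \<open>H\<^sup>1\<^sup>/\<^sup>2\<close> energy on a Lipschitz surface\<close>

lemma dyadic_bracket:
  assumes "1 \<le> (x::real)"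
  obtains i :: nat where "2 ^ i \<le> x" "x < 2 ^ Suc i"
proof -
  obtain j where j: "x < 2 ^ j" using real_arch_pow[of 2 x] by auto
  define i where "i = (LEAST i. x < 2 ^ Suc i)"
  have "x < 2 ^ Suc j" using j by (simp, smt (verit) zero_less_power)
  then have 1: "x < 2 ^ Suc i" unfolding i_def by (rule LeastI)
  have "2 ^ i \<le> x"
  proof (cases i)
    case (Suc k)
    then have "\<not> x < 2 ^ Suc k" unfolding i_def by (metis lessI not_less_Least)
    then show ?thesis using Suc by simp
  qed (use assms in simp)
  then show ?thesis using 1 by (rule that)
qed

context lipschitz_surface
begin

lemma finite_measure_surf: "finite_measure (surf \<Gamma>)"
  by (rule finite_measureI) (use finite_surf in \<open>simp add: less_top\<close>)

sublocale M: finite_measure "surf \<Gamma>"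
  by (rule finite_measure_surf)

sublocale MM: pair_sigma_finite "surf \<Gamma>" "surf \<Gamma>" ..

lemma measurable_ident_surf [measurable]: "(\<lambda>x. x) \<in> borel_measurable (surf \<Gamma>)"
proof -
  have "(\<lambda>x. x) \<in> borel_measurable (restrict_space borel \<Gamma>)" by (rule measurable_restrict_space1) simp
  then show ?thesis by (simp cong: measurable_cong_sets add: sets_surf)
qed

lemma sets_surf_D: "A \<in> sets (surf \<Gamma>) \<Longrightarrow> A \<subseteq> \<Gamma>"
  using sets.sets_into_space by fastforce

text \<open>Up to the square of the Lipschitz constant, this majorises the seminorm density of a
  cut-off function, which varies by at most a multiple of
  \<open>min 1 (dist s t / h)\<close>.\<close>

definition kernel :: "real \<Rightarrow> real^'n \<Rightarrow> real^'n \<Rightarrow> real" where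
  "kernel h s t = (min 1 (dist s t / h))\<^sup>2 / norm (t - s) ^ CARD('n)"

lemma kernel_sym: "kernel h s t = kernel h t s"
  by (simp add: kernel_def dist_commute norm_minus_commute)

lemma kernel_nonneg: "0 \<le> kernel h s t"
  by (simp add: kernel_def)

lemma borel_measurable_kernel [measurable]:
  "(\<lambda>z. kernel h (fst z) (snd z)) \<in> borel_measurable (surf \<Gamma> \<Otimes>\<^sub>M surf \<Gamma>)"
  "(\<lambda>t. kernel h s t) \<in> borel_measurable (surf \<Gamma>)"
  unfolding kernel_def by measurable

text \<open>Dyadic decomposition around \<open>s\<close>. At distance \<open>u\<close> below
  \<open>h\<close> the kernel is \<open>1 / (h^2 u^(n-2))\<close>, and mass of order
  \<open>u^(n-1)\<close> gives \<open>u / h^2\<close>; above \<open>h\<close> the kernel is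
  \<open>1 / u^n\<close>, which gives \<open>1 / u\<close>. Both are geometric series led by a term
  of order \<open>1 / h\<close>.\<close>

lemma kernel_integral:
  "\<exists>C>0. \<forall>h>0. \<forall>s\<in>\<Gamma>. (\<integral>\<^sup>+t. ennreal (kernel h s t) \<partial>surf \<Gamma>) \<le> ennreal (C / h)"
proof -
  obtain A where A: "A > 0" "\<And>x r. x \<in> \<Gamma> \<Longrightarrow> r > 0 \<Longrightarrow> emeasure (surf \<Gamma>) (\<Gamma> \<inter> ball x r) \<le> ennreal (A * r ^ d)"
    using upper_regular by blast
  \<comment> \<open>\<open>m\<close> is \<open>CARD('n) - 2\<close>, the exponent of the singularity
    left after the square of the distance has cancelled.\<close>
  obtain m where m: "d = Suc m" using d1 by (cases d) auto
  have n: "CARD('n) = Suc (Suc m)" using Suc_d m by simp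
  show ?thesis
  proof (intro exI[of _ "A * 4 ^ Suc d"] conjI allI impI ballI)
    show "A * 4 ^ Suc d > 0" using A by simp
    fix h :: real and s assume h: "h > 0" and s: "s \<in> \<Gamma>"
    define c where "c i = 1 / (h\<^sup>2 * (h / 2 ^ Suc i) ^ m)" for i :: nat
    define e where "e i = 1 / (2 ^ i * h) ^ CARD('n)" for i :: nat
    define Bc where "Bc i = \<Gamma> \<inter> ball s (2 * (h / 2 ^ i))" for i :: nat
    define Be where "Be i = \<Gamma> \<inter> ball s (2 * (2 ^ i * h))" for i :: nat
    have c0: "c i \<ge> 0" "e i \<ge> 0" for i using h by (auto simp: c_def e_def)
    have sets: "Bc i \<in> sets (surf \<Gamma>)" "Be i \<in> sets (surf \<Gamma>)" for i
      unfolding Bc_def Be_def using borel by (auto intro!: sets_surf_subset)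
    have le_suminf: "f i \<le> suminf f" for f :: "nat \<Rightarrow> ennreal" and i
      using sum_le_suminf[of f "{i}"] by simp
    have point: "ennreal (kernel h s t) \<le> (\<Sum>i. ennreal (c i) * indicator (Bc i) t) + (\<Sum>i. ennreal (e i) * indicator (Be i) t)"
      if t: "t \<in> \<Gamma>" for t
    proof -
      define \<rho> where "\<rho> = dist s t"
      have k: "kernel h s t = (min 1 (\<rho> / h))\<^sup>2 / \<rho> ^ CARD('n)"
        by (simp add: kernel_def \<rho>_def dist_norm norm_minus_commute)
      consider "\<rho> = 0" | "0 < \<rho>" "\<rho> < h" | "h \<le> \<rho>" unfolding \<rho>_def using zero_le_dist[of s t] by linarith
      then show ?thesis
      proof cases
        case 1
        \<comment> \<open>On the diagonal the minimum is 0, so the kernel is 0 as well.\<close>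
        then show ?thesis using k h by simp
      next
        case 2
        have "1 \<le> h / \<rho>" using 2 by (simp add: field_simps)
        then obtain i where i: "2 ^ i \<le> h / \<rho>" "h / \<rho> < 2 ^ Suc i" by (rule dyadic_bracket)
        have r1: "h / 2 ^ Suc i \<le> \<rho>" using i(2) 2 by (simp add: field_simps)
        have "\<rho> \<le> h / 2 ^ i" using i(1) 2 by (simp add: field_simps)
        moreover have "h / 2 ^ i > 0" using h by simp
        ultimately have r2: "\<rho> < 2 * (h / 2 ^ i)" by linarith
        have "kernel h s t = (\<rho> / h)\<^sup>2 / \<rho> ^ CARD('n)" unfolding k using 2 by (simp add: min_def)
        also have "\<dots> = 1 / (h\<^sup>2 * \<rho> ^ m)" using 2 h unfolding n by (simp add: power2_eq_square)
        also have "\<dots> \<le> c i" unfolding c_def using r1 h 2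
          by (intro divide_left_mono mult_left_mono power_mono mult_pos_pos zero_less_power) auto
        finally have "ennreal (kernel h s t) \<le> ennreal (c i) * indicator (Bc i) t"
          using r2 t by (simp add: Bc_def \<rho>_def ennreal_leI)
        also have "\<dots> \<le> (\<Sum>i. ennreal (c i) * indicator (Bc i) t)" by (rule le_suminf)
        finally show ?thesis by (rule order_trans) simp
      next
        case 3
        have "1 \<le> \<rho> / h" using 3 h by (simp add: field_simps)
        then obtain i where i: "2 ^ i \<le> \<rho> / h" "\<rho> / h < 2 ^ Suc i" by (rule dyadic_bracket)
        have r1: "2 ^ i * h \<le> \<rho>" "\<rho> < 2 * (2 ^ i * h)" using i h by (simp_all add: field_simps)
        have "kernel h s t = 1 / \<rho> ^ CARD('n)" unfolding k using 3 h by (simp add: min_def)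
        also have "\<dots> \<le> e i" unfolding e_def using r1 h 3
          by (intro divide_left_mono power_mono mult_pos_pos zero_less_power) auto
        finally have "ennreal (kernel h s t) \<le> ennreal (e i) * indicator (Be i) t"
          using r1(2) t by (simp add: Be_def \<rho>_def ennreal_leI)
        also have "\<dots> \<le> (\<Sum>i. ennreal (e i) * indicator (Be i) t)" by (rule le_suminf)
        finally show ?thesis by (rule order_trans) simp
      qed
    qed
    have geo: "(\<Sum>i. ennreal (B * (1/2) ^ i)) = ennreal (2 * B)" if "B \<ge> 0" for B :: real
    proof -
      have "(\<lambda>i. B * (1/2) ^ i) sums (B * (1 / (1 - 1/2)))" by (intro sums_mult geometric_sums) simp
      then have "(\<lambda>i. B * (1/2) ^ i) sums (2 * B)" by (simp add: mult.commute)
      then show ?thesis using that by (intro suminf_ennreal_eq) auto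
    qed
    \<comment> \<open>The shells inside and outside give \<open>2 * 4 ^ m\<close> and
      \<open>2 ^ d\<close>; both are rounded up to \<open>4 ^ d\<close>, so that one geometric
      series handles the two sums.\<close>
    have Ic: "ennreal (c i) * emeasure (surf \<Gamma>) (Bc i) \<le> ennreal (A * 4 ^ d / h * (1/2) ^ i)" for i
    proof -
      have "ennreal (c i) * emeasure (surf \<Gamma>) (Bc i) \<le> ennreal (c i) * ennreal (A * (2 * (h / 2 ^ i)) ^ d)"
        unfolding Bc_def using A(2)[OF s, of "2 * (h / 2 ^ i)"] h by (intro mult_left_mono) auto
      also have "\<dots> = ennreal (c i * (A * (2 * (h / 2 ^ i)) ^ d))" using c0 A h by (simp add: ennreal_mult)
      also have "c i * (A * (2 * (h / 2 ^ i)) ^ d) = A * (2 * 4 ^ m) / h * (1/2) ^ i"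
      proof -
        define u where "u = h / 2 ^ i"
        have u: "u > 0" "u = h * (1/2) ^ i" using h by (simp_all add: u_def power_one_over)
        have "c i = 1 / (h\<^sup>2 * (u / 2) ^ m)" by (simp add: c_def u_def mult.commute)
        then have "c i * (A * (2 * u) ^ d) = A * (2 * u) * ((2 * u) ^ m / (u / 2) ^ m) / h\<^sup>2"
          by (simp add: m mult_ac)
        also have "(2 * u) ^ m / (u / 2) ^ m = 4 ^ m"
        proof -
          have "(2 * u) ^ m / (u / 2) ^ m = ((2 * u) / (u / 2)) ^ m" by (rule power_divide[symmetric])
          also have "(2 * u) / (u / 2) = 4" using u(1) by simp
          finally show ?thesis .
        qed
        also have "A * (2 * u) * 4 ^ m / h\<^sup>2 = A * (2 * 4 ^ m) / h * (1/2) ^ i"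
          unfolding u(2) using h by (simp add: power2_eq_square)
        finally show ?thesis unfolding u_def .
      qed
      also have "\<dots> \<le> A * 4 ^ d / h * (1/2) ^ i"
        unfolding m using A h by (intro mult_right_mono divide_right_mono mult_left_mono) auto
      finally show ?thesis by (simp add: ennreal_leI)
    qed
    have Ie: "ennreal (e i) * emeasure (surf \<Gamma>) (Be i) \<le> ennreal (A * 4 ^ d / h * (1/2) ^ i)" for i
    proof -
      have "ennreal (e i) * emeasure (surf \<Gamma>) (Be i) \<le> ennreal (e i) * ennreal (A * (2 * (2 ^ i * h)) ^ d)"
        unfolding Be_def using A(2)[OF s, of "2 * (2 ^ i * h)"] h by (intro mult_left_mono) auto
      also have "\<dots> = ennreal (e i * (A * (2 * (2 ^ i * h)) ^ d))" using c0 A h by (simp add: ennreal_mult)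
      also have "e i * (A * (2 * (2 ^ i * h)) ^ d) = A * 2 ^ d / h * (1/2) ^ i"
      proof -
        define u where "u = 2 ^ i * h"
        have u: "u > 0" "1 / u = 1 / h * (1/2) ^ i" using h by (simp_all add: u_def power_one_over)
        have "e i * (A * (2 * u) ^ d) = A * 2 ^ d * (1 / u)"
          using u(1) unfolding e_def u_def[symmetric] Suc_d[symmetric] by (simp add: power_mult_distrib)
        then show ?thesis unfolding u_def[symmetric] u(2) by simp
      qed
      also have "\<dots> \<le> A * 4 ^ d / h * (1/2) ^ i"
        using A h by (intro mult_right_mono divide_right_mono mult_left_mono power_mono) auto
      finally show ?thesis by (simp add: ennreal_leI)
    qed
    note [measurable] = sets
    have "(\<integral>\<^sup>+t. ennreal (kernel h s t) \<partial>surf \<Gamma>) \<le>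
       (\<integral>\<^sup>+t. (\<Sum>i. ennreal (c i) * indicator (Bc i) t) + (\<Sum>i. ennreal (e i) * indicator (Be i) t) \<partial>surf \<Gamma>)"
      by (intro nn_integral_mono point) simp
    also have "\<dots> = (\<integral>\<^sup>+t. (\<Sum>i. ennreal (c i) * indicator (Bc i) t) \<partial>surf \<Gamma>) + (\<integral>\<^sup>+t. (\<Sum>i. ennreal (e i) * indicator (Be i) t) \<partial>surf \<Gamma>)"
      by (rule nn_integral_add) measurable
    also have "(\<integral>\<^sup>+t. (\<Sum>i. ennreal (c i) * indicator (Bc i) t) \<partial>surf \<Gamma>) = (\<Sum>i. ennreal (c i) * emeasure (surf \<Gamma>) (Bc i))"
      using sets by (subst nn_integral_suminf) (auto simp: nn_integral_cmult_indicator)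
    also have "(\<integral>\<^sup>+t. (\<Sum>i. ennreal (e i) * indicator (Be i) t) \<partial>surf \<Gamma>) = (\<Sum>i. ennreal (e i) * emeasure (surf \<Gamma>) (Be i))"
      using sets by (subst nn_integral_suminf) (auto simp: nn_integral_cmult_indicator)
    also have "(\<Sum>i. ennreal (c i) * emeasure (surf \<Gamma>) (Bc i)) + (\<Sum>i. ennreal (e i) * emeasure (surf \<Gamma>) (Be i))
       \<le> (\<Sum>i. ennreal (A * 4 ^ d / h * (1/2) ^ i)) + (\<Sum>i. ennreal (A * 4 ^ d / h * (1/2) ^ i))"
      by (intro add_mono suminf_le Ic Ie summableI)
    also have "\<dots> = ennreal (2 * (A * 4 ^ d / h)) + ennreal (2 * (A * 4 ^ d / h))"
    proof -
      have "0 \<le> A * 4 ^ d / h" using A h by simp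
      then show ?thesis by (simp only: geo)
    qed
    also have "\<dots> = ennreal (A * 4 ^ Suc d / h)" using A h
      by (simp add: ennreal_plus[symmetric] del: ennreal_plus)
    finally show "(\<integral>\<^sup>+t. ennreal (kernel h s t) \<partial>surf \<Gamma>) \<le> ennreal (A * 4 ^ Suc d / h)" .
  qed
qed

text \<open>The seminorm density on the product space: by Tonelli the iterated integral in the
  definition becomes a single one, which can be restricted to sets of pairs.\<close>

definition edens :: "(real^'n \<Rightarrow> real) \<Rightarrow> (real^'n) \<times> (real^'n) \<Rightarrow> real" where
  "edens v z = (v (fst z) - v (snd z))\<^sup>2 / norm (fst z - snd z) ^ CARD('n)"

lemma edens_nonneg: "0 \<le> edens v z"
  by (simp add: edens_def)

lemma borel_measurable_edens [measurable]:
  assumes [measurable]: "v \<in> borel_measurable (surf \<Gamma>)"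
  shows "edens v \<in> borel_measurable (surf \<Gamma> \<Otimes>\<^sub>M surf \<Gamma>)"
  unfolding edens_def[abs_def] by measurable

lemma half_seminorm_sq_eq:
  assumes [measurable]: "v \<in> borel_measurable (surf \<Gamma>)"
  shows "half_seminorm_sq \<Gamma> v = (\<integral>\<^sup>+z. ennreal (edens v z) \<partial>(surf \<Gamma> \<Otimes>\<^sub>M surf \<Gamma>))"
  unfolding half_seminorm_sq_def by (subst M.nn_integral_fst[symmetric]) (auto simp: edens_def)

section \<open>Elementary properties of \<open>Hhalf\<close>\<close>

lemma L2_sq_cong: "(\<And>x. x \<in> \<Gamma> \<Longrightarrow> v x = w x) \<Longrightarrow> L2_sq \<Gamma> v = L2_sq \<Gamma> w"
  unfolding L2_sq_def by (intro nn_integral_cong) simp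

lemma half_seminorm_sq_cong: "(\<And>x. x \<in> \<Gamma> \<Longrightarrow> v x = w x) \<Longrightarrow> half_seminorm_sq \<Gamma> v = half_seminorm_sq \<Gamma> w"
  unfolding half_seminorm_sq_def by (intro nn_integral_cong) simp

lemma Hhalf_cong:
  assumes "\<And>x. x \<in> \<Gamma> \<Longrightarrow> v x = w x"
  shows "v \<in> Hhalf \<Gamma> \<longleftrightarrow> w \<in> Hhalf \<Gamma>" "Hhalf_norm \<Gamma> v = Hhalf_norm \<Gamma> w"
proof -
  have "v \<in> borel_measurable (surf \<Gamma>) \<longleftrightarrow> w \<in> borel_measurable (surf \<Gamma>)"
    using assms by (intro measurable_cong) simp
  then show "v \<in> Hhalf \<Gamma> \<longleftrightarrow> w \<in> Hhalf \<Gamma>" "Hhalf_norm \<Gamma> v = Hhalf_norm \<Gamma> w"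
    using L2_sq_cong[OF assms] half_seminorm_sq_cong[OF assms] by (auto simp: Hhalf_def Hhalf_norm_def)
qed

lemma half_seminorm_sq_shift: "half_seminorm_sq \<Gamma> (\<lambda>x. v x - c) = half_seminorm_sq \<Gamma> v"
  by (simp add: half_seminorm_sq_def)

lemma Hhalf_measurable: "v \<in> Hhalf \<Gamma> \<Longrightarrow> v \<in> borel_measurable (surf \<Gamma>)"
  and Hhalf_finite: "v \<in> Hhalf \<Gamma> \<Longrightarrow> L2_sq \<Gamma> v < \<infinity>" "v \<in> Hhalf \<Gamma> \<Longrightarrow> half_seminorm_sq \<Gamma> v < \<infinity>"
  by (auto simp: Hhalf_def)

lemma HhalfI: "v \<in> borel_measurable (surf \<Gamma>) \<Longrightarrow> L2_sq \<Gamma> v < \<infinity> \<Longrightarrow> half_seminorm_sq \<Gamma> v < \<infinity> \<Longrightarrow> v \<in> Hhalf \<Gamma>"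
  by (auto simp: Hhalf_def)

lemma sq_lincomb_le: "(a * x + b * y)\<^sup>2 \<le> 2 * a\<^sup>2 * x\<^sup>2 + 2 * b\<^sup>2 * (y::real)\<^sup>2"
proof -
  have "0 \<le> (a * x - b * y)\<^sup>2" by simp
  then show ?thesis by (simp add: power2_eq_square algebra_simps)
qed

lemma Hhalf_lincomb:
  assumes v: "v \<in> Hhalf \<Gamma>" and w: "w \<in> Hhalf \<Gamma>"
  shows "(\<lambda>x. a * v x + b * w x) \<in> Hhalf \<Gamma>"
proof (rule HhalfI)
  note [measurable] = Hhalf_measurable[OF v] Hhalf_measurable[OF w]
  show m: "(\<lambda>x. a * v x + b * w x) \<in> borel_measurable (surf \<Gamma>)" by measurable
  have "L2_sq \<Gamma> (\<lambda>x. a * v x + b * w x) \<le>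
      (\<integral>\<^sup>+x. ennreal (2 * a\<^sup>2) * ennreal ((v x)\<^sup>2) + ennreal (2 * b\<^sup>2) * ennreal ((w x)\<^sup>2) \<partial>surf \<Gamma>)"
    unfolding L2_sq_def
    by (intro nn_integral_mono) (simp add: ennreal_mult[symmetric] ennreal_plus[symmetric] ennreal_leI sq_lincomb_le del: ennreal_plus)
  also have "\<dots> = ennreal (2 * a\<^sup>2) * L2_sq \<Gamma> v + ennreal (2 * b\<^sup>2) * L2_sq \<Gamma> w"
    unfolding L2_sq_def by (simp add: nn_integral_add nn_integral_cmult)
  also have "\<dots> < \<infinity>" using Hhalf_finite(1)[OF v] Hhalf_finite(1)[OF w] by (simp add: ennreal_mult_less_top)
  finally show "L2_sq \<Gamma> (\<lambda>x. a * v x + b * w x) < \<infinity>" .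
  have p: "edens (\<lambda>x. a * v x + b * w x) z \<le> 2 * a\<^sup>2 * edens v z + 2 * b\<^sup>2 * edens w z" for z
  proof -
    have "(a * v (fst z) + b * w (fst z) - (a * v (snd z) + b * w (snd z)))\<^sup>2 =
       (a * (v (fst z) - v (snd z)) + b * (w (fst z) - w (snd z)))\<^sup>2" by (simp add: algebra_simps)
    also have "\<dots> \<le> 2 * a\<^sup>2 * (v (fst z) - v (snd z))\<^sup>2 + 2 * b\<^sup>2 * (w (fst z) - w (snd z))\<^sup>2"
      by (rule sq_lincomb_le)
    finally show ?thesis unfolding edens_def by (simp add: divide_right_mono add_divide_distrib[symmetric])
  qed
  have "half_seminorm_sq \<Gamma> (\<lambda>x. a * v x + b * w x) \<le>
      (\<integral>\<^sup>+z. ennreal (2 * a\<^sup>2) * ennreal (edens v z) + ennreal (2 * b\<^sup>2) * ennreal (edens w z) \<partial>(surf \<Gamma> \<Otimes>\<^sub>M surf \<Gamma>))"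
    unfolding half_seminorm_sq_eq[OF m]
    by (intro nn_integral_mono) (simp add: ennreal_mult[symmetric] ennreal_plus[symmetric] ennreal_leI p edens_nonneg del: ennreal_plus)
  also have "\<dots> = ennreal (2 * a\<^sup>2) * half_seminorm_sq \<Gamma> v + ennreal (2 * b\<^sup>2) * half_seminorm_sq \<Gamma> w"
    by (simp add: nn_integral_add nn_integral_cmult half_seminorm_sq_eq)
  also have "\<dots> < \<infinity>" using Hhalf_finite(2)[OF v] Hhalf_finite(2)[OF w] by (simp add: ennreal_mult_less_top)
  finally show "half_seminorm_sq \<Gamma> (\<lambda>x. a * v x + b * w x) < \<infinity>" .
qed

lemma Hhalf_const: "(\<lambda>_. c) \<in> Hhalf \<Gamma>"
proof (rule HhalfI)
  show "L2_sq \<Gamma> (\<lambda>_. c) < \<infinity>" using finite_surf by (simp add: L2_sq_def ennreal_mult_less_top)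
qed (simp_all add: half_seminorm_sq_def)

lemma Hhalf_diff_const: "v \<in> Hhalf \<Gamma> \<Longrightarrow> (\<lambda>x. v x - c) \<in> Hhalf \<Gamma>"
  using Hhalf_lincomb[OF _ Hhalf_const[of 1], of v 1 "- c"] by simp

lemma Hhalf_sum:
  "finite I \<Longrightarrow> (\<And>i. i \<in> I \<Longrightarrow> f i \<in> Hhalf \<Gamma>) \<Longrightarrow> (\<lambda>x. \<Sum>i\<in>I. a i * f i x) \<in> Hhalf \<Gamma>"
proof (induction I rule: finite_induct)
  case empty
  show ?case using Hhalf_const[of 0] by simp
next
  case (insert j I)
  then show ?case using Hhalf_lincomb[of "f j" "\<lambda>x. \<Sum>i\<in>I. a i * f i x" "a j" 1] by simp
qed

lemma nn_integral_surf_subset: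
  assumes "\<tau> \<subseteq> \<Gamma>" "\<tau> \<in> sets borel"
  shows "(\<integral>\<^sup>+x. f x \<partial>surf \<tau>) = (\<integral>\<^sup>+x. f x * indicator \<tau> x \<partial>surf \<Gamma>)"
  unfolding surf_subset_eq[OF assms borel]
  using sets_surf_subset[OF assms(2,1)] assms(1)
    by (intro nn_integral_restrict_space) (simp add: Int_absorb2)

lemma Hhalf_restrict:
  assumes \<tau>: "\<tau> \<subseteq> \<Gamma>" "\<tau> \<in> sets borel" and v: "v \<in> Hhalf \<Gamma>"
  shows "v \<in> Hhalf \<tau>"
proof -
  have "v \<in> borel_measurable (surf \<tau>)"
    unfolding surf_subset_eq[OF \<tau> borel] by (rule measurable_restrict_space1[OF Hhalf_measurable[OF v]])
  moreover have "L2_sq \<tau> v \<le> L2_sq \<Gamma> v"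
    unfolding L2_sq_def nn_integral_surf_subset[OF \<tau>] by (intro nn_integral_mono) (simp add: indicator_def)
  moreover have "half_seminorm_sq \<tau> v \<le> half_seminorm_sq \<Gamma> v"
    unfolding half_seminorm_sq_def nn_integral_surf_subset[OF \<tau>]
  proof (rule nn_integral_mono)
    fix t
    let ?F = "\<lambda>s. ennreal (\<bar>v t - v s\<bar>\<^sup>2 / norm (t - s) ^ CARD('n))"
    have "(\<integral>\<^sup>+s. ?F s * indicator \<tau> s \<partial>surf \<Gamma>) * indicator \<tau> t \<le> (\<integral>\<^sup>+s. ?F s * indicator \<tau> s \<partial>surf \<Gamma>)"
      by (simp add: indicator_def)
    also have "\<dots> \<le> (\<integral>\<^sup>+s. ?F s \<partial>surf \<Gamma>)" by (intro nn_integral_mono) (simp add: indicator_def)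
    finally show "(\<integral>\<^sup>+s. ?F s * indicator \<tau> s \<partial>surf \<Gamma>) * indicator \<tau> t \<le> (\<integral>\<^sup>+s. ?F s \<partial>surf \<Gamma>)" .
  qed
  ultimately show ?thesis using Hhalf_finite[OF v] by (auto simp: Hhalf_def intro: le_less_trans)
qed

text \<open>Instead of the mean value, the value at a well chosen point is subtracted; such a point
  exists because the average of \<open>\<integral> (v(s) - v(t))\<^sup>2 ds\<close> over \<open>t\<close> is bounded by the energy.\<close>

lemma poincare:
  assumes \<tau>: "\<tau> \<in> sets (surf \<Gamma>)" and m: "m > 0" "ennreal m \<le> emeasure (surf \<Gamma>) \<tau>"
    and D: "\<And>s t. s \<in> \<tau> \<Longrightarrow> t \<in> \<tau> \<Longrightarrow> dist s t \<le> D" "D \<ge> 0" and v: "v \<in> borel_measurable (surf \<Gamma>)"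
  obtains t0 where "t0 \<in> \<tau>" "(\<integral>\<^sup>+s. ennreal ((v s - v t0)\<^sup>2) * indicator \<tau> s \<partial>surf \<Gamma>) \<le>
    ennreal (2 * D ^ CARD('n) / m) * (\<integral>\<^sup>+z. ennreal (edens v z) * indicator (\<tau> \<times> \<tau>) z \<partial>(surf \<Gamma> \<Otimes>\<^sub>M surf \<Gamma>))"
proof -
  note [measurable] = v \<tau>
  let ?M = "surf \<Gamma>"
  define F where "F t = (\<integral>\<^sup>+s. ennreal ((v s - v t)\<^sup>2) * indicator \<tau> s \<partial>?M)" for t
  define E where "E = (\<integral>\<^sup>+z. ennreal (edens v z) * indicator (\<tau> \<times> \<tau>) z \<partial>(?M \<Otimes>\<^sub>M ?M))"
  define A where "A = ennreal (D ^ CARD('n)) * E"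
  have [measurable]: "F \<in> borel_measurable ?M" unfolding F_def by measurable
  have FA: "(\<integral>\<^sup>+t. F t * indicator \<tau> t \<partial>?M) \<le> A"
  proof -
    have "(\<integral>\<^sup>+t. F t * indicator \<tau> t \<partial>?M) =
       (\<integral>\<^sup>+t. (\<integral>\<^sup>+s. ennreal ((v s - v t)\<^sup>2) * indicator \<tau> s * indicator \<tau> t \<partial>?M) \<partial>?M)"
      unfolding F_def by (intro nn_integral_cong nn_integral_multc[symmetric]) measurable
    also have "\<dots> \<le> (\<integral>\<^sup>+t. (\<integral>\<^sup>+s. ennreal (D ^ CARD('n)) * (ennreal (edens v (t,s)) * indicator (\<tau> \<times> \<tau>) (t,s)) \<partial>?M) \<partial>?M)"
    proof (intro nn_integral_mono)
      fix t s
      show "ennreal ((v s - v t)\<^sup>2) * indicator \<tau> s * indicator \<tau> t \<le> ennreal (D ^ CARD('n)) * (ennreal (edens v (t,s)) * indicator (\<tau> \<times> \<tau>) (t,s))"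
      proof (cases "t \<in> \<tau> \<and> s \<in> \<tau>")
        case True
        have "(v s - v t)\<^sup>2 \<le> D ^ CARD('n) * edens v (t, s)"
        proof (cases "t = s")
          case False
          have "(v s - v t)\<^sup>2 = norm (t - s) ^ CARD('n) * edens v (t,s)" using False
            by (simp add: edens_def power2_commute)
          also have "\<dots> \<le> D ^ CARD('n) * edens v (t,s)"
            using D(1)[of t s] True edens_nonneg
              by (intro mult_right_mono power_mono) (auto simp: dist_norm)
          finally show ?thesis .
        qed (simp add: edens_def)
        then show ?thesis using True D(2) by (simp add: ennreal_mult[symmetric] edens_nonneg ennreal_leI)
      qed (auto simp: indicator_def)
    qed
    also have "\<dots> = (\<integral>\<^sup>+z. ennreal (D ^ CARD('n)) * (ennreal (edens v z) * indicator (\<tau> \<times> \<tau>) z) \<partial>(?M \<Otimes>\<^sub>M ?M))"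
      by (rule M.nn_integral_fst) measurable
    also have "\<dots> = A" unfolding A_def E_def by (rule nn_integral_cmult) measurable
    finally show ?thesis .
  qed
  \<comment> \<open>The average of \<open>F\<close> over \<open>\<tau>\<close> is at most
    \<open>A / m\<close>. The factor 2 gives room for a contradiction: otherwise
    \<open>2 * A \<le> A\<close>, so \<open>A\<close> is 0 or infinite. If infinite, nothing exceeds
    it; if 0, \<open>F\<close> vanishes almost everywhere on \<open>\<tau>\<close>, although it is
    positive there and \<open>\<tau>\<close> has positive mass.\<close>
  have ex: "\<exists>t0\<in>\<tau>. F t0 \<le> ennreal (2 / m) * A"
  proof (rule ccontr)
    assume "\<not> ?thesis"
    then have *: "\<And>t. t \<in> \<tau> \<Longrightarrow> ennreal (2 / m) * A < F t" by (auto simp: not_le)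
    have "ennreal 2 * A = ennreal (2 / m) * A * ennreal m"
      using m(1) by (simp add: mult.commute mult.left_commute ennreal_mult[symmetric] mult.assoc[symmetric])
    also have "\<dots> \<le> ennreal (2 / m) * A * emeasure ?M \<tau>" by (intro mult_left_mono m(2)) simp
    also have "\<dots> = (\<integral>\<^sup>+t. ennreal (2 / m) * A * indicator \<tau> t \<partial>?M)" using \<tau>
      by (simp add: nn_integral_cmult_indicator)
    also have "\<dots> \<le> (\<integral>\<^sup>+t. F t * indicator \<tau> t \<partial>?M)"
      using * by (intro nn_integral_mono) (auto simp: indicator_def less_imp_le)
    finally have 2: "ennreal 2 * A \<le> A" using FA by simp
    have tau_ne: "emeasure ?M \<tau> \<noteq> 0" using m by (auto simp: ennreal_eq_0_iff not_le)
    have "A \<noteq> \<infinity>"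
    proof
      assume "A = \<infinity>"
      then have "ennreal (2 / m) * A = \<infinity>" using m(1) by (simp add: ennreal_mult_top)
      moreover obtain t where "t \<in> \<tau>" using tau_ne by (metis emeasure_empty ex_in_conv)
      ultimately show False using *[of t] by simp
    qed
    then obtain a where a: "A = ennreal a" "a \<ge> 0" by (cases A) auto
    have "ennreal 2 * ennreal a = ennreal (2 * a)" using a by (simp only: ennreal_mult[symmetric])
    then have "2 * a \<le> a" using 2 a by (simp only: ennreal_le_iff)
    then have "A = 0" using a by simp
    then have "(\<integral>\<^sup>+t. F t * indicator \<tau> t \<partial>?M) = 0" using FA by simp
    moreover have "(\<lambda>t. F t * indicator \<tau> t) \<in> borel_measurable ?M" by measurable
    ultimately have "AE t in ?M. F t * indicator \<tau> t = 0" by (simp only: nn_integral_0_iff_AE)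
    then have "AE t in ?M. t \<notin> \<tau>"
    proof eventually_elim
      fix t assume "F t * indicator \<tau> t = 0"
      then show "t \<notin> \<tau>" using *[of t] by (cases "t \<in> \<tau>") auto
    qed
    then have "emeasure ?M \<tau> = 0" using \<tau> sets_surf_D[OF \<tau>]
      by (subst (asm) AE_iff_measurable[OF _ refl]) (auto simp: Int_absorb1 Collect_conj_eq)
    then show False using tau_ne by simp
  qed
  then obtain t0 where t0: "t0 \<in> \<tau>" "F t0 \<le> ennreal (2 / m) * A" by blast
  have "ennreal (2 / m) * A = ennreal (2 * D ^ CARD('n) / m) * E"
    unfolding A_def mult.assoc[symmetric] using m D(2) by (simp add: ennreal_mult[symmetric])
  then show ?thesis using that[OF t0(1)] t0(2) unfolding F_def E_def by simp
qed

end

text \<open>Product rule for differences: \<open>a * x - b * y\<close> is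
  \<open>a * (x - y) + y * (a - b)\<close>.\<close>

lemma sq_product_diff_le:
  fixes a b x y :: real
  assumes "\<bar>a\<bar> \<le> C" "\<bar>a - b\<bar> \<le> m"
  shows "(a * x - b * y)\<^sup>2 \<le> 2 * C\<^sup>2 * (x - y)\<^sup>2 + 2 * (y\<^sup>2 * m\<^sup>2)"
proof -
  have C: "a\<^sup>2 \<le> C\<^sup>2" "(a - b)\<^sup>2 \<le> m\<^sup>2" using assms by (auto simp: abs_le_square_iff[symmetric])
  have "(a * x - b * y)\<^sup>2 = (a * (x - y) + y * (a - b))\<^sup>2" by (simp add: algebra_simps)
  also have "\<dots> \<le> 2 * (a\<^sup>2 * (x - y)\<^sup>2) + 2 * (y\<^sup>2 * (a - b)\<^sup>2)"
    using sum_squares_ge_zero[of "a * (x - y) - y * (a - b)" 0]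
      by (simp add: power2_eq_square algebra_simps)
  also have "\<dots> \<le> 2 * (C\<^sup>2 * (x - y)\<^sup>2) + 2 * (y\<^sup>2 * m\<^sup>2)"
    using C by (intro add_mono mult_left_mono mult_right_mono) auto
  finally show ?thesis by simp
qed

section \<open>Energy of products with cut-off functions\<close>

context lipschitz_surface
begin

lemma surf_mass_pos: "emeasure (surf \<Gamma>) \<Gamma> = ennreal (measure (surf \<Gamma>) \<Gamma>)" "measure (surf \<Gamma>) \<Gamma> > 0"
proof -
  show 1: "emeasure (surf \<Gamma>) \<Gamma> = ennreal (measure (surf \<Gamma>) \<Gamma>)"
    using finite_surf by (simp add: emeasure_eq_ennreal_measure)
  obtain a where a: "a > 0" "\<And>x r. x \<in> \<Gamma> \<Longrightarrow> 0 < r \<Longrightarrow> r \<le> r0 \<Longrightarrow> ennreal (a * r ^ d) \<le> emeasure (surf \<Gamma>) (\<Gamma> \<inter> ball x r)"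
    using lower_regular by blast
  obtain x where "x \<in> \<Gamma>" using nonempty by blast
  then have "ennreal (a * r0 ^ d) \<le> emeasure (surf \<Gamma>) (\<Gamma> \<inter> ball x r0)" using a(2) r0 by blast
  also have "\<dots> \<le> emeasure (surf \<Gamma>) \<Gamma>" using borel by (intro emeasure_mono sets_surf_subset) auto
  finally have "a * r0 ^ d \<le> measure (surf \<Gamma>) \<Gamma>" unfolding 1 by (simp add: ennreal_le_iff)
  moreover have "a * r0 ^ d > 0" using a(1) r0 by simp
  ultimately show "measure (surf \<Gamma>) \<Gamma> > 0" by linarith
qed

definition poincare_const :: real where
  "poincare_const = 2 * diam ^ CARD('n) / measure (surf \<Gamma>) \<Gamma>"

lemma poincare_const_nonneg: "poincare_const \<ge> 0"
  using diam_nonneg surf_mass_pos by (simp add: poincare_const_def)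

lemma poincare_surface:
  assumes v: "v \<in> borel_measurable (surf \<Gamma>)"
  obtains c where "L2_sq \<Gamma> (\<lambda>x. v x - c) \<le> ennreal poincare_const * half_seminorm_sq \<Gamma> v"
proof -
  have "\<Gamma> \<in> sets (surf \<Gamma>)" by (rule sets_surf_subset[OF borel order_refl])
  then obtain t0 where t0: "(\<integral>\<^sup>+s. ennreal ((v s - v t0)\<^sup>2) * indicator \<Gamma> s \<partial>surf \<Gamma>) \<le>
    ennreal (2 * diam ^ CARD('n) / measure (surf \<Gamma>) \<Gamma>) *
      (\<integral>\<^sup>+z. ennreal (edens v z) * indicator (\<Gamma> \<times> \<Gamma>) z \<partial>(surf \<Gamma> \<Otimes>\<^sub>M surf \<Gamma>))"
    using poincare[OF _ surf_mass_pos(2) _ dist_le_diam diam_nonneg v, of \<Gamma>] surf_mass_pos(1)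
      by (metis order_refl)
  have "(\<integral>\<^sup>+s. ennreal ((v s - v t0)\<^sup>2) * indicator \<Gamma> s \<partial>surf \<Gamma>) = L2_sq \<Gamma> (\<lambda>x. v x - v t0)"
    unfolding L2_sq_def by (intro nn_integral_cong) simp
  moreover have "(\<integral>\<^sup>+z. ennreal (edens v z) * indicator (\<Gamma> \<times> \<Gamma>) z \<partial>(surf \<Gamma> \<Otimes>\<^sub>M surf \<Gamma>)) = half_seminorm_sq \<Gamma> v"
    unfolding half_seminorm_sq_eq[OF v] by (intro nn_integral_cong) (auto simp: space_pair_measure)
  ultimately show ?thesis using that t0 unfolding poincare_const_def by simp
qed

lemma kernel_weighted:
  assumes [measurable]: "g \<in> borel_measurable (surf \<Gamma>)"
    and Ck: "\<And>s. s \<in> \<Gamma> \<Longrightarrow> (\<integral>\<^sup>+t. ennreal (kernel h s t) \<partial>surf \<Gamma>) \<le> B"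
  shows "(\<integral>\<^sup>+z. g (fst z) * ennreal (kernel h (fst z) (snd z)) \<partial>(surf \<Gamma> \<Otimes>\<^sub>M surf \<Gamma>)) \<le> B * (\<integral>\<^sup>+s. g s \<partial>surf \<Gamma>)"
    "(\<integral>\<^sup>+z. g (snd z) * ennreal (kernel h (fst z) (snd z)) \<partial>(surf \<Gamma> \<Otimes>\<^sub>M surf \<Gamma>)) \<le> B * (\<integral>\<^sup>+s. g s \<partial>surf \<Gamma>)"
proof -
  have *: "(\<integral>\<^sup>+s. (\<integral>\<^sup>+t. g s * ennreal (kernel h s t) \<partial>surf \<Gamma>) \<partial>surf \<Gamma>) \<le> B * (\<integral>\<^sup>+s. g s \<partial>surf \<Gamma>)"
  proof -
    have "(\<integral>\<^sup>+s. (\<integral>\<^sup>+t. g s * ennreal (kernel h s t) \<partial>surf \<Gamma>) \<partial>surf \<Gamma>) = (\<integral>\<^sup>+s. g s * (\<integral>\<^sup>+t. ennreal (kernel h s t) \<partial>surf \<Gamma>) \<partial>surf \<Gamma>)"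
      by (intro nn_integral_cong nn_integral_cmult) measurable
    also have "\<dots> \<le> (\<integral>\<^sup>+s. g s * B \<partial>surf \<Gamma>)" by (intro nn_integral_mono mult_left_mono Ck) auto
    also have "\<dots> = B * (\<integral>\<^sup>+s. g s \<partial>surf \<Gamma>)" by (subst nn_integral_multc) (auto simp: mult.commute)
    finally show ?thesis .
  qed
  have "(\<integral>\<^sup>+z. g (fst z) * ennreal (kernel h (fst z) (snd z)) \<partial>(surf \<Gamma> \<Otimes>\<^sub>M surf \<Gamma>)) =
      (\<integral>\<^sup>+s. (\<integral>\<^sup>+t. g s * ennreal (kernel h s t) \<partial>surf \<Gamma>) \<partial>surf \<Gamma>)"
    by (subst M.nn_integral_fst[symmetric]) auto
  with * show "(\<integral>\<^sup>+z. g (fst z) * ennreal (kernel h (fst z) (snd z)) \<partial>(surf \<Gamma> \<Otimes>\<^sub>M surf \<Gamma>)) \<le> B * (\<integral>\<^sup>+s. g s \<partial>surf \<Gamma>)"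
    by simp
  have "(\<integral>\<^sup>+z. g (snd z) * ennreal (kernel h (fst z) (snd z)) \<partial>(surf \<Gamma> \<Otimes>\<^sub>M surf \<Gamma>)) =
      (\<integral>\<^sup>+s. (\<integral>\<^sup>+t. g s * ennreal (kernel h t s) \<partial>surf \<Gamma>) \<partial>surf \<Gamma>)"
    by (subst MM.nn_integral_snd[symmetric]) auto
  also have "\<dots> = (\<integral>\<^sup>+s. (\<integral>\<^sup>+t. g s * ennreal (kernel h s t) \<partial>surf \<Gamma>) \<partial>surf \<Gamma>)" by (simp only: kernel_sym)
  finally show "(\<integral>\<^sup>+z. g (snd z) * ennreal (kernel h (fst z) (snd z)) \<partial>(surf \<Gamma> \<Otimes>\<^sub>M surf \<Gamma>)) \<le> B * (\<integral>\<^sup>+s. g s \<partial>surf \<Gamma>)"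
    using * by simp
qed

text \<open>If the first point is in the patch, differences of \<open>v\<close> are charged to patch
  times \<Gamma>; differences of \<open>f\<close> are charged to the kernel, weighted with
  \<open>v - c\<close> at a point of the patch, and integrated over the other point. The 3 is 2 + 1,
  from the weight at the second and at the first point.\<close>

lemma cutoff_energy:
  assumes [measurable]: "f \<in> borel_measurable (surf \<Gamma>)" "v \<in> borel_measurable (surf \<Gamma>)" "\<tau> \<in> sets (surf \<Gamma>)"
    and f: "\<And>x. x \<in> \<Gamma> - \<tau> \<Longrightarrow> f x = 0" "\<And>x. x \<in> \<Gamma> \<Longrightarrow> \<bar>f x\<bar> \<le> C0"
      "\<And>p q. p \<in> \<Gamma> \<Longrightarrow> q \<in> \<Gamma> \<Longrightarrow> \<bar>f p - f q\<bar> \<le> \<Lambda> * min 1 (dist p q / h)"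
    and h: "h > 0" and B: "\<And>s. s \<in> \<Gamma> \<Longrightarrow> (\<integral>\<^sup>+t. ennreal (kernel h s t) \<partial>surf \<Gamma>) \<le> ennreal B" "B \<ge> 0"
  shows "half_seminorm_sq \<Gamma> (\<lambda>x. f x * (v x - c)) \<le>
    ennreal (2 * C0\<^sup>2) * (\<integral>\<^sup>+z. ennreal (edens v z) * indicator \<tau> (fst z) \<partial>(surf \<Gamma> \<Otimes>\<^sub>M surf \<Gamma>)) +
    ennreal (3 * \<Lambda>\<^sup>2 * B) * (\<integral>\<^sup>+s. ennreal ((v s - c)\<^sup>2) * indicator \<tau> s \<partial>surf \<Gamma>)"
proof -
  let ?P = "surf \<Gamma> \<Otimes>\<^sub>M surf \<Gamma>"
  define w where "w x = v x - c" for x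
  define g where "g s = ennreal ((w s)\<^sup>2) * indicator \<tau> s" for s
  have [measurable]: "w \<in> borel_measurable (surf \<Gamma>)" unfolding w_def[abs_def] by measurable
  have gm [measurable]: "g \<in> borel_measurable (surf \<Gamma>)" unfolding g_def by measurable
  have fm [measurable]: "(\<lambda>x. f x * w x) \<in> borel_measurable (surf \<Gamma>)" by measurable
  have point: "ennreal (edens (\<lambda>x. f x * w x) z) \<le>
      ennreal (2 * C0\<^sup>2) * (ennreal (edens v z) * indicator \<tau> (fst z)) +
      (ennreal (2 * \<Lambda>\<^sup>2) * (g (snd z) * ennreal (kernel h (fst z) (snd z))) +
       ennreal (\<Lambda>\<^sup>2) * (g (fst z) * ennreal (kernel h (fst z) (snd z))))" if z: "z \<in> space ?P" for z
  proof -
    obtain t s where [simp]: "z = (t, s)" and ts: "t \<in> \<Gamma>" "s \<in> \<Gamma>" using z by (auto simp: space_pair_measure)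
    define \<mu> where "\<mu> = min 1 (dist t s / h)"
    define I where "I x = (if x \<in> \<tau> then 1 else 0 :: real)" for x
    have I: "indicator \<tau> x = ennreal (I x)" for x by (simp add: I_def)
    have I0: "I x \<ge> 0" for x by (simp add: I_def)
    have lip: "\<bar>f t - f s\<bar> \<le> \<Lambda> * \<mu>" using f(3)[OF ts] by (simp add: \<mu>_def)
    have "(f t * w t - f s * w s)\<^sup>2 \<le> 2 * C0\<^sup>2 * (w t - w s)\<^sup>2 * I t + 2 * ((w s)\<^sup>2 * (\<Lambda> * \<mu>)\<^sup>2) * I s + (w t)\<^sup>2 * (\<Lambda> * \<mu>)\<^sup>2 * I t"
    proof (cases "t \<in> \<tau>")
      case True
      show ?thesis
      proof (cases "s \<in> \<tau>")
        case True
        have I1: "I t = 1" "I s = 1" using True \<open>t \<in> \<tau>\<close> by (simp_all add: I_def)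
        have "0 \<le> (w t)\<^sup>2 * (\<Lambda> * \<mu>)\<^sup>2" by simp
        then show ?thesis
          using sq_product_diff_le[OF f(2)[OF ts(1)] lip, of "w t" "w s"] unfolding I1 mult_1_right
            by linarith
      next
        case False
        then have "f s = 0" using f(1) ts by simp
        \<comment> \<open>With one point off the patch, the bound for the difference of
          \<open>f\<close> is a bound for its remaining value.\<close>
        then have "(f t)\<^sup>2 \<le> (\<Lambda> * \<mu>)\<^sup>2" using lip by (simp add: abs_le_square_iff[symmetric])
        then have "(w t)\<^sup>2 * (f t)\<^sup>2 \<le> (w t)\<^sup>2 * (\<Lambda> * \<mu>)\<^sup>2" by (intro mult_left_mono) auto
        moreover have "0 \<le> 2 * C0\<^sup>2 * (w t - w s)\<^sup>2" by simp
        moreover have "(f t * w t - f s * w s)\<^sup>2 = (w t)\<^sup>2 * (f t)\<^sup>2"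
          using \<open>f s = 0\<close> by (simp add: power_mult_distrib)
        moreover have "I t = 1" "I s = 0" using True False by (simp_all add: I_def)
        ultimately show ?thesis by (simp only: mult_1_right mult_zero_right)
      qed
    next
      case False
      then have ft: "f t = 0" using f(1) ts by simp
      show ?thesis
      proof (cases "s \<in> \<tau>")
        case True
        have "(f s)\<^sup>2 \<le> (\<Lambda> * \<mu>)\<^sup>2" using lip ft by (simp add: abs_le_square_iff[symmetric])
        then have "(w s)\<^sup>2 * (f s)\<^sup>2 \<le> (w s)\<^sup>2 * (\<Lambda> * \<mu>)\<^sup>2" by (intro mult_left_mono) auto
        moreover have "0 \<le> (w s)\<^sup>2 * (\<Lambda> * \<mu>)\<^sup>2" by simp
        ultimately have "(w s)\<^sup>2 * (f s)\<^sup>2 \<le> 2 * ((w s)\<^sup>2 * (\<Lambda> * \<mu>)\<^sup>2)" by linarith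
        then show ?thesis using ft False True by (simp add: I_def power_mult_distrib mult_ac)
      next
        case False
        then have "f s = 0" using f(1) ts by simp
        then show ?thesis using ft I0 by simp
      qed
    qed
    then have "(f t * w t - f s * w s)\<^sup>2 / norm (t - s) ^ CARD('n) \<le>
      (2 * C0\<^sup>2 * (w t - w s)\<^sup>2 * I t + 2 * ((w s)\<^sup>2 * (\<Lambda> * \<mu>)\<^sup>2) * I s + (w t)\<^sup>2 * (\<Lambda> * \<mu>)\<^sup>2 * I t) / norm (t - s) ^ CARD('n)"
      by (rule divide_right_mono) simp
    also have "\<dots> = 2 * C0\<^sup>2 * (edens v (t,s) * I t) + (2 * \<Lambda>\<^sup>2 * ((w s)\<^sup>2 * I s * kernel h t s) + \<Lambda>\<^sup>2 * ((w t)\<^sup>2 * I t * kernel h t s))"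
      by (simp add: edens_def kernel_def \<mu>_def w_def power_mult_distrib add_divide_distrib norm_minus_commute mult_ac)
    finally have "ennreal (edens (\<lambda>x. f x * w x) z) \<le> ennreal \<dots>"
      by (intro ennreal_leI) (simp add: edens_def)
    then show ?thesis
      unfolding g_def I using I0 edens_nonneg kernel_nonneg by (simp add: ennreal_mult)
  qed
  have "half_seminorm_sq \<Gamma> (\<lambda>x. f x * w x) \<le> (\<integral>\<^sup>+z. ennreal (2 * C0\<^sup>2) * (ennreal (edens v z) * indicator \<tau> (fst z)) +
      (ennreal (2 * \<Lambda>\<^sup>2) * (g (snd z) * ennreal (kernel h (fst z) (snd z))) +
       ennreal (\<Lambda>\<^sup>2) * (g (fst z) * ennreal (kernel h (fst z) (snd z)))) \<partial>?P)"
    unfolding half_seminorm_sq_eq[OF fm] by (intro nn_integral_mono point)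
  also have "\<dots> = (\<integral>\<^sup>+z. ennreal (2 * C0\<^sup>2) * (ennreal (edens v z) * indicator \<tau> (fst z)) \<partial>?P) +
      ((\<integral>\<^sup>+z. ennreal (2 * \<Lambda>\<^sup>2) * (g (snd z) * ennreal (kernel h (fst z) (snd z))) \<partial>?P) +
       (\<integral>\<^sup>+z. ennreal (\<Lambda>\<^sup>2) * (g (fst z) * ennreal (kernel h (fst z) (snd z))) \<partial>?P))"
    by (subst nn_integral_add, measurable, subst nn_integral_add, measurable)
  also have "\<dots> = ennreal (2 * C0\<^sup>2) * (\<integral>\<^sup>+z. ennreal (edens v z) * indicator \<tau> (fst z) \<partial>?P) +
      (ennreal (2 * \<Lambda>\<^sup>2) * (\<integral>\<^sup>+z. g (snd z) * ennreal (kernel h (fst z) (snd z)) \<partial>?P) +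
       ennreal (\<Lambda>\<^sup>2) * (\<integral>\<^sup>+z. g (fst z) * ennreal (kernel h (fst z) (snd z)) \<partial>?P))"
    by (subst nn_integral_cmult, measurable, subst nn_integral_cmult, measurable, subst nn_integral_cmult, measurable)
  also have "\<dots> \<le> ennreal (2 * C0\<^sup>2) * (\<integral>\<^sup>+z. ennreal (edens v z) * indicator \<tau> (fst z) \<partial>?P) +
      (ennreal (2 * \<Lambda>\<^sup>2) * (ennreal B * (\<integral>\<^sup>+s. g s \<partial>surf \<Gamma>)) + ennreal (\<Lambda>\<^sup>2) * (ennreal B * (\<integral>\<^sup>+s. g s \<partial>surf \<Gamma>)))"
    by (intro add_mono order_refl mult_left_mono kernel_weighted[OF gm B(1)]) auto
  also have "ennreal (2 * \<Lambda>\<^sup>2) * (ennreal B * (\<integral>\<^sup>+s. g s \<partial>surf \<Gamma>)) + ennreal (\<Lambda>\<^sup>2) * (ennreal B * (\<integral>\<^sup>+s. g s \<partial>surf \<Gamma>))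
      = (ennreal (2 * \<Lambda>\<^sup>2) * ennreal B + ennreal (\<Lambda>\<^sup>2) * ennreal B) * (\<integral>\<^sup>+s. g s \<partial>surf \<Gamma>)"
    by (simp only: distrib_right mult.assoc)
  also have "ennreal (2 * \<Lambda>\<^sup>2) * ennreal B + ennreal (\<Lambda>\<^sup>2) * ennreal B = ennreal (2 * \<Lambda>\<^sup>2 * B + \<Lambda>\<^sup>2 * B)"
    using B(2)
      by (simp only: ennreal_mult[symmetric] ennreal_plus[symmetric] zero_le_power2 mult_nonneg_nonneg zero_le_numeral)
  also have "2 * \<Lambda>\<^sup>2 * B + \<Lambda>\<^sup>2 * B = 3 * \<Lambda>\<^sup>2 * B" by simp
  finally show ?thesis unfolding w_def g_def .
qed

definition cutoffs :: "real \<Rightarrow> real \<Rightarrow> (real^'n \<Rightarrow> real^'n) set \<Rightarrow> (real^'n \<Rightarrow> real^'n \<Rightarrow> real) \<Rightarrow> bool" where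
  "cutoffs C0 h \<T> \<phi> \<longleftrightarrow> (\<forall>y\<in>nodes \<T>. \<phi> y \<in> W1inf_0 \<Gamma> (patch \<T> y) \<and>
            Linf_norm (patch \<T> y) (\<phi> y) \<le> ennreal C0 \<and>
            W1inf_seminorm (patch \<T> y) (\<phi> y) \<le> ennreal (C0 / h))"

lemma patch_sets:
  assumes "mesh \<kappa> q h \<T>" shows "patch \<T> y \<in> sets (surf \<Gamma>)" "patch \<T> y \<in> sets borel" "closed (patch \<T> y)"
  using compact_patch[OF assms] patch_subset[OF assms]
  by (auto intro: sets_surf_subset borel_closed compact_imp_closed)

lemma cutoffsD:
  assumes m: "mesh \<kappa> q h \<T>" and "cutoffs C0 h \<T> \<phi>" "C0 > 0" "y \<in> nodes \<T>"
  defines "\<Lambda> \<equiv> cutoff_lip C0 (\<bar>q\<bar> * diam)"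
  shows "\<And>x. x \<in> \<Gamma> - patch \<T> y \<Longrightarrow> \<phi> y x = 0" "\<And>x. x \<in> \<Gamma> \<Longrightarrow> \<bar>\<phi> y x\<bar> \<le> C0"
    "\<And>p q. p \<in> \<Gamma> \<Longrightarrow> q \<in> \<Gamma> \<Longrightarrow> \<bar>\<phi> y p - \<phi> y q\<bar> \<le> \<Lambda> * min 1 (dist p q / h)"
    "\<phi> y \<in> borel_measurable (surf \<Gamma>)"
proof -
  have "\<phi> y \<in> W1inf_0 \<Gamma> (patch \<T> y)" "Linf_norm (patch \<T> y) (\<phi> y) \<le> ennreal C0"
    "W1inf_seminorm (patch \<T> y) (\<phi> y) \<le> ennreal (C0 / h)"
    using assms(2,4) by (auto simp: cutoffs_def)
  note * = cutoff_lipschitz[OF patch_subset[OF m] patch_sets(3)[OF m] this(1) assms(3) this(2) mesh_size(1,2)[OF m] this(3)]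
  show "\<And>x. x \<in> \<Gamma> - patch \<T> y \<Longrightarrow> \<phi> y x = 0" by (rule *(1))
  show "\<And>x. x \<in> \<Gamma> \<Longrightarrow> \<bar>\<phi> y x\<bar> \<le> C0" by (rule *(2))
  show "\<And>p q. p \<in> \<Gamma> \<Longrightarrow> q \<in> \<Gamma> \<Longrightarrow> \<bar>\<phi> y p - \<phi> y q\<bar> \<le> \<Lambda> * min 1 (dist p q / h)"
    unfolding \<Lambda>_def by (rule *(3))
  show "\<phi> y \<in> borel_measurable (surf \<Gamma>)"
    using borel_measurable_continuous_on_restrict[OF *(4)]
      by (simp cong: measurable_cong_sets add: sets_surf)
qed

text \<open>Makes functionals applicable to the local pieces; \<open>v = 1\<close> and
  \<open>c = 0\<close> give the cut-off function itself. Only finiteness is claimed, so the bounds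
  used here may depend on \<open>h\<close>.\<close>

lemma cutoff_mult_Hhalf:
  assumes m: "mesh \<kappa> q h \<T>" and \<phi>: "cutoffs C0 h \<T> \<phi>" "C0 > 0" "y \<in> nodes \<T>" and v: "v \<in> Hhalf \<Gamma>"
  shows "(\<lambda>x. \<phi> y x * (v x - c)) \<in> Hhalf \<Gamma>"
proof (rule HhalfI)
  note f = cutoffsD[OF m \<phi>]
  note [measurable] = f(4) Hhalf_measurable[OF v] patch_sets(1)[OF m]
  have vc: "(\<lambda>x. v x - c) \<in> Hhalf \<Gamma>" by (rule Hhalf_diff_const[OF v])
  show "(\<lambda>x. \<phi> y x * (v x - c)) \<in> borel_measurable (surf \<Gamma>)" by measurable
  have "L2_sq \<Gamma> (\<lambda>x. \<phi> y x * (v x - c)) \<le> (\<integral>\<^sup>+x. ennreal (C0\<^sup>2) * ennreal ((v x - c)\<^sup>2) \<partial>surf \<Gamma>)"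
    unfolding L2_sq_def
  proof (intro nn_integral_mono)
    fix x assume "x \<in> space (surf \<Gamma>)"
    then have "(\<phi> y x)\<^sup>2 \<le> C0\<^sup>2" using f(2)[of x] \<phi>(2) by (simp add: abs_le_square_iff[symmetric])
    then show "ennreal ((\<phi> y x * (v x - c))\<^sup>2) \<le> ennreal (C0\<^sup>2) * ennreal ((v x - c)\<^sup>2)"
      by (simp add: power_mult_distrib ennreal_mult[symmetric] ennreal_leI mult_right_mono)
  qed
  also have "\<dots> = ennreal (C0\<^sup>2) * L2_sq \<Gamma> (\<lambda>x. v x - c)" unfolding L2_sq_def
    by (rule nn_integral_cmult) measurable
  also have "\<dots> < \<infinity>" using Hhalf_finite(1)[OF vc] by (simp add: ennreal_mult_less_top)
  finally show "L2_sq \<Gamma> (\<lambda>x. \<phi> y x * (v x - c)) < \<infinity>" .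
  obtain Ck where Ck: "Ck > 0" "\<And>h s. h > 0 \<Longrightarrow> s \<in> \<Gamma> \<Longrightarrow> (\<integral>\<^sup>+t. ennreal (kernel h s t) \<partial>surf \<Gamma>) \<le> ennreal (Ck / h)"
    using kernel_integral by blast
  have h: "h > 0" by (rule mesh_size(1)[OF m])
  have B: "Ck / h \<ge> 0" using Ck h by simp
  have "half_seminorm_sq \<Gamma> (\<lambda>x. \<phi> y x * (v x - c)) \<le>
    ennreal (2 * C0\<^sup>2) * (\<integral>\<^sup>+z. ennreal (edens v z) * indicator (patch \<T> y) (fst z) \<partial>(surf \<Gamma> \<Otimes>\<^sub>M surf \<Gamma>)) +
    ennreal (3 * (cutoff_lip C0 (\<bar>q\<bar> * diam))\<^sup>2 * (Ck / h)) * (\<integral>\<^sup>+s. ennreal ((v s - c)\<^sup>2) * indicator (patch \<T> y) s \<partial>surf \<Gamma>)"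
    by (rule cutoff_energy[OF _ _ _ f(1) f(2) f(3) h Ck(2)[OF h] B]) auto
  also have "\<dots> \<le> ennreal (2 * C0\<^sup>2) * half_seminorm_sq \<Gamma> v +
    ennreal (3 * (cutoff_lip C0 (\<bar>q\<bar> * diam))\<^sup>2 * (Ck / h)) * L2_sq \<Gamma> (\<lambda>x. v x - c)"
    unfolding half_seminorm_sq_eq[OF Hhalf_measurable[OF v]] L2_sq_def
    by (intro add_mono mult_left_mono nn_integral_mono) (auto simp: indicator_def)
  also have "\<dots> < \<infinity>" using Hhalf_finite(1)[OF vc] Hhalf_finite(2)[OF v] by (simp add: ennreal_mult_less_top)
  finally show "half_seminorm_sq \<Gamma> (\<lambda>x. \<phi> y x * (v x - c)) < \<infinity>" .
qed

text \<open>The constants \<open>c y\<close> are values of \<open>v\<close> at points supplied by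
  \<open>poincare\<close>. They make the zero-order term of \<open>cutoff_energy\<close> comparable
  to the energy over patch times \<Gamma>, and a pair of points is counted at most
  \<open>overlap \<kappa> q\<close> times.\<close>

lemma localization:
  assumes "C0 > 0"
  shows "\<exists>C>0. \<forall>h \<T> \<phi> v. mesh \<kappa> q h \<T> \<and> cutoffs C0 h \<T> \<phi> \<and> v \<in> Hhalf \<Gamma> \<longrightarrow>
    (\<exists>c. (\<Sum>y\<in>nodes \<T>. half_seminorm_sq \<Gamma> (\<lambda>x. \<phi> y x * (v x - c y))) \<le> ennreal C * half_seminorm_sq \<Gamma> v)"
proof -
  obtain Ck where Ck: "Ck > 0" "\<And>h s. h > 0 \<Longrightarrow> s \<in> \<Gamma> \<Longrightarrow> (\<integral>\<^sup>+t. ennreal (kernel h s t) \<partial>surf \<Gamma>) \<le> ennreal (Ck / h)"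
    using kernel_integral by blast
  obtain a where a: "a > 0" "\<And>x r. x \<in> \<Gamma> \<Longrightarrow> 0 < r \<Longrightarrow> r \<le> r0 \<Longrightarrow> ennreal (a * r ^ d) \<le> emeasure (surf \<Gamma>) (\<Gamma> \<inter> ball x r)"
    using lower_regular by blast
  define \<rho> where "\<rho> = inradius \<kappa> q"
  have \<rho>: "\<rho> > 0" by (simp add: \<rho>_def inradius_pos)
  define \<Lambda> where "\<Lambda> = cutoff_lip C0 (\<bar>q\<bar> * diam)"
  \<comment> \<open>The product of \<open>3 * \<Lambda>\<^sup>2 * (Ck / h)\<close> from
    \<open>cutoff_energy\<close> and the Poincare factor with diameter
    \<open>2 * \<bar>q\<bar> * h\<close> and mass \<open>a * (\<rho> * h) ^ d\<close>; all powers of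
    \<open>h\<close> cancel.\<close>
  define D where "D = 3 * \<Lambda>\<^sup>2 * Ck * (2 * (2 * \<bar>q\<bar>) ^ CARD('n) / (a * \<rho> ^ d))"
  have D0: "D \<ge> 0" using Ck a \<rho> by (simp add: D_def)
  define B where "B = 2 * C0\<^sup>2 + D"
  have B: "B > 0" using D0 assms by (simp add: B_def add_pos_nonneg)
  show ?thesis
  proof (intro exI[of _ "B * (overlap \<kappa> q + 1)"] conjI allI impI)
    show "B * (overlap \<kappa> q + 1) > 0" using B overlap_nonneg[of \<kappa> q] by simp
    fix h \<T> \<phi> v assume *: "mesh \<kappa> q h \<T> \<and> cutoffs C0 h \<T> \<phi> \<and> v \<in> Hhalf \<Gamma>"
    then have m: "mesh \<kappa> q h \<T>" and \<phi>: "cutoffs C0 h \<T> \<phi>" and v: "v \<in> Hhalf \<Gamma>" by auto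
    have h: "h > 0" by (rule mesh_size(1)[OF m])
    note [measurable] = Hhalf_measurable[OF v] patch_sets(1)[OF m]
    let ?P = "surf \<Gamma> \<Otimes>\<^sub>M surf \<Gamma>"
    define J where "J y = (\<integral>\<^sup>+z. ennreal (edens v z) * indicator (patch \<T> y) (fst z) \<partial>?P)" for y
    have loc: "\<exists>c. half_seminorm_sq \<Gamma> (\<lambda>x. \<phi> y x * (v x - c)) \<le> ennreal B * J y" if y: "y \<in> nodes \<T>" for y
    proof -
      let ?\<tau> = "patch \<T> y"
      note f = cutoffsD[OF m \<phi> assms y]
      obtain x where x: "x \<in> ?\<tau>" "\<Gamma> \<inter> ball x (\<rho> * h) \<subseteq> ?\<tau>"
        using patch_contains_ball[OF m y] unfolding \<rho>_def by blast
      have "ennreal (a * (\<rho> * h) ^ d) \<le> emeasure (surf \<Gamma>) (\<Gamma> \<inter> ball x (\<rho> * h))"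
        using a(2)[of x "\<rho> * h"] x(1) patch_subset[OF m, of y] \<rho> h mesh_size(3)[OF m] by (auto simp: \<rho>_def)
      also have "\<dots> \<le> emeasure (surf \<Gamma>) ?\<tau>" using x(2) by (intro emeasure_mono) auto
      finally have mass: "ennreal (a * (\<rho> * h) ^ d) \<le> emeasure (surf \<Gamma>) ?\<tau>" .
      have mp: "a * (\<rho> * h) ^ d > 0" using a \<rho> h by simp
      have Dp: "2 * \<bar>q\<bar> * h \<ge> 0" using h by simp
      obtain t0 where t0: "(\<integral>\<^sup>+s. ennreal ((v s - v t0)\<^sup>2) * indicator ?\<tau> s \<partial>surf \<Gamma>) \<le>
          ennreal (2 * (2 * \<bar>q\<bar> * h) ^ CARD('n) / (a * (\<rho> * h) ^ d)) *
          (\<integral>\<^sup>+z. ennreal (edens v z) * indicator (?\<tau> \<times> ?\<tau>) z \<partial>?P)"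
        by (rule poincare[OF patch_sets(1)[OF m] mp mass patch_dist_le[OF m] Dp Hhalf_measurable[OF v]])
      have "(\<integral>\<^sup>+z. ennreal (edens v z) * indicator (?\<tau> \<times> ?\<tau>) z \<partial>?P) \<le> J y"
        unfolding J_def by (intro nn_integral_mono) (auto simp: indicator_def)
      then have L2: "(\<integral>\<^sup>+s. ennreal ((v s - v t0)\<^sup>2) * indicator ?\<tau> s \<partial>surf \<Gamma>) \<le>
          ennreal (2 * (2 * \<bar>q\<bar> * h) ^ CARD('n) / (a * (\<rho> * h) ^ d)) * J y"
        by (intro order_trans[OF t0] mult_left_mono) simp_all
      have Bk: "Ck / h \<ge> 0" using Ck h by simp
      have "half_seminorm_sq \<Gamma> (\<lambda>x. \<phi> y x * (v x - v t0)) \<le> ennreal (2 * C0\<^sup>2) * J y +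
          ennreal (3 * \<Lambda>\<^sup>2 * (Ck / h)) * (\<integral>\<^sup>+s. ennreal ((v s - v t0)\<^sup>2) * indicator ?\<tau> s \<partial>surf \<Gamma>)"
        unfolding \<Lambda>_def J_def
        by (rule cutoff_energy[OF f(4) Hhalf_measurable[OF v] patch_sets(1)[OF m] f(1) f(2) f(3) h Ck(2)[OF h] Bk]) auto
      also have "\<dots> \<le> ennreal (2 * C0\<^sup>2) * J y +
          ennreal (3 * \<Lambda>\<^sup>2 * (Ck / h)) * (ennreal (2 * (2 * \<bar>q\<bar> * h) ^ CARD('n) / (a * (\<rho> * h) ^ d)) * J y)"
        by (intro add_mono order_refl mult_left_mono L2) simp
      also have "\<dots> = (ennreal (2 * C0\<^sup>2) + ennreal (3 * \<Lambda>\<^sup>2 * (Ck / h)) * ennreal (2 * (2 * \<bar>q\<bar> * h) ^ CARD('n) / (a * (\<rho> * h) ^ d))) * J y"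
        by (simp only: distrib_right mult.assoc)
      also have "ennreal (3 * \<Lambda>\<^sup>2 * (Ck / h)) * ennreal (2 * (2 * \<bar>q\<bar> * h) ^ CARD('n) / (a * (\<rho> * h) ^ d)) =
          ennreal (3 * \<Lambda>\<^sup>2 * (Ck / h) * (2 * (2 * \<bar>q\<bar> * h) ^ CARD('n) / (a * (\<rho> * h) ^ d)))"
      proof (rule ennreal_mult[symmetric])
        show "0 \<le> 3 * \<Lambda>\<^sup>2 * (Ck / h)" by (intro mult_nonneg_nonneg Bk) auto
        show "0 \<le> 2 * (2 * \<bar>q\<bar> * h) ^ CARD('n) / (a * (\<rho> * h) ^ d)"
          using less_imp_le[OF mp] zero_le_power[OF Dp] by (intro divide_nonneg_nonneg) auto
      qed
      \<comment> \<open>Here \<open>h\<close> disappears: \<open>h ^ CARD('n)\<close> stands against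
        \<open>h * h ^ d\<close>.\<close>
      also have "3 * \<Lambda>\<^sup>2 * (Ck / h) * (2 * (2 * \<bar>q\<bar> * h) ^ CARD('n) / (a * (\<rho> * h) ^ d)) = D"
        unfolding D_def Suc_d[symmetric] using h by (simp add: power_mult_distrib)
      also have "ennreal (2 * C0\<^sup>2) + ennreal D = ennreal B" unfolding B_def using D0
        by (simp add: ennreal_plus)
      finally show ?thesis by (rule exI[of _ "v t0"])
    qed
    have "\<forall>y\<in>nodes \<T>. \<exists>c. half_seminorm_sq \<Gamma> (\<lambda>x. \<phi> y x * (v x - c)) \<le> ennreal B * J y"
      by (intro ballI loc)
    from bchoice[OF this] obtain c where c: "\<forall>y\<in>nodes \<T>. half_seminorm_sq \<Gamma> (\<lambda>x. \<phi> y x * (v x - c y)) \<le> ennreal B * J y" ..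
    have fin: "finite (nodes \<T>)" by (rule mesh_size(4)[OF m])
    have point: "(\<Sum>y\<in>nodes \<T>. ennreal (edens v z) * indicator (patch \<T> y) (fst z)) \<le> ennreal (overlap \<kappa> q) * ennreal (edens v z)"
      for z :: "(real^'n) \<times> (real^'n)"
    proof -
      have "(\<Sum>y\<in>nodes \<T>. indicator (patch \<T> y) (fst z) :: ennreal) = (\<Sum>y\<in>nodes \<T>. if fst z \<in> patch \<T> y then 1 else 0)"
        by (intro sum.cong refl) (simp add: indicator_def)
      also have "\<dots> = (\<Sum>y\<in>{y\<in>nodes \<T>. fst z \<in> patch \<T> y}. 1)"
        by (rule sum.inter_filter[OF fin, symmetric])
      also have "\<dots> = ennreal (real (card {y\<in>nodes \<T>. fst z \<in> patch \<T> y}))"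
        by (simp add: ennreal_of_nat_eq_real_of_nat)
      also have "\<dots> \<le> ennreal (overlap \<kappa> q)" by (rule ennreal_leI[OF patch_overlap[OF m]])
      finally show ?thesis
        unfolding sum_distrib_left[symmetric] mult.commute[of "ennreal (overlap \<kappa> q)"]
          by (rule mult_left_mono) simp
    qed
    have "(\<Sum>y\<in>nodes \<T>. J y) = (\<integral>\<^sup>+z. (\<Sum>y\<in>nodes \<T>. ennreal (edens v z) * indicator (patch \<T> y) (fst z)) \<partial>?P)"
    proof -
      have "(\<lambda>z. ennreal (edens v z) * indicator (patch \<T> y) (fst z)) \<in> borel_measurable ?P" for y
        by measurable
      from nn_integral_sum[of "nodes \<T>" "\<lambda>y z. ennreal (edens v z) * indicator (patch \<T> y) (fst z)", OF this]
      show ?thesis unfolding J_def ..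
    qed
    also have "\<dots> \<le> (\<integral>\<^sup>+z. ennreal (overlap \<kappa> q) * ennreal (edens v z) \<partial>?P)"
      by (rule nn_integral_mono) (rule point)
    also have "\<dots> = ennreal (overlap \<kappa> q) * half_seminorm_sq \<Gamma> v"
      by (simp add: nn_integral_cmult half_seminorm_sq_eq)
    also have "\<dots> \<le> ennreal (overlap \<kappa> q + 1) * half_seminorm_sq \<Gamma> v"
      by (intro mult_right_mono ennreal_leI) auto
    finally have J: "(\<Sum>y\<in>nodes \<T>. J y) \<le> ennreal (overlap \<kappa> q + 1) * half_seminorm_sq \<Gamma> v" .
    have "(\<Sum>y\<in>nodes \<T>. half_seminorm_sq \<Gamma> (\<lambda>x. \<phi> y x * (v x - c y))) \<le> (\<Sum>y\<in>nodes \<T>. ennreal B * J y)"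
      by (rule sum_mono) (rule c[rule_format])
    also have "\<dots> = ennreal B * (\<Sum>y\<in>nodes \<T>. J y)" by (rule sum_distrib_left[symmetric])
    also have "\<dots> \<le> ennreal B * (ennreal (overlap \<kappa> q + 1) * half_seminorm_sq \<Gamma> v)"
      by (rule mult_left_mono[OF J]) simp
    also have "\<dots> = ennreal (B * (overlap \<kappa> q + 1)) * half_seminorm_sq \<Gamma> v"
      unfolding mult.assoc[symmetric] using B overlap_nonneg[of \<kappa> q] by (subst ennreal_mult) auto
    finally show "\<exists>c. (\<Sum>y\<in>nodes \<T>. half_seminorm_sq \<Gamma> (\<lambda>x. \<phi> y x * (v x - c y))) \<le> ennreal (B * (overlap \<kappa> q + 1)) * half_seminorm_sq \<Gamma> v"
      by (rule exI[of _ c])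
  qed
qed

text \<open>For a given pair of points only the nodes whose patch contains one of the two contribute
  to the difference. There are at most \<open>2 * overlap \<kappa> q\<close> of them, and
  Cauchy-Schwarz for this short sum costs just their number.\<close>

lemma superposition_energy:
  assumes m: "mesh \<kappa> q h \<T>" and w: "\<And>y. y \<in> nodes \<T> \<Longrightarrow> w y \<in> borel_measurable (surf \<Gamma>)"
    and supp: "\<And>x y. y \<in> nodes \<T> \<Longrightarrow> x \<in> \<Gamma> - patch \<T> y \<Longrightarrow> w y x = 0"
  shows "half_seminorm_sq \<Gamma> (\<lambda>x. \<Sum>y\<in>nodes \<T>. \<alpha> y * w y x) \<le>
    ennreal (2 * overlap \<kappa> q) * (\<Sum>y\<in>nodes \<T>. ennreal ((\<alpha> y)\<^sup>2) * half_seminorm_sq \<Gamma> (w y))"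
proof -
  note [measurable] = w
  let ?P = "surf \<Gamma> \<Otimes>\<^sub>M surf \<Gamma>" and ?Y = "nodes \<T>"
  have fin: "finite ?Y" by (rule mesh_size(4)[OF m])
  have um: "(\<lambda>x. \<Sum>y\<in>?Y. \<alpha> y * w y x) \<in> borel_measurable (surf \<Gamma>)" by measurable
  have point: "edens (\<lambda>x. \<Sum>y\<in>?Y. \<alpha> y * w y x) z \<le> 2 * overlap \<kappa> q * (\<Sum>y\<in>?Y. (\<alpha> y)\<^sup>2 * edens (w y) z)"
    if z: "z \<in> space ?P" for z
  proof -
    obtain t s where [simp]: "z = (t, s)" and ts: "t \<in> \<Gamma>" "s \<in> \<Gamma>" using z by (auto simp: space_pair_measure)
    define A where "A = {y\<in>?Y. t \<in> patch \<T> y} \<union> {y\<in>?Y. s \<in> patch \<T> y}"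
    have A: "finite A" "A \<subseteq> ?Y" using fin by (auto simp: A_def)
    have "real (card A) \<le> real (card {y\<in>?Y. t \<in> patch \<T> y} + card {y\<in>?Y. s \<in> patch \<T> y})"
      unfolding A_def using card_Un_le of_nat_le_iff by blast
    then have cA: "real (card A) \<le> 2 * overlap \<kappa> q" using patch_overlap[OF m, of t] patch_overlap[OF m, of s]
      by simp
    define \<Delta> where "\<Delta> y = \<alpha> y * (w y t - w y s)" for y
    have "(\<Sum>y\<in>?Y. \<alpha> y * w y t) - (\<Sum>y\<in>?Y. \<alpha> y * w y s) = (\<Sum>y\<in>?Y. \<Delta> y)"
      by (simp add: \<Delta>_def sum_subtractf[symmetric] right_diff_distrib)
    also have "\<dots> = (\<Sum>y\<in>A. \<Delta> y)"
      using fin A supp ts by (intro sum.mono_neutral_right) (auto simp: A_def \<Delta>_def)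
    finally have "((\<Sum>y\<in>?Y. \<alpha> y * w y t) - (\<Sum>y\<in>?Y. \<alpha> y * w y s))\<^sup>2 = (\<Sum>y\<in>A. \<Delta> y)\<^sup>2" by simp
    also have "\<dots> \<le> (\<Sum>y\<in>A. (\<Delta> y)\<^sup>2) * real (card A)" by (rule sum_squared_le_sum_of_squares)
    also have "\<dots> \<le> (\<Sum>y\<in>?Y. (\<Delta> y)\<^sup>2) * (2 * overlap \<kappa> q)"
      using A fin cA by (intro mult_mono sum_mono2 sum_nonneg) auto
    finally have "((\<Sum>y\<in>?Y. \<alpha> y * w y t) - (\<Sum>y\<in>?Y. \<alpha> y * w y s))\<^sup>2 / norm (t - s) ^ CARD('n) \<le>
       (2 * overlap \<kappa> q) * ((\<Sum>y\<in>?Y. (\<Delta> y)\<^sup>2) / norm (t - s) ^ CARD('n))"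
      by (simp add: divide_right_mono mult.commute)
    also have "(\<Sum>y\<in>?Y. (\<Delta> y)\<^sup>2) / norm (t - s) ^ CARD('n) = (\<Sum>y\<in>?Y. (\<alpha> y)\<^sup>2 * edens (w y) z)"
      by (simp add: edens_def \<Delta>_def sum_divide_distrib power_mult_distrib)
    finally show ?thesis by (simp add: edens_def)
  qed
  have "half_seminorm_sq \<Gamma> (\<lambda>x. \<Sum>y\<in>?Y. \<alpha> y * w y x) \<le>
      (\<integral>\<^sup>+z. ennreal (2 * overlap \<kappa> q) * (\<Sum>y\<in>?Y. ennreal ((\<alpha> y)\<^sup>2) * ennreal (edens (w y) z)) \<partial>?P)"
    unfolding half_seminorm_sq_eq[OF um]
  proof (intro nn_integral_mono)
    fix z assume "z \<in> space ?P"
    from ennreal_leI[OF point[OF this]]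
    show "ennreal (edens (\<lambda>x. \<Sum>y\<in>?Y. \<alpha> y * w y x) z) \<le>
        ennreal (2 * overlap \<kappa> q) * (\<Sum>y\<in>?Y. ennreal ((\<alpha> y)\<^sup>2) * ennreal (edens (w y) z))"
      using overlap_nonneg[of \<kappa> q] edens_nonneg
      by (simp add: ennreal_mult sum_nonneg sum_ennreal[symmetric] del: sum_ennreal)
  qed
  also have "\<dots> = ennreal (2 * overlap \<kappa> q) * (\<integral>\<^sup>+z. (\<Sum>y\<in>?Y. ennreal ((\<alpha> y)\<^sup>2) * ennreal (edens (w y) z)) \<partial>?P)"
    by (rule nn_integral_cmult) measurable
  also have "(\<integral>\<^sup>+z. (\<Sum>y\<in>?Y. ennreal ((\<alpha> y)\<^sup>2) * ennreal (edens (w y) z)) \<partial>?P) = (\<Sum>y\<in>?Y. \<integral>\<^sup>+z. ennreal ((\<alpha> y)\<^sup>2) * ennreal (edens (w y) z) \<partial>?P)"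
    by (rule nn_integral_sum) measurable
  also have "\<dots> = (\<Sum>y\<in>?Y. ennreal ((\<alpha> y)\<^sup>2) * half_seminorm_sq \<Gamma> (w y))"
    by (intro sum.cong refl) (simp add: half_seminorm_sq_eq nn_integral_cmult)
  finally show ?thesis .
qed

end

section \<open>Functionals\<close>

text \<open>A vanishing denominator is harmless, because the hypothesis then forces the numerator to
  be truncated to 0, and \<open>0 / 0 = 0\<close>.\<close>

lemma ennreal_ratio_le:
  assumes "x \<le> B * N" "B \<ge> 0" "N \<ge> 0"
  shows "ennreal x / ennreal N \<le> ennreal B"
proof (cases "N = 0 \<or> x \<le> 0")
  case True
  then have "ennreal x = 0" using assms by (auto simp: ennreal_eq_0_iff)
  then show ?thesis by simp
next
  case False
  then have "N > 0" "x > 0" using assms by auto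
  then have "ennreal x / ennreal N = ennreal (x / N)" by (intro divide_ennreal) auto
  also have "\<dots> \<le> ennreal B" using assms \<open>N > 0\<close> by (intro ennreal_leI) (simp add: pos_divide_le_eq)
  finally show ?thesis .
qed

lemma ennreal_ratio_le_D:
  assumes "ennreal x / ennreal N \<le> ennreal X" "N > 0" "X \<ge> 0"
  shows "x \<le> X * N"
proof (cases "x \<le> 0")
  case True
  then show ?thesis using assms by (meson mult_nonneg_nonneg less_imp_le order_trans)
next
  case False
  then have "ennreal x / ennreal N = ennreal (x / N)" using assms by (intro divide_ennreal) auto
  then have "x / N \<le> X" using assms by (simp add: ennreal_le_iff)
  then show ?thesis using assms by (simp add: pos_divide_le_eq)
qed

lemma Hhalf_norm_nonneg: "Hhalf_norm \<Gamma> v \<ge> 0"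
  by (simp add: Hhalf_norm_def)

lemma H00_norm_nonneg: "H00_norm \<Gamma> \<tau> v \<ge> 0"
  by (simp add: H00_norm_def)

context lipschitz_surface
begin

lemma Hmhalf_linear:
  "\<xi> \<in> Hmhalf \<Gamma> \<Longrightarrow> v \<in> Hhalf \<Gamma> \<Longrightarrow> w \<in> Hhalf \<Gamma> \<Longrightarrow> \<xi> (\<lambda>x. a * v x + b * w x) = a * \<xi> v + b * \<xi> w"
  unfolding Hmhalf_def by blast

lemma Hmhalf_zero: "\<xi> \<in> Hmhalf \<Gamma> \<Longrightarrow> \<xi> (\<lambda>_. 0) = 0"
  using Hmhalf_linear[of \<xi> "\<lambda>_. 0" "\<lambda>_. 0" 0 0] Hhalf_const[of 0] by simp

lemma Hmhalf_sum:
  assumes \<xi>: "\<xi> \<in> Hmhalf \<Gamma>"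
  shows "finite I \<Longrightarrow> (\<And>i. i \<in> I \<Longrightarrow> f i \<in> Hhalf \<Gamma>) \<Longrightarrow> \<xi> (\<lambda>x. \<Sum>i\<in>I. a i * f i x) = (\<Sum>i\<in>I. a i * \<xi> (f i))"
proof (induction I rule: finite_induct)
  case empty
  show ?case using Hmhalf_zero[OF \<xi>] by simp
next
  case (insert j I)
  have "(\<lambda>x. \<Sum>i\<in>I. a i * f i x) \<in> Hhalf \<Gamma>" using insert by (intro Hhalf_sum) auto
  then show ?case using insert Hmhalf_linear[OF \<xi>, of "f j" "\<lambda>x. \<Sum>i\<in>I. a i * f i x" "a j" 1] by simp
qed

lemma Hmhalf_AE_zero:
  assumes \<xi>: "\<xi> \<in> Hmhalf \<Gamma>" and v: "v \<in> Hhalf \<Gamma>" and ae: "AE x in surf \<Gamma>. v x = 0"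
  shows "\<xi> v = 0"
proof -
  note [measurable] = Hhalf_measurable[OF v]
  have "L2_sq \<Gamma> v = (\<integral>\<^sup>+t. 0 \<partial>surf \<Gamma>)"
    unfolding L2_sq_def using ae by (intro nn_integral_cong_AE) (auto elim: eventually_mono)
  moreover have "half_seminorm_sq \<Gamma> v = (\<integral>\<^sup>+t. 0 \<partial>surf \<Gamma>)"
    unfolding half_seminorm_sq_def
  proof (rule nn_integral_cong_AE, use ae in eventually_elim)
    fix t assume t: "v t = 0"
    have "(\<integral>\<^sup>+s. ennreal (\<bar>v t - v s\<bar>\<^sup>2 / norm (t - s) ^ CARD('n)) \<partial>surf \<Gamma>) = (\<integral>\<^sup>+s. 0 \<partial>surf \<Gamma>)"
      by (rule nn_integral_cong_AE, use ae in eventually_elim) (simp add: t)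
    then show "(\<integral>\<^sup>+s. ennreal (\<bar>v t - v s\<bar>\<^sup>2 / norm (t - s) ^ CARD('n)) \<partial>surf \<Gamma>) = 0" by simp
  qed
  ultimately have "Hhalf_norm \<Gamma> v = 0" by (simp add: Hhalf_norm_def)
  moreover obtain B where "\<And>v. v \<in> Hhalf \<Gamma> \<Longrightarrow> \<bar>\<xi> v\<bar> \<le> B * Hhalf_norm \<Gamma> v" using \<xi> unfolding Hmhalf_def
    by blast
  then have "\<bar>\<xi> v\<bar> \<le> B * Hhalf_norm \<Gamma> v" using v by blast
  ultimately show ?thesis by simp
qed

lemma Hmhalf_cong:
  assumes \<xi>: "\<xi> \<in> Hmhalf \<Gamma>" and v: "v \<in> Hhalf \<Gamma>" and eq: "\<And>x. x \<in> \<Gamma> \<Longrightarrow> v x = w x"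
  shows "\<xi> v = \<xi> w"
proof -
  have w: "w \<in> Hhalf \<Gamma>" using v Hhalf_cong(1)[of v w, OF eq] by blast
  have "\<xi> (\<lambda>x. 1 * v x + (-1) * w x) = 0"
  proof (rule Hmhalf_AE_zero[OF \<xi> Hhalf_lincomb[OF v w]])
    show "AE x in surf \<Gamma>. 1 * v x + - 1 * w x = 0" by (rule AE_I2) (simp add: eq)
  qed
  then show ?thesis using Hmhalf_linear[OF \<xi> v w, of 1 "-1"] by simp
qed

lemma Hmhalf_diff:
  assumes \<zeta>: "\<zeta> \<in> Hmhalf \<Gamma>" and \<eta>: "\<eta> \<in> Hmhalf \<Gamma>"
  shows "(\<lambda>v. \<zeta> v - \<eta> v) \<in> Hmhalf \<Gamma>"
proof -
  obtain B1 where B1: "\<And>v. v \<in> Hhalf \<Gamma> \<Longrightarrow> \<bar>\<zeta> v\<bar> \<le> B1 * Hhalf_norm \<Gamma> v" using \<zeta> unfolding Hmhalf_def by blast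
  obtain B2 where B2: "\<And>v. v \<in> Hhalf \<Gamma> \<Longrightarrow> \<bar>\<eta> v\<bar> \<le> B2 * Hhalf_norm \<Gamma> v" using \<eta> unfolding Hmhalf_def by blast
  have "\<bar>\<zeta> v - \<eta> v\<bar> \<le> (B1 + B2) * Hhalf_norm \<Gamma> v" if "v \<in> Hhalf \<Gamma>" for v
    using B1[OF that] B2[OF that] by (simp add: distrib_right)
  moreover have "\<zeta> v - \<eta> v = 0" if "v \<notin> Hhalf \<Gamma>" for v using \<zeta> \<eta> that by (simp add: Hmhalf_def)
  moreover have "\<zeta> (\<lambda>x. a * v x + b * w x) - \<eta> (\<lambda>x. a * v x + b * w x) = a * (\<zeta> v - \<eta> v) + b * (\<zeta> w - \<eta> w)"
    if "v \<in> Hhalf \<Gamma>" "w \<in> Hhalf \<Gamma>" for v w a b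
    using Hmhalf_linear[OF \<zeta> that] Hmhalf_linear[OF \<eta> that] by (simp add: algebra_simps)
  ultimately show ?thesis unfolding Hmhalf_def by blast
qed

section \<open>Dual norms as real numbers\<close>

lemma mhalf_norm_le:
  assumes "B \<ge> 0" "\<And>v. v \<in> Hhalf \<Gamma> \<Longrightarrow> \<xi> v \<le> B * Hhalf_norm \<Gamma> v"
  shows "mhalf_norm \<Gamma> \<xi> \<le> ennreal B"
  unfolding mhalf_norm_def using assms Hhalf_norm_nonneg by (intro SUP_least ennreal_ratio_le) auto

definition dnorm :: "((real^'n \<Rightarrow> real) \<Rightarrow> real) \<Rightarrow> real" where
  "dnorm \<xi> = enn2real (mhalf_norm \<Gamma> \<xi>)"

lemma dnorm_nonneg: "dnorm \<xi> \<ge> 0"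
  by (simp add: dnorm_def)

lemma mhalf_norm_eq_dnorm:
  assumes "\<xi> \<in> Hmhalf \<Gamma>" shows "mhalf_norm \<Gamma> \<xi> = ennreal (dnorm \<xi>)"
proof -
  obtain B where B: "\<And>v. v \<in> Hhalf \<Gamma> \<Longrightarrow> \<bar>\<xi> v\<bar> \<le> B * Hhalf_norm \<Gamma> v" using assms unfolding Hmhalf_def by blast
  have "mhalf_norm \<Gamma> \<xi> \<le> ennreal \<bar>B\<bar>"
  proof (rule mhalf_norm_le)
    fix v assume "v \<in> Hhalf \<Gamma>"
    then have "\<xi> v \<le> B * Hhalf_norm \<Gamma> v" using B by fastforce
    also have "\<dots> \<le> \<bar>B\<bar> * Hhalf_norm \<Gamma> v" by (intro mult_right_mono Hhalf_norm_nonneg) simp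
    finally show "\<xi> v \<le> \<bar>B\<bar> * Hhalf_norm \<Gamma> v" .
  qed simp
  then have "mhalf_norm \<Gamma> \<xi> < top" by (rule le_less_trans) simp
  then show ?thesis by (simp add: dnorm_def)
qed

lemma Hhalf_norm_pos:
  assumes v: "v \<in> Hhalf \<Gamma>" and "\<not> (AE x in surf \<Gamma>. v x = 0)"
  shows "Hhalf_norm \<Gamma> v > 0"
proof -
  note [measurable] = Hhalf_measurable[OF v]
  have "L2_sq \<Gamma> v \<noteq> 0" unfolding L2_sq_def using assms(2) by (subst nn_integral_0_iff_AE) auto
  then have "L2_sq \<Gamma> v + half_seminorm_sq \<Gamma> v \<noteq> 0" by simp
  moreover have "L2_sq \<Gamma> v + half_seminorm_sq \<Gamma> v < top" using Hhalf_finite[OF v] by simp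
  ultimately have "enn2real (L2_sq \<Gamma> v + half_seminorm_sq \<Gamma> v) > 0"
    by (simp add: enn2real_positive_iff zero_less_iff_neq_zero)
  then show ?thesis by (simp add: Hhalf_norm_def)
qed

lemma functional_le:
  assumes \<xi>: "\<xi> \<in> Hmhalf \<Gamma>" and v: "v \<in> Hhalf \<Gamma>"
  shows "\<xi> v \<le> dnorm \<xi> * Hhalf_norm \<Gamma> v"
proof (cases "AE x in surf \<Gamma>. v x = 0")
  case True
  then show ?thesis using Hmhalf_AE_zero[OF \<xi> v] by (simp add: dnorm_nonneg Hhalf_norm_nonneg)
next
  case False
  then have "ennreal (\<xi> v) / ennreal (Hhalf_norm \<Gamma> v) \<le> mhalf_norm \<Gamma> \<xi>"
    unfolding mhalf_norm_def using v by (intro SUP_upper) auto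
  then show ?thesis
    unfolding mhalf_norm_eq_dnorm[OF \<xi>]
      by (rule ennreal_ratio_le_D[OF _ Hhalf_norm_pos[OF v False] dnorm_nonneg])
qed

text \<open>On functionals that annihilate the constants, the full norm may be replaced by the
  seminorm; this applies to \<open>\<zeta> - P \<zeta>\<close> because the cut-off functions sum up to \<open>1\<close>. It also
  covers patches that exhaust \<open>\<Gamma>\<close>, where the seminorm does not control the constants.\<close>

definition mean_const :: real where
  "mean_const = sqrt (poincare_const + 1)"

lemma mean_const_nonneg: "mean_const \<ge> 0"
  using poincare_const_nonneg by (simp add: mean_const_def)

lemma functional_le_seminorm:
  assumes \<xi>: "\<xi> \<in> Hmhalf \<Gamma>" "\<xi> (\<lambda>_. 1) = 0" and u: "u \<in> Hhalf \<Gamma>"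
  shows "\<xi> u \<le> dnorm \<xi> * mean_const * sqrt (enn2real (half_seminorm_sq \<Gamma> u))"
proof -
  obtain c where c: "L2_sq \<Gamma> (\<lambda>x. u x - c) \<le> ennreal poincare_const * half_seminorm_sq \<Gamma> u"
    using poincare_surface[OF Hhalf_measurable[OF u]] .
  have uc: "(\<lambda>x. u x - c) \<in> Hhalf \<Gamma>" by (rule Hhalf_diff_const[OF u])
  define Q where "Q = enn2real (half_seminorm_sq \<Gamma> u)"
  have Q: "half_seminorm_sq \<Gamma> u = ennreal Q" "Q \<ge> 0" using Hhalf_finite(2)[OF u] by (auto simp: Q_def)
  have "\<xi> (\<lambda>x. 1 * u x + (- c) * 1) = \<xi> u" using Hmhalf_linear[OF \<xi>(1) u Hhalf_const[of 1], of 1 "-c"] \<xi>(2)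
    by simp
  then have "\<xi> u = \<xi> (\<lambda>x. u x - c)" by simp
  also have "\<dots> \<le> dnorm \<xi> * Hhalf_norm \<Gamma> (\<lambda>x. u x - c)" by (rule functional_le[OF \<xi>(1) uc])
  also have "\<dots> \<le> dnorm \<xi> * (mean_const * sqrt Q)"
  proof (intro mult_left_mono dnorm_nonneg)
    have "L2_sq \<Gamma> (\<lambda>x. u x - c) + half_seminorm_sq \<Gamma> (\<lambda>x. u x - c) \<le> ennreal poincare_const * ennreal Q + ennreal Q"
      unfolding half_seminorm_sq_shift using c Q by (intro add_mono) auto
    also have "\<dots> = ennreal ((poincare_const + 1) * Q)"
      using poincare_const_nonneg Q(2)
        by (simp add: ennreal_mult[symmetric] ennreal_plus[symmetric] distrib_right del: ennreal_plus)
    finally have "enn2real (L2_sq \<Gamma> (\<lambda>x. u x - c) + half_seminorm_sq \<Gamma> (\<lambda>x. u x - c)) \<le> (poincare_const + 1) * Q"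
      using poincare_const_nonneg Q(2) by (intro enn2real_leI) auto
    then show "Hhalf_norm \<Gamma> (\<lambda>x. u x - c) \<le> mean_const * sqrt Q"
      unfolding Hhalf_norm_def mean_const_def real_sqrt_mult[symmetric] by (rule real_sqrt_le_mono)
  qed
  finally show ?thesis by (simp add: Q_def mult.assoc)
qed

section \<open>Dual norms on the patches\<close>

lemma zero_ext_measure_zero:
  assumes "\<tau> \<subseteq> \<Gamma>" "\<tau> \<in> sets borel" "AE x in surf \<tau>. v x = 0"
  shows "AE x in surf \<Gamma>. zero_ext \<tau> v x = 0"
proof -
  have "AE x in surf \<Gamma>. x \<in> \<tau> \<longrightarrow> v x = 0"
    using assms(3) sets_surf_subset[OF assms(2,1)] assms(1) unfolding surf_subset_eq[OF assms(1,2) borel]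
    by (subst (asm) AE_restrict_space_iff) (simp_all add: Int_absorb2)
  then show ?thesis by eventually_elim (simp add: zero_ext_def)
qed

abbreviation tnorm :: "(real^'n) set \<Rightarrow> ((real^'n \<Rightarrow> real) \<Rightarrow> real) \<Rightarrow> ennreal" where
  "tnorm \<tau> \<xi> \<equiv> mhalf_tilde_norm \<Gamma> \<tau> (restrict_functional \<Gamma> \<tau> \<xi>)"

lemma tnorm_finite:
  assumes \<xi>: "\<xi> \<in> Hmhalf \<Gamma>" "\<xi> (\<lambda>_. 1) = 0"
  shows "tnorm \<tau> \<xi> < top"
proof -
  have "tnorm \<tau> \<xi> \<le> ennreal (dnorm \<xi> * mean_const)"
    unfolding mhalf_tilde_norm_def
  proof (intro SUP_least ennreal_ratio_le)
    fix v assume "v \<in> {v \<in> H00 \<Gamma> \<tau>. \<not> (AE x in surf \<tau>. v x = 0)}"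
    then have "v \<in> H00 \<Gamma> \<tau>" "zero_ext \<tau> v \<in> Hhalf \<Gamma>" by (auto simp: H00_def)
    then show "restrict_functional \<Gamma> \<tau> \<xi> v \<le> dnorm \<xi> * mean_const * H00_norm \<Gamma> \<tau> v"
      using functional_le_seminorm[OF \<xi>] by (simp add: restrict_functional_def H00_norm_def)
  qed (auto simp: dnorm_nonneg mean_const_nonneg H00_norm_nonneg)
  then show ?thesis by (rule le_less_trans) simp
qed

lemma functional_le_tnorm:
  assumes \<xi>: "\<xi> \<in> Hmhalf \<Gamma>" "\<xi> (\<lambda>_. 1) = 0" and \<tau>: "\<tau> \<subseteq> \<Gamma>" "\<tau> \<in> sets borel" and v: "v \<in> H00 \<Gamma> \<tau>"
  shows "\<xi> (zero_ext \<tau> v) \<le> enn2real (tnorm \<tau> \<xi>) * H00_norm \<Gamma> \<tau> v"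
proof -
  have ev: "zero_ext \<tau> v \<in> Hhalf \<Gamma>" using v by (simp add: H00_def)
  have t: "tnorm \<tau> \<xi> = ennreal (enn2real (tnorm \<tau> \<xi>))" using tnorm_finite[OF \<xi>] by simp
  consider "AE x in surf \<tau>. v x = 0" | "H00_norm \<Gamma> \<tau> v = 0" | "\<not> (AE x in surf \<tau>. v x = 0)" "H00_norm \<Gamma> \<tau> v > 0"
    using H00_norm_nonneg[of \<Gamma> \<tau> v] by (auto simp: less_le)
  then show ?thesis
  proof cases
    case 1
    then show ?thesis
      using Hmhalf_AE_zero[OF \<xi>(1) ev zero_ext_measure_zero[OF \<tau> 1]] by (simp add: H00_norm_nonneg)
  next
    case 2
    \<comment> \<open>The seminorm can vanish on a nonzero \<open>v\<close>, such as a constant on a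
      patch that is all of \<Gamma>; then the seminorm estimate gives
      \<open>\<xi> (zero_ext \<tau> v) \<le> 0\<close>.\<close>
    then show ?thesis using functional_le_seminorm[OF \<xi> ev] by (simp add: H00_norm_def)
  next
    case 3
    have "ennreal (restrict_functional \<Gamma> \<tau> \<xi> v) / ennreal (H00_norm \<Gamma> \<tau> v) \<le> tnorm \<tau> \<xi>"
      unfolding mhalf_tilde_norm_def using v 3 by (intro SUP_upper) auto
    then have "restrict_functional \<Gamma> \<tau> \<xi> v \<le> enn2real (tnorm \<tau> \<xi>) * H00_norm \<Gamma> \<tau> v"
      by (subst (asm) t) (rule ennreal_ratio_le_D[OF _ 3(2)], simp_all)
    then show ?thesis using v by (simp add: restrict_functional_def)
  qed
qed

text \<open>The supremum need not be attained, but if positive its half is exceeded by some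
  quotient; rescaling the test function normalises its energy.\<close>

lemma tnorm_almost_attained:
  assumes \<xi>: "\<xi> \<in> Hmhalf \<Gamma>" "\<xi> (\<lambda>_. 1) = 0"
  obtains w where "w \<in> Hhalf \<Gamma>" "\<And>x. x \<notin> \<tau> \<Longrightarrow> w x = 0"
    "half_seminorm_sq \<Gamma> w \<le> 1" "enn2real (tnorm \<tau> \<xi>) / 2 \<le> \<xi> w"
proof (cases "enn2real (tnorm \<tau> \<xi>) = 0")
  case True
  then show ?thesis using that[of "\<lambda>_. 0"] Hhalf_const[of 0] Hmhalf_zero[OF \<xi>(1)]
    by (simp add: half_seminorm_sq_def)
next
  case False
  define \<alpha> where "\<alpha> = enn2real (tnorm \<tau> \<xi>)"
  have \<alpha>: "\<alpha> > 0" using False by (simp add: \<alpha>_def less_le)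
  have t: "tnorm \<tau> \<xi> = ennreal \<alpha>" using tnorm_finite[OF \<xi>] by (simp add: \<alpha>_def)
  have "ennreal (\<alpha> / 2) < tnorm \<tau> \<xi>" unfolding t using \<alpha> by (intro ennreal_lessI) auto
  then obtain v where v: "v \<in> H00 \<Gamma> \<tau>" and
    gt: "ennreal (\<alpha> / 2) < ennreal (restrict_functional \<Gamma> \<tau> \<xi> v) / ennreal (H00_norm \<Gamma> \<tau> v)"
    unfolding mhalf_tilde_norm_def less_SUP_iff by blast
  define N where "N = H00_norm \<Gamma> \<tau> v"
  define e where "e = zero_ext \<tau> v"
  have e: "e \<in> Hhalf \<Gamma>" using v by (simp add: H00_def e_def)
  have N0: "N \<ge> 0" by (simp add: N_def H00_norm_nonneg)
  have re: "restrict_functional \<Gamma> \<tau> \<xi> v = \<xi> e" using v by (simp add: restrict_functional_def e_def)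
  have Nsq: "half_seminorm_sq \<Gamma> e = ennreal (N\<^sup>2)"
    using Hhalf_finite(2)[OF e] by (simp add: N_def H00_norm_def e_def)
  have "\<not> \<xi> e \<le> \<alpha> / 2 * N"
  proof
    assume "\<xi> e \<le> \<alpha> / 2 * N"
    then have "ennreal (\<xi> e) / ennreal N \<le> ennreal (\<alpha> / 2)" using \<alpha> N0 by (intro ennreal_ratio_le) auto
    then show False using gt by (simp add: re N_def[symmetric])
  qed
  then have ge: "\<alpha> / 2 * N < \<xi> e" by simp
  \<comment> \<open>Without energy the value \<open>\<xi> e\<close> would be at most 0, again
    because \<open>\<xi>\<close> annihilates the constants.\<close>
  have Np: "N > 0"
  proof (rule ccontr)
    assume "\<not> N > 0"
    then have "N = 0" using N0 by simp
    then show False using ge functional_le_seminorm[OF \<xi> e] Nsq by simp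
  qed
  \<comment> \<open>Written as a linear combination to match the form of
    \<open>Hhalf_lincomb\<close> and \<open>Hmhalf_linear\<close>.\<close>
  define w where "w x = (1 / N) * e x + 0 * e x" for x
  have wH: "w \<in> Hhalf \<Gamma>" unfolding w_def by (rule Hhalf_lincomb[OF e e])
  have "\<xi> w = \<xi> e / N" unfolding w_def using Hmhalf_linear[OF \<xi>(1) e e, of "1/N" 0] by simp
  then have "\<alpha> / 2 \<le> \<xi> w" using ge Np by (simp add: pos_le_divide_eq less_imp_le)
  moreover have "half_seminorm_sq \<Gamma> w \<le> 1"
  proof -
    note [measurable] = Hhalf_measurable[OF e]
    have "half_seminorm_sq \<Gamma> w = (\<integral>\<^sup>+z. ennreal ((1 / N)\<^sup>2) * ennreal (edens e z) \<partial>(surf \<Gamma> \<Otimes>\<^sub>M surf \<Gamma>))"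
      unfolding half_seminorm_sq_eq[OF Hhalf_measurable[OF wH]]
      by (intro nn_integral_cong) (simp add: ennreal_mult[symmetric] edens_nonneg, simp add: edens_def w_def right_diff_distrib[symmetric] diff_divide_distrib[symmetric] power_divide)
    also have "\<dots> = ennreal ((1 / N)\<^sup>2) * half_seminorm_sq \<Gamma> e"
      by (simp add: nn_integral_cmult half_seminorm_sq_eq)
    also have "\<dots> = ennreal ((1 / N)\<^sup>2 * N\<^sup>2)" unfolding Nsq by (rule ennreal_mult[symmetric]) auto
    also have "(1 / N)\<^sup>2 * N\<^sup>2 = 1" using Np by (simp add: power_divide)
    finally show ?thesis by simp
  qed
  moreover have "w x = 0" if "x \<notin> \<tau>" for x using that by (simp add: w_def e_def zero_ext_def)
  ultimately show ?thesis using that[OF wH] \<alpha>_def by blast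
qed

text \<open>Testing \<open>\<xi>\<close> with \<open>u\<close> gives at least \<open>S / 2\<close>,
  while the energy of \<open>u\<close> is at most \<open>2 * N * S\<close>; so \<open>S\<close> is
  bounded by a multiple of its own root, and one factor of \<open>S\<close> divides out. In the
  constant, 8 is 4 * 2: the square of the half-attained norms, and the two points of a
  difference.\<close>

lemma sum_tnorm_le:
  assumes m: "mesh \<kappa> q h \<T>" and \<xi>: "\<xi> \<in> Hmhalf \<Gamma>" "\<xi> (\<lambda>_. 1) = 0"
  shows "(\<Sum>y\<in>nodes \<T>. (enn2real (tnorm (patch \<T> y) \<xi>))\<^sup>2) \<le> 8 * overlap \<kappa> q * mean_const\<^sup>2 * (dnorm \<xi>)\<^sup>2"
proof -
  let ?Y = "nodes \<T>"
  define \<alpha> where "\<alpha> y = enn2real (tnorm (patch \<T> y) \<xi>)" for y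
  have fin: "finite ?Y" by (rule mesh_size(4)[OF m])
  have "\<forall>y. \<exists>w. w \<in> Hhalf \<Gamma> \<and> (\<forall>x. x \<notin> patch \<T> y \<longrightarrow> w x = 0) \<and> half_seminorm_sq \<Gamma> w \<le> 1 \<and> \<alpha> y / 2 \<le> \<xi> w"
    unfolding \<alpha>_def using tnorm_almost_attained[OF \<xi>] by metis
  from choice[OF this] obtain w where "\<forall>y. w y \<in> Hhalf \<Gamma> \<and> (\<forall>x. x \<notin> patch \<T> y \<longrightarrow> w y x = 0) \<and>
      half_seminorm_sq \<Gamma> (w y) \<le> 1 \<and> \<alpha> y / 2 \<le> \<xi> (w y)" ..
  then have w: "w y \<in> Hhalf \<Gamma>" "x \<notin> patch \<T> y \<Longrightarrow> w y x = 0" "half_seminorm_sq \<Gamma> (w y) \<le> 1" "\<alpha> y / 2 \<le> \<xi> (w y)" for y x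
    by auto
  define u where "u x = (\<Sum>y\<in>?Y. \<alpha> y * w y x)" for x
  have u: "u \<in> Hhalf \<Gamma>" unfolding u_def by (intro Hhalf_sum fin w)
  define S where "S = (\<Sum>y\<in>?Y. (\<alpha> y)\<^sup>2)"
  have S0: "S \<ge> 0" unfolding S_def by (intro sum_nonneg) auto
  define N where "N = overlap \<kappa> q"
  have N0: "N \<ge> 0" by (simp add: N_def overlap_nonneg)
  have "half_seminorm_sq \<Gamma> u \<le> ennreal (2 * N) * (\<Sum>y\<in>?Y. ennreal ((\<alpha> y)\<^sup>2) * half_seminorm_sq \<Gamma> (w y))"
    unfolding u_def N_def by (rule superposition_energy[OF m]) (use w in \<open>auto intro: Hhalf_measurable\<close>)
  also have "\<dots> \<le> ennreal (2 * N) * (\<Sum>y\<in>?Y. ennreal ((\<alpha> y)\<^sup>2) * 1)"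
    by (intro mult_left_mono sum_mono w) auto
  also have "\<dots> = ennreal (2 * N * S)" using N0 S0 by (simp add: S_def ennreal_mult)
  finally have Qu: "enn2real (half_seminorm_sq \<Gamma> u) \<le> 2 * N * S" using N0 S0 by (intro enn2real_leI) auto
  have "S / 2 = (\<Sum>y\<in>?Y. \<alpha> y * (\<alpha> y / 2))" by (simp add: S_def sum_divide_distrib power2_eq_square)
  also have "\<dots> \<le> (\<Sum>y\<in>?Y. \<alpha> y * \<xi> (w y))" by (intro sum_mono mult_left_mono w) (simp add: \<alpha>_def)
  also have "\<dots> = \<xi> u" unfolding u_def by (rule Hmhalf_sum[OF \<xi>(1) fin w(1), symmetric])
  also have "\<dots> \<le> dnorm \<xi> * mean_const * sqrt (enn2real (half_seminorm_sq \<Gamma> u))"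
    by (rule functional_le_seminorm[OF \<xi> u])
  also have "\<dots> \<le> dnorm \<xi> * mean_const * sqrt (2 * N * S)"
    using Qu dnorm_nonneg mean_const_nonneg by (intro mult_left_mono real_sqrt_le_mono) auto
  finally have le: "S / 2 \<le> dnorm \<xi> * mean_const * sqrt (2 * N * S)" .
  have "(S / 2)\<^sup>2 \<le> (dnorm \<xi> * mean_const * sqrt (2 * N * S))\<^sup>2" using le S0 by (intro power_mono) auto
  also have "\<dots> = (dnorm \<xi>)\<^sup>2 * mean_const\<^sup>2 * (2 * N * S)" using N0 S0 by (simp add: power_mult_distrib)
  finally have "S * S \<le> (8 * N * mean_const\<^sup>2 * (dnorm \<xi>)\<^sup>2) * S"
    by (simp add: power2_eq_square algebra_simps)
  then have "S \<le> 8 * N * mean_const\<^sup>2 * (dnorm \<xi>)\<^sup>2"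
    using S0 N0 by (cases "S = 0") (auto simp: mult_le_cancel_right)
  then show ?thesis by (simp add: S_def \<alpha>_def N_def)
qed

text \<open>The pieces \<open>\<phi> y x * (v x - c y)\<close> are admissible on the patches, and
  their energies add up to a multiple of that of \<open>v\<close>. That \<open>\<xi>\<close>
  annihilates 1 is part of the conclusion because the finiteness of the patch norms and the opposite
  estimate rest on it.\<close>

lemma dnorm_le_sum_tnorm:
  assumes C0: "C0 > 0"
  shows "\<exists>C>0. \<forall>h \<T> \<phi> \<xi>. mesh \<kappa> q h \<T> \<and> cutoffs C0 h \<T> \<phi> \<and> (\<forall>x\<in>\<Gamma>. (\<Sum>y\<in>nodes \<T>. \<phi> y x) = 1) \<and>
      \<xi> \<in> Hmhalf \<Gamma> \<and> (\<forall>y\<in>nodes \<T>. \<xi> (\<phi> y) = 0) \<longrightarrow>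
    \<xi> (\<lambda>_. 1) = 0 \<and> (dnorm \<xi>)\<^sup>2 \<le> C * (\<Sum>y\<in>nodes \<T>. (enn2real (tnorm (patch \<T> y) \<xi>))\<^sup>2)"
proof -
  obtain C where C: "C > 0" "\<And>h \<T> \<phi> v. mesh \<kappa> q h \<T> \<Longrightarrow> cutoffs C0 h \<T> \<phi> \<Longrightarrow> v \<in> Hhalf \<Gamma> \<Longrightarrow>
    (\<exists>c. (\<Sum>y\<in>nodes \<T>. half_seminorm_sq \<Gamma> (\<lambda>x. \<phi> y x * (v x - c y))) \<le> ennreal C * half_seminorm_sq \<Gamma> v)"
    using localization[OF C0, of \<kappa> q] by blast
  show ?thesis
  proof (intro exI[of _ C] conjI[OF C(1)] allI impI, elim conjE)
    fix h \<T> \<phi> \<xi>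
    assume m: "mesh \<kappa> q h \<T>" and \<phi>: "cutoffs C0 h \<T> \<phi>" and part: "\<forall>x\<in>\<Gamma>. (\<Sum>y\<in>nodes \<T>. \<phi> y x) = 1"
      and \<xi>: "\<xi> \<in> Hmhalf \<Gamma>" and orth: "\<forall>y\<in>nodes \<T>. \<xi> (\<phi> y) = 0"
    let ?Y = "nodes \<T>"
    have fin: "finite ?Y" by (rule mesh_size(4)[OF m])
    \<comment> \<open>The cut-off function is its product with the constant 1.\<close>
    have \<phi>H: "\<phi> y \<in> Hhalf \<Gamma>" if "y \<in> ?Y" for y
      using cutoff_mult_Hhalf[OF m \<phi> C0 that Hhalf_const[of 1], of 0] by simp
    have \<xi>1: "\<xi> (\<lambda>_. 1) = 0"
    proof -
      have "\<xi> (\<lambda>_. 1) = \<xi> (\<lambda>x. \<Sum>y\<in>?Y. 1 * \<phi> y x)"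
        using part by (intro Hmhalf_cong[OF \<xi> Hhalf_const]) simp
      also have "\<dots> = (\<Sum>y\<in>?Y. 1 * \<xi> (\<phi> y))" by (rule Hmhalf_sum[OF \<xi> fin \<phi>H])
      finally show ?thesis using orth by simp
    qed
    define \<alpha> where "\<alpha> y = enn2real (tnorm (patch \<T> y) \<xi>)" for y
    define S where "S = (\<Sum>y\<in>?Y. (\<alpha> y)\<^sup>2)"
    have S0: "S \<ge> 0" unfolding S_def by (intro sum_nonneg) auto
    have "\<xi> v \<le> sqrt (C * S) * Hhalf_norm \<Gamma> v" if v: "v \<in> Hhalf \<Gamma>" for v
    proof -
      obtain c where c: "(\<Sum>y\<in>?Y. half_seminorm_sq \<Gamma> (\<lambda>x. \<phi> y x * (v x - c y))) \<le> ennreal C * half_seminorm_sq \<Gamma> v"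
        using C(2)[OF m \<phi> v] by blast
      define g where "g y x = \<phi> y x * (v x - c y)" for y x
      have gH: "g y \<in> Hhalf \<Gamma>" if "y \<in> ?Y" for y
        unfolding g_def by (rule cutoff_mult_Hhalf[OF m \<phi> C0 that v])
      define \<beta> where "\<beta> y = sqrt (enn2real (half_seminorm_sq \<Gamma> (g y)))" for y
      have g\<beta>: "\<xi> (g y) \<le> \<alpha> y * \<beta> y" if y: "y \<in> ?Y" for y
      proof -
        let ?\<tau> = "patch \<T> y"
        note \<tau> = patch_subset[OF m, of y] patch_sets(2)[OF m, of y]
        have eq: "g y x = zero_ext ?\<tau> (g y) x" if "x \<in> \<Gamma>" for x
          using cutoffsD(1)[OF m \<phi> C0 y, of x] that by (simp add: zero_ext_def g_def)
        have H00: "g y \<in> H00 \<Gamma> ?\<tau>"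
          unfolding H00_def
          using Hhalf_restrict[OF \<tau> gH[OF y]] gH[OF y] Hhalf_cong(1)[of "g y" "zero_ext ?\<tau> (g y)", OF eq]
            by simp
        have "\<xi> (g y) = \<xi> (zero_ext ?\<tau> (g y))" by (rule Hmhalf_cong[OF \<xi> gH[OF y] eq])
        also have "\<dots> \<le> \<alpha> y * H00_norm \<Gamma> ?\<tau> (g y)" unfolding \<alpha>_def
          by (rule functional_le_tnorm[OF \<xi> \<xi>1 \<tau> H00])
        also have "H00_norm \<Gamma> ?\<tau> (g y) = \<beta> y"
          using half_seminorm_sq_cong[of "g y" "zero_ext ?\<tau> (g y)", OF eq] by (simp add: H00_norm_def \<beta>_def)
        finally show ?thesis .
      qed
      \<comment> \<open>The partition of unity splits \<open>v\<close> into the local pieces and a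
        combination of the cut-off functions, which \<open>\<xi>\<close> annihilates. So the
        \<open>c y\<close> may depend on \<open>v\<close> freely.\<close>
      have "\<xi> v = \<xi> (\<lambda>x. 1 * (\<Sum>y\<in>?Y. 1 * g y x) + 1 * (\<Sum>y\<in>?Y. c y * \<phi> y x))"
      proof (rule Hmhalf_cong[OF \<xi> v])
        fix x assume "x \<in> \<Gamma>"
        have "(\<Sum>y\<in>?Y. g y x) + (\<Sum>y\<in>?Y. c y * \<phi> y x) = (\<Sum>y\<in>?Y. \<phi> y x * v x)"
          unfolding sum.distrib[symmetric] by (intro sum.cong refl) (simp add: g_def algebra_simps)
        also have "\<dots> = v x" using part \<open>x \<in> \<Gamma>\<close> by (simp add: sum_distrib_right[symmetric])
        finally show "v x = 1 * (\<Sum>y\<in>?Y. 1 * g y x) + 1 * (\<Sum>y\<in>?Y. c y * \<phi> y x)" by simp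
      qed
      also have "\<dots> = 1 * \<xi> (\<lambda>x. \<Sum>y\<in>?Y. 1 * g y x) + 1 * \<xi> (\<lambda>x. \<Sum>y\<in>?Y. c y * \<phi> y x)"
        by (rule Hmhalf_linear[OF \<xi>]) (intro Hhalf_sum fin gH \<phi>H, assumption)+
      also have "\<xi> (\<lambda>x. \<Sum>y\<in>?Y. 1 * g y x) = (\<Sum>y\<in>?Y. 1 * \<xi> (g y))" by (rule Hmhalf_sum[OF \<xi> fin gH])
      also have "\<xi> (\<lambda>x. \<Sum>y\<in>?Y. c y * \<phi> y x) = (\<Sum>y\<in>?Y. c y * \<xi> (\<phi> y))" by (rule Hmhalf_sum[OF \<xi> fin \<phi>H])
      also have "\<dots> = 0" using orth by simp
      also have "1 * (\<Sum>y\<in>?Y. 1 * \<xi> (g y)) + 1 * 0 \<le> (\<Sum>y\<in>?Y. \<alpha> y * \<beta> y)" using g\<beta> by (simp add: sum_mono)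
      also have "\<dots> \<le> sqrt ((\<Sum>y\<in>?Y. (\<alpha> y)\<^sup>2) * (\<Sum>y\<in>?Y. (\<beta> y)\<^sup>2))"
        by (rule real_le_rsqrt) (rule Cauchy_Schwarz_ineq_sum)
      also have "\<dots> \<le> sqrt (S * (C * (Hhalf_norm \<Gamma> v)\<^sup>2))"
      proof (intro real_sqrt_le_mono)
        have "ennreal (\<Sum>y\<in>?Y. (\<beta> y)\<^sup>2) = (\<Sum>y\<in>?Y. half_seminorm_sq \<Gamma> (g y))"
          using Hhalf_finite(2)[OF gH] by (simp add: \<beta>_def sum_ennreal[symmetric] less_top)
        also have "\<dots> \<le> ennreal C * half_seminorm_sq \<Gamma> v" using c unfolding g_def .
        also have "\<dots> \<le> ennreal C * (L2_sq \<Gamma> v + half_seminorm_sq \<Gamma> v)" by (intro mult_left_mono) auto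
        also have "\<dots> = ennreal C * ennreal ((Hhalf_norm \<Gamma> v)\<^sup>2)"
          using Hhalf_finite[OF v] by (simp add: Hhalf_norm_def)
        also have "\<dots> = ennreal (C * (Hhalf_norm \<Gamma> v)\<^sup>2)" using C(1) by (simp add: ennreal_mult)
        finally have "(\<Sum>y\<in>?Y. (\<beta> y)\<^sup>2) \<le> C * (Hhalf_norm \<Gamma> v)\<^sup>2" using C(1)
          by (subst (asm) ennreal_le_iff) auto
        then show "(\<Sum>y\<in>?Y. (\<alpha> y)\<^sup>2) * (\<Sum>y\<in>?Y. (\<beta> y)\<^sup>2) \<le> S * (C * (Hhalf_norm \<Gamma> v)\<^sup>2)"
          unfolding S_def[symmetric] by (rule mult_left_mono[OF _ S0])
      qed
      also have "\<dots> = sqrt (C * S) * Hhalf_norm \<Gamma> v"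
        using Hhalf_norm_nonneg[of \<Gamma> v] by (simp add: real_sqrt_mult mult_ac)
      finally show ?thesis .
    qed
    then have "mhalf_norm \<Gamma> \<xi> \<le> ennreal (sqrt (C * S))" using C(1) S0 by (intro mhalf_norm_le) auto
    then have "dnorm \<xi> \<le> sqrt (C * S)" unfolding dnorm_def using C(1) S0 by (intro enn2real_leI) auto
    then have "(dnorm \<xi>)\<^sup>2 \<le> (sqrt (C * S))\<^sup>2" using dnorm_nonneg by (intro power_mono) auto
    then have "(dnorm \<xi>)\<^sup>2 \<le> C * S" using C(1) S0 by simp
    then show "\<xi> (\<lambda>_. 1) = 0 \<and> (dnorm \<xi>)\<^sup>2 \<le> C * (\<Sum>y\<in>?Y. (enn2real (tnorm (patch \<T> y) \<xi>))\<^sup>2)"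
      using \<xi>1 by (simp add: S_def \<alpha>_def)
  qed
qed

text \<open>Both estimates for \<open>\<xi>\<close> bound the patch sum by its global dual norm
  \<open>X\<close> from either side. The triangle inequality between \<open>Z\<close>,
  \<open>p\<close> and \<open>X\<close>, together with the bound for the operator, replaces
  \<open>X\<close> by the norm of \<open>\<zeta>\<close>.\<close>

lemma norm_equivalence:
  assumes "C0 > 0"
  shows "\<exists>c>0. \<exists>C>0. \<forall>h \<T> P.
      mesh \<kappa> q h \<T> \<and> Hmhalf_projector \<Gamma> P \<and>
      (\<forall>\<zeta>\<in>Hmhalf \<Gamma>. mhalf_norm \<Gamma> (P \<zeta>) \<le> ennreal M * mhalf_norm \<Gamma> \<zeta>) \<and>
      (\<exists>\<phi>. cutoffs C0 h \<T> \<phi> \<and> (\<forall>x\<in>\<Gamma>. (\<Sum>y\<in>nodes \<T>. \<phi> y x) = 1) \<and>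
         (\<forall>\<zeta>\<in>Hmhalf \<Gamma>. \<forall>y\<in>nodes \<T>. \<zeta> (\<phi> y) - P \<zeta> (\<phi> y) = 0)) \<longrightarrow>
      (\<forall>\<zeta>\<in>Hmhalf \<Gamma>.
         ennreal c * (mhalf_norm \<Gamma> \<zeta>)\<^sup>2 \<le>
           (mhalf_norm \<Gamma> (P \<zeta>))\<^sup>2 + (\<Sum>y\<in>nodes \<T>. (tnorm (patch \<T> y) (\<lambda>v. \<zeta> v - P \<zeta> v))\<^sup>2) \<and>
         (mhalf_norm \<Gamma> (P \<zeta>))\<^sup>2 + (\<Sum>y\<in>nodes \<T>. (tnorm (patch \<T> y) (\<lambda>v. \<zeta> v - P \<zeta> v))\<^sup>2)
           \<le> ennreal C * (mhalf_norm \<Gamma> \<zeta>)\<^sup>2)"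
proof -
  obtain C1 where C1: "C1 > 0" "\<And>h \<T> \<phi> \<xi>. mesh \<kappa> q h \<T> \<Longrightarrow> cutoffs C0 h \<T> \<phi> \<Longrightarrow>
      (\<forall>x\<in>\<Gamma>. (\<Sum>y\<in>nodes \<T>. \<phi> y x) = 1) \<Longrightarrow> \<xi> \<in> Hmhalf \<Gamma> \<Longrightarrow> (\<forall>y\<in>nodes \<T>. \<xi> (\<phi> y) = 0) \<Longrightarrow>
    \<xi> (\<lambda>_. 1) = 0 \<and> (dnorm \<xi>)\<^sup>2 \<le> C1 * (\<Sum>y\<in>nodes \<T>. (enn2real (tnorm (patch \<T> y) \<xi>))\<^sup>2)"
    using dnorm_le_sum_tnorm[OF assms, of \<kappa> q] by blast
  define C2 where "C2 = 8 * overlap \<kappa> q * mean_const\<^sup>2"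
  have C2: "C2 \<ge> 0" by (simp add: C2_def overlap_nonneg)
  \<comment> \<open>\<open>ennreal M\<close> is 0 for negative \<open>M\<close>, so the effective
    operator bound is \<open>max 0 M\<close>.\<close>
  define m where "m = max 0 M"
  have m0: "m \<ge> 0" by (simp add: m_def)
  show ?thesis
  \<comment> \<open>The lower constant comes from
    \<open>Z\<^sup>2 \<le> 2 * p\<^sup>2 + 2 * X\<^sup>2\<close> and
    \<open>X\<^sup>2 \<le> C1 * S\<close>; the upper one from \<open>p \<le> m * Z\<close> and
    \<open>X \<le> (1 + m) * Z\<close>, with 1 added for positivity.\<close>
  proof (rule exI[of _ "1 / (2 + 2 * C1)"], rule conjI, use C1(1) in simp,
      rule exI[of _ "m\<^sup>2 + C2 * (1 + m)\<^sup>2 + 1"], rule conjI, use C2 in \<open>simp add: add_nonneg_pos\<close>,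
      intro allI impI ballI, elim conjE exE)
    fix h \<T> P \<zeta> \<phi>
    assume mesh: "mesh \<kappa> q h \<T>" and P: "Hmhalf_projector \<Gamma> P"
      and bd: "\<forall>\<zeta>\<in>Hmhalf \<Gamma>. mhalf_norm \<Gamma> (P \<zeta>) \<le> ennreal M * mhalf_norm \<Gamma> \<zeta>"
      and \<phi>: "cutoffs C0 h \<T> \<phi>" "\<forall>x\<in>\<Gamma>. (\<Sum>y\<in>nodes \<T>. \<phi> y x) = 1"
      and orth: "\<forall>\<zeta>\<in>Hmhalf \<Gamma>. \<forall>y\<in>nodes \<T>. \<zeta> (\<phi> y) - P \<zeta> (\<phi> y) = 0" and \<zeta>: "\<zeta> \<in> Hmhalf \<Gamma>"
    have P\<zeta>: "P \<zeta> \<in> Hmhalf \<Gamma>" using P \<zeta> by (simp add: Hmhalf_projector_def)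
    define \<xi> where "\<xi> v = \<zeta> v - P \<zeta> v" for v
    have \<xi>: "\<xi> \<in> Hmhalf \<Gamma>" unfolding \<xi>_def by (rule Hmhalf_diff[OF \<zeta> P\<zeta>])
    have \<xi>0: "\<forall>y\<in>nodes \<T>. \<xi> (\<phi> y) = 0" using orth \<zeta> by (simp add: \<xi>_def)
    define S where "S = (\<Sum>y\<in>nodes \<T>. (enn2real (tnorm (patch \<T> y) \<xi>))\<^sup>2)"
    have S0: "S \<ge> 0" unfolding S_def by (intro sum_nonneg) auto
    have \<xi>1: "\<xi> (\<lambda>_. 1) = 0" and low: "(dnorm \<xi>)\<^sup>2 \<le> C1 * S"
      using C1(2)[OF mesh \<phi> \<xi> \<xi>0] by (simp_all add: S_def)
    have up: "S \<le> C2 * (dnorm \<xi>)\<^sup>2" unfolding S_def C2_def by (rule sum_tnorm_le[OF mesh \<xi> \<xi>1])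
    have SS: "(\<Sum>y\<in>nodes \<T>. (tnorm (patch \<T> y) (\<lambda>v. \<zeta> v - P \<zeta> v))\<^sup>2) = ennreal S"
    proof -
      have "(tnorm (patch \<T> y) (\<lambda>v. \<zeta> v - P \<zeta> v))\<^sup>2 = ennreal ((enn2real (tnorm (patch \<T> y) \<xi>))\<^sup>2)" for y
      proof -
        have "tnorm (patch \<T> y) \<xi> = ennreal (enn2real (tnorm (patch \<T> y) \<xi>))" using tnorm_finite[OF \<xi> \<xi>1]
          by simp
        then have "(tnorm (patch \<T> y) \<xi>)\<^sup>2 = (ennreal (enn2real (tnorm (patch \<T> y) \<xi>)))\<^sup>2"
          by (rule arg_cong)
        also have "\<dots> = ennreal ((enn2real (tnorm (patch \<T> y) \<xi>))\<^sup>2)" by (rule ennreal_power) simp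
        finally show ?thesis unfolding \<xi>_def .
      qed
      then show ?thesis by (simp add: S_def sum_ennreal)
    qed
    define Z where "Z = dnorm \<zeta>"
    define p where "p = dnorm (P \<zeta>)"
    define X where "X = dnorm \<xi>"
    have nn: "Z \<ge> 0" "p \<ge> 0" "X \<ge> 0" by (simp_all add: Z_def p_def X_def dnorm_nonneg)
    have Z: "mhalf_norm \<Gamma> \<zeta> = ennreal Z" and p: "mhalf_norm \<Gamma> (P \<zeta>) = ennreal p"
      by (simp_all add: Z_def p_def mhalf_norm_eq_dnorm \<zeta> P\<zeta>)
    have "ennreal p \<le> ennreal M * ennreal Z" using bd \<zeta> Z p by metis
    also have "\<dots> = ennreal (m * Z)" using nn by (simp add: m_def ennreal_mult' max_def ennreal_neg)
    finally have pM: "p \<le> m * Z" using nn m0 by (subst (asm) ennreal_le_iff) auto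
    have "mhalf_norm \<Gamma> \<zeta> \<le> ennreal (p + X)"
    proof (rule mhalf_norm_le)
      fix v assume v: "v \<in> Hhalf \<Gamma>"
      have "\<zeta> v = P \<zeta> v + \<xi> v" by (simp add: \<xi>_def)
      then show "\<zeta> v \<le> (p + X) * Hhalf_norm \<Gamma> v"
        using functional_le[OF P\<zeta> v] functional_le[OF \<xi> v] by (simp add: p_def X_def distrib_right)
    qed (use nn in simp)
    then have ZpX: "Z \<le> p + X" unfolding Z using nn by (subst (asm) ennreal_le_iff) auto
    have "mhalf_norm \<Gamma> \<xi> \<le> ennreal (Z + p)"
    proof (rule mhalf_norm_le)
      fix v assume v: "v \<in> Hhalf \<Gamma>"
      \<comment> \<open>\<open>functional_le\<close> bounds values from above only; a lower bound
        for \<open>P \<zeta> v\<close> results from applying it to \<open>- v\<close>.\<close>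
      have mv: "(\<lambda>x. (-1) * v x + 0 * v x) \<in> Hhalf \<Gamma>" by (rule Hhalf_lincomb[OF v v])
      have "P \<zeta> (\<lambda>x. (-1) * v x + 0 * v x) = - P \<zeta> v" using Hmhalf_linear[OF P\<zeta> v v, of "-1" 0] by simp
      moreover have "Hhalf_norm \<Gamma> (\<lambda>x. (-1) * v x + 0 * v x) = Hhalf_norm \<Gamma> v"
        by (simp add: Hhalf_norm_def L2_sq_def half_seminorm_sq_def power2_commute)
      ultimately have "- P \<zeta> v \<le> p * Hhalf_norm \<Gamma> v" using functional_le[OF P\<zeta> mv] by (simp add: p_def)
      then show "\<xi> v \<le> (Z + p) * Hhalf_norm \<Gamma> v"
        using functional_le[OF \<zeta> v] by (simp add: \<xi>_def Z_def distrib_right)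
    qed (use nn in simp)
    then have XZ: "X \<le> Z + p"
      unfolding mhalf_norm_eq_dnorm[OF \<xi>] X_def[symmetric] using nn by (subst (asm) ennreal_le_iff) auto
    have lower: "1 / (2 + 2 * C1) * Z\<^sup>2 \<le> p\<^sup>2 + S"
    proof -
      have "Z\<^sup>2 \<le> (p + X)\<^sup>2" using ZpX nn by (intro power_mono) auto
      also have "\<dots> \<le> 2 * p\<^sup>2 + 2 * X\<^sup>2" using sq_lincomb_le[of 1 p 1 X] by simp
      also have "\<dots> \<le> 2 * p\<^sup>2 + 2 * (C1 * S)" using low by (simp add: X_def)
      also have "\<dots> \<le> (2 + 2 * C1) * (p\<^sup>2 + S)"
        using C1(1) S0 by (simp add: algebra_simps)
      finally show ?thesis using C1(1) by (simp add: pos_divide_le_eq mult.commute)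
    qed
    have upper: "p\<^sup>2 + S \<le> (m\<^sup>2 + C2 * (1 + m)\<^sup>2 + 1) * Z\<^sup>2"
    proof -
      have 1: "p\<^sup>2 \<le> m\<^sup>2 * Z\<^sup>2" using pM nn by (metis power_mono power_mult_distrib)
      have "X \<le> (1 + m) * Z" using XZ pM by (simp add: distrib_right)
      then have "X\<^sup>2 \<le> (1 + m)\<^sup>2 * Z\<^sup>2" using nn by (metis power_mono power_mult_distrib)
      then have "C2 * X\<^sup>2 \<le> C2 * ((1 + m)\<^sup>2 * Z\<^sup>2)" using C2 by (intro mult_left_mono)
      then have "S \<le> C2 * ((1 + m)\<^sup>2 * Z\<^sup>2)" using up by (simp add: X_def)
      moreover have "0 \<le> Z\<^sup>2" by simp
      ultimately show ?thesis using 1 unfolding distrib_right mult.assoc mult_1_left by linarith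
    qed
    have "ennreal (1 / (2 + 2 * C1)) * (mhalf_norm \<Gamma> \<zeta>)\<^sup>2 = ennreal (1 / (2 + 2 * C1) * Z\<^sup>2)"
      unfolding Z using nn C1(1) by (simp add: ennreal_power ennreal_mult[symmetric])
    moreover have "(mhalf_norm \<Gamma> (P \<zeta>))\<^sup>2 + ennreal S = ennreal (p\<^sup>2 + S)"
      unfolding p using nn S0 by (simp add: ennreal_power ennreal_plus)
    moreover have "ennreal (m\<^sup>2 + C2 * (1 + m)\<^sup>2 + 1) * (mhalf_norm \<Gamma> \<zeta>)\<^sup>2 = ennreal ((m\<^sup>2 + C2 * (1 + m)\<^sup>2 + 1) * Z\<^sup>2)"
    proof -
      have "0 \<le> m\<^sup>2 + C2 * (1 + m)\<^sup>2 + 1" using C2 by simp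
      then show ?thesis unfolding Z ennreal_power[OF nn(1)] by (rule ennreal_mult[symmetric]) simp
    qed
    ultimately show "ennreal (1 / (2 + 2 * C1)) * (mhalf_norm \<Gamma> \<zeta>)\<^sup>2 \<le>
           (mhalf_norm \<Gamma> (P \<zeta>))\<^sup>2 + (\<Sum>y\<in>nodes \<T>. (tnorm (patch \<T> y) (\<lambda>v. \<zeta> v - P \<zeta> v))\<^sup>2) \<and>
         (mhalf_norm \<Gamma> (P \<zeta>))\<^sup>2 + (\<Sum>y\<in>nodes \<T>. (tnorm (patch \<T> y) (\<lambda>v. \<zeta> v - P \<zeta> v))\<^sup>2)
           \<le> ennreal (m\<^sup>2 + C2 * (1 + m)\<^sup>2 + 1) * (mhalf_norm \<Gamma> \<zeta>)\<^sup>2"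
      unfolding SS using lower upper by (simp only: ennreal_leI)
  qed
qed

end

lemma admissible_domain_lipschitz_surface:
  fixes \<Omega> :: "(real^'n) set"
  assumes "2 \<le> CARD('n)" "admissible_domain \<Omega>"
    and "measure_space UNIV (sets borel) (hausdorff_outer (CARD('n) - 1) :: (real^'n) set \<Rightarrow> ennreal)"
  obtains r0 L K where "lipschitz_surface (frontier \<Omega>) r0 L K"
proof -
  have \<Omega>: "open \<Omega>" "\<Omega> \<noteq> {}" "bounded \<Omega>" "lipschitz_boundary \<Omega>"
    using assms(2) by (auto simp: admissible_domain_def)
  obtain K where K: "\<forall>x\<in>frontier \<Omega>. \<forall>y\<in>frontier \<Omega>. geodesic_dist (frontier \<Omega>) x y \<le> ennreal (K * dist x y)"
    using assms(2) unfolding admissible_domain_def by (elim conjE exE) (rule that)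
  obtain r L where rL: "r > 0" "L \<ge> 0"
    "\<forall>x\<in>frontier \<Omega>. \<exists>e g. norm e = 1 \<and> L-lipschitz_on {w. w \<bullet> e = 0} g \<and>
      frontier \<Omega> \<inter> ball x r = {y\<in>ball x r. g (hproj e y) = y \<bullet> e}"
    by (rule uniform_charts[OF \<Omega>(1,3,4)])
  \<comment> \<open>A set that is neither empty nor the whole space has a nonempty frontier, by
    connectedness of the space.\<close>
  have "\<Omega> \<noteq> UNIV" using \<Omega>(3) not_bounded_UNIV by blast
  then have "frontier \<Omega> \<noteq> {}" using \<Omega>(2) by (simp add: frontier_eq_empty)
  moreover have "geodesic_dist (frontier \<Omega>) x y \<le> ennreal (max 1 K * dist x y)"
    if "x \<in> frontier \<Omega>" "y \<in> frontier \<Omega>" for x y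
  proof -
    have "geodesic_dist (frontier \<Omega>) x y \<le> ennreal (K * dist x y)" using K that by blast
    also have "\<dots> \<le> ennreal (max 1 K * dist x y)" by (intro ennreal_leI mult_right_mono) auto
    finally show ?thesis .
  qed
  ultimately have "lipschitz_surface (frontier \<Omega>) r L (max 1 K)"
    using rL assms(1,3) \<Omega>(3) by unfold_locales auto
  then show ?thesis by (rule that)
qed

text \<open>The value of \<^const>\<open>measure_of\<close> on a set function that is not a measure is the null
  measure. Hence it need not be shown that the Hausdorff outer measure is a measure on the Borel
  sets: otherwise all the norms vanish.\<close>

lemma degenerate_hausdorff:
  fixes \<tau> :: "(real^'n) set"
  assumes "\<not> measure_space UNIV (sets borel) (hausdorff_outer (CARD('n) - 1) :: (real^'n) set \<Rightarrow> ennreal)"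
  shows "AE x in surf \<tau>. Q x"
proof -
  have "emeasure (hausdorff_measure (CARD('n) - 1) :: (real^'n) measure) A = 0" for A
    unfolding hausdorff_measure_def emeasure_measure_of_conv
    using assms sets.sigma_sets_eq[of "borel :: (real^'n) measure"] by simp
  then have "emeasure (surf \<tau>) (space (surf \<tau>)) = 0"
    unfolding surf_def restrict_space_def emeasure_measure_of_conv by simp
  then have "space (surf \<tau>) \<in> null_sets (surf \<tau>)" by (intro null_setsI sets.top)
  then show ?thesis by (rule AE_I') auto
qed

theorem corollary4p3:
  fixes \<Omega> :: "(real^'n) set" and \<Gamma> :: "(real^'n) set" and \<kappa> q C0 M :: real
  assumes "CARD('n) = 2 \<or> CARD('n) = 3"
    and "admissible_domain \<Omega>"
    and "\<Gamma> = frontier \<Omega>"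
    and "C0 > 0"
  shows "\<exists>c>0. \<exists>C>0.
    \<forall>(h::real) (\<T> :: (real^'n \<Rightarrow> real^'n) set)
      (P :: ((real^'n \<Rightarrow> real) \<Rightarrow> real) \<Rightarrow> ((real^'n \<Rightarrow> real) \<Rightarrow> real)).
      h > 0 \<and> conforming_mesh \<Gamma> \<T> \<and> quasi_uniform q h \<T> \<and> shape_regular \<Gamma> \<kappa> \<T> \<and>
      Hmhalf_projector \<Gamma> P \<and>
      (\<forall>\<zeta>\<in>Hmhalf \<Gamma>. mhalf_norm \<Gamma> (P \<zeta>) \<le> ennreal M * mhalf_norm \<Gamma> \<zeta>) \<and>
      (\<exists>\<phi> :: real^'n \<Rightarrow> real^'n \<Rightarrow> real.
         (\<forall>y\<in>nodes \<T>. \<phi> y \<in> W1inf_0 \<Gamma> (patch \<T> y) \<and>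
            Linf_norm (patch \<T> y) (\<phi> y) \<le> ennreal C0 \<and>
            W1inf_seminorm (patch \<T> y) (\<phi> y) \<le> ennreal (C0 / h)) \<and>
         (\<forall>x\<in>\<Gamma>. (\<Sum>y\<in>nodes \<T>. \<phi> y x) = 1) \<and>
         (\<forall>\<zeta>\<in>Hmhalf \<Gamma>. \<forall>y\<in>nodes \<T>. \<zeta> (\<phi> y) - P \<zeta> (\<phi> y) = 0))
      \<longrightarrow>
      (\<forall>\<zeta>\<in>Hmhalf \<Gamma>.
         ennreal c * (mhalf_norm \<Gamma> \<zeta>)\<^sup>2 \<le>
           (mhalf_norm \<Gamma> (P \<zeta>))\<^sup>2 +
           (\<Sum>y\<in>nodes \<T>. (mhalf_tilde_norm \<Gamma> (patch \<T> y)
               (restrict_functional \<Gamma> (patch \<T> y) (\<lambda>v. \<zeta> v - P \<zeta> v)))\<^sup>2) \<and>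
         (mhalf_norm \<Gamma> (P \<zeta>))\<^sup>2 +
           (\<Sum>y\<in>nodes \<T>. (mhalf_tilde_norm \<Gamma> (patch \<T> y)
               (restrict_functional \<Gamma> (patch \<T> y) (\<lambda>v. \<zeta> v - P \<zeta> v)))\<^sup>2)
           \<le> ennreal C * (mhalf_norm \<Gamma> \<zeta>)\<^sup>2)"
proof (cases "measure_space UNIV (sets borel) (hausdorff_outer (CARD('n) - 1) :: (real^'n) set \<Rightarrow> ennreal)")
  case True
  have "2 \<le> CARD('n)" using assms(1) by auto
  then obtain r0 L K where surface: "lipschitz_surface \<Gamma> r0 L K"
    using admissible_domain_lipschitz_surface[OF _ assms(2) True] unfolding assms(3) by blast
  from lipschitz_surface.norm_equivalence[OF surface assms(4), of \<kappa> q M]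
  show ?thesis
    unfolding lipschitz_surface.mesh_def[OF surface] lipschitz_surface.cutoffs_def[OF surface] conj_assoc .
next
  case False
  \<comment> \<open>Every function now vanishes almost everywhere, so the supremum runs over the
    empty set; the same holds on the patches, and any positive constants will do.\<close>
  have "mhalf_norm \<Gamma> \<zeta> = 0" for \<zeta>
    unfolding mhalf_norm_def using degenerate_hausdorff[OF False] by (simp add: bot_ennreal)
  moreover have "mhalf_tilde_norm \<Gamma> \<tau> \<zeta> = 0" for \<tau> \<zeta>
    unfolding mhalf_tilde_norm_def using degenerate_hausdorff[OF False] by (simp add: bot_ennreal)
  ultimately show ?thesis by (intro exI[of _ "1::real"] conjI allI impI ballI) simp_all
qed

end
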